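(* Let $K$ be a field containing $\mathbb{F}_q$, and let $\phi$ be a pure Anderson $t$-module over $K$ of dimension $d$ and weight $w$. Then there exist a finite extension $L$ of $K$ and an almost strictly pure $t$-module $\psi$ over $L$ such that the base extension of $\phi$ to $L$ is isomorphic to $\psi$. The $t$-module $\psi$ over $L$ can be chosen to be strictly pure if and only if $\frac1w\in\mathbb{Z}$.
   Context: $\mathbb{F}_q$ is the finite field with $q$ elements, $K$ is a field containing $\mathbb{F}_q$, $\theta\in K$ is a fixed element, and $\mathbb{K}$ is an algebraic closure of $K$. For a field $F\supseteq\mathbb{F}_q$, $F\{\tau\}$ is the skew polynomial ring with $\tau\alpha=\alpha^q\tau$ for $\alpha\in F$; $F\{\tau,t\}$ is the skew polynomial ring in $\tau,t$ with in addition $t\alpha=\alpha t$ for $\alpha\in F$, and $t\tau=\tau t$. For $d>0$, a $d$-dimensional Anderson $t$-module over a field $F\ni\theta$ is an $\mathbb{F}_q$-algebra homomorphism $\phi:\mathbb{F}_q[t]\to\mathrm{Mat}_d(F\{\tau\})$, $a\mapsto\phi_a$, such that $\partial\phi_t-\theta\mathbb{I}_d$ is nilpotent, where $\partial(\sum_i B_i\tau^i)=B_0$ for $B_i\in\mathrm{Mat}_d(F)$. Two $d$-dimensional $t$-modules $\phi,\psi$ over $F$ are isomorphic if there is $U\in\mathrm{GL}_d(F\{\tau\})$ with $U\phi_a=\psi_aU$ for all $a\in\mathbb{F}_q[t]$. The base extension $\phi^L$ of $\phi$ to an extension $L$ of $K$ is the composite $\mathbb{F}_q[t]\to\mathrm{Mat}_d(K\{\tau\})\hookrightarrow\mathrm{Mat}_d(L\{\tau\})$.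 The associated left $K\{\tau,t\}$-module is $\mathsf{M}_\phi=\mathrm{Mat}_{1\times d}(K\{\tau\})$ with left multiplication by $K\{\tau\}$ and $t\cdot x=x\phi_t$. $\phi$ is abelian if $\mathsf{M}_\phi$ is free of finite rank over $K[t]$; this rank $r$ is the rank of $\phi$. An abelian $\phi$ is pure if there are positive integers $u,v$ and a $\mathbb{K}[\![\frac1t]\!]$-lattice $\tilde\Lambda$ (the $\mathbb{K}[\![\frac1t]\!]$-span of a $\mathbb{K}(\!(\frac1t)\!)$-basis) in $\mathbb{K}(\!(\frac1t)\!)\otimes_{K[t]}\mathsf{M}_\phi$ such that $t^u\tilde\Lambda=\tau^v\tilde\Lambda$, where $\tau(f\otimes m)=f^{(1)}\otimes\tau m$ and $f^{(1)}$ is obtained from $f$ by raising all coefficients to the $q$-th power. The weight of a pure $\phi$ is $w=d/r$ (which equals $u/v$). A $d$-dimensional $t$-module $\psi$ over $F$ is almost strictly pure if for some integer $n\ge1$, writing $\psi_{t^n}=B_0+B_1\tau+\cdots+B_s\tau^s$ with $B_j\in\mathrm{Mat}_d(F)$ and $B_s\neq0$, one has $B_s\in\mathrm{GL}_d(F)$. It is strictly pure if this holds with $n=1$. *)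

theory Defs
  imports
    "HOL-Algebra.Algebraic_Closure_Type"
    "HOL-Algebra.Free_Abelian_Groups"
    "HOL-Computational_Algebra.Formal_Laurent_Series"
    "Jordan_Normal_Form.Matrix"
begin

no_notation fls_nth (infixl \<open>$$\<close> 75)

text \<open>
  The algebraic closure of the base field is a type \<open>'a\<close>; the finite field, the base field and
  all its finite extensions are subsets of it that are subfields of the following ring.
  Every finite extension of the base field embeds into its algebraic closure.
\<close>

abbreviation ambient :: "'a::field ring"  (\<open>\<AA>\<close>)
  where "\<AA> \<equiv> ring_of_type_algebra"

definition finite_extension_field :: "'a::field set \<Rightarrow> 'a set \<Rightarrow> bool"
  where "finite_extension_field K L \<longleftrightarrow>
    subfield L \<AA> \<and> K \<subseteq> L \<and> ring.finite_dimension \<AA> K L"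

definition polys_over :: "'a::field set \<Rightarrow> 'a poly set"
  where "polys_over F = {p. range (poly.coeff p) \<subseteq> F}"

definition poly_ring_over :: "'a::field set \<Rightarrow> 'a poly ring"
  where "poly_ring_over F = ring_of_type_algebra\<lparr>carrier := polys_over F\<rparr>"

definition mats_over :: "'b set \<Rightarrow> nat \<Rightarrow> nat \<Rightarrow> 'b mat set"
  where "mats_over S m n = {A \<in> carrier_mat m n. elements_mat A \<subseteq> S}"

definition matrix_ring_over :: "'a::field set \<Rightarrow> nat \<Rightarrow> 'a mat ring"
  where "matrix_ring_over F d =
    \<lparr>carrier = mats_over F d d, monoid.mult = (*),
     monoid.one = 1\<^sub>m d, ring.zero = 0\<^sub>m d d, ring.add = (+)\<rparr>"


section \<open>Skew polynomials\<close>

text \<open>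
  An element \<open>\<Sum>\<^sub>i a\<^sub>i \<tau>\<^sup>i\<close> of the skew polynomial ring is represented by the value of type
  \<open>'a poly\<close> with coefficients \<open>a\<^sub>i\<close>. Addition and left multiplication by scalars are those of
  \<open>'a poly\<close>, whereas the product is determined by \<open>\<tau> a = a\<^sup>q \<tau>\<close>. The parameter \<open>Fq\<close> is the
  finite field, so that \<open>q = card Fq\<close>. A matrix \<open>\<Sum>\<^sub>j B\<^sub>j \<tau>\<^sup>j\<close> has type \<open>'a poly mat\<close>.
\<close>

definition skew_mult :: "'a::field set \<Rightarrow> 'a poly \<Rightarrow> 'a poly \<Rightarrow> 'a poly"
  where "skew_mult Fq f g = (\<Sum>i\<le>Polynomial.degree f. \<Sum>j\<le>Polynomial.degree g.
    Polynomial.monom (poly.coeff f i * poly.coeff g j ^ (card Fq ^ i)) (i + j))"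

definition skew_mat_mult ::
    "'a::field set \<Rightarrow> 'a poly mat \<Rightarrow> 'a poly mat \<Rightarrow> 'a poly mat"
  where "skew_mat_mult Fq A B = mat (dim_row A) (dim_col B)
    (\<lambda>(i, j). \<Sum>k<dim_col A. skew_mult Fq (A $$ (i, k)) (B $$ (k, j)))"

definition skew_matrix_ring :: "'a::field set \<Rightarrow> 'a set \<Rightarrow> nat \<Rightarrow> 'a poly mat ring"
  where "skew_matrix_ring Fq F d =
    \<lparr>carrier = mats_over (polys_over F) d d, monoid.mult = skew_mat_mult Fq,
     monoid.one = 1\<^sub>m d, ring.zero = 0\<^sub>m d d, ring.add = (+)\<rparr>"

definition tau_coeff :: "nat \<Rightarrow> 'a::field poly mat \<Rightarrow> 'a mat"
  where "tau_coeff j A = map_mat (\<lambda>p. poly.coeff p j) A"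


section \<open>Anderson t-modules\<close>

text \<open>
  The variable \<open>t\<close> of \<open>\<bbbF>\<^sub>q[t]\<close> is \<open>monom 1 1\<close>. Since all fields are subsets of one type,
  the base extension of a t-module is the same map, regarded as a t-module over the larger field.
\<close>

definition t_module ::
    "'a::field set \<Rightarrow> 'a set \<Rightarrow> 'a \<Rightarrow> nat \<Rightarrow> ('a poly \<Rightarrow> 'a poly mat) \<Rightarrow> bool"
  where "t_module Fq F \<theta> d \<phi> \<longleftrightarrow>
    \<theta> \<in> F \<and> d > 0 \<and>
    \<phi> \<in> Ring.ring_hom (poly_ring_over Fq) (skew_matrix_ring Fq F d) \<and>
    (\<forall>c\<in>Fq. \<forall>a\<in>polys_over Fq. \<phi> (Polynomial.smult c a) = map_mat (Polynomial.smult c) (\<phi> a)) \<and>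
    (\<exists>k. (tau_coeff 0 (\<phi> (Polynomial.monom 1 1)) - \<theta> \<cdot>\<^sub>m 1\<^sub>m d) ^\<^sub>m k = 0\<^sub>m d d)"

definition t_module_isomorphic :: "'a::field set \<Rightarrow> 'a set \<Rightarrow> nat \<Rightarrow>
    ('a poly \<Rightarrow> 'a poly mat) \<Rightarrow> ('a poly \<Rightarrow> 'a poly mat) \<Rightarrow> bool"
  where "t_module_isomorphic Fq F d \<phi> \<psi> \<longleftrightarrow>
    (\<exists>U\<in>Units (skew_matrix_ring Fq F d). \<forall>a\<in>polys_over Fq.
      skew_mat_mult Fq U (\<phi> a) = skew_mat_mult Fq (\<psi> a) U)"

definition invertible_leading_coeff :: "'a::field set \<Rightarrow> nat \<Rightarrow> 'a poly mat \<Rightarrow> bool"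
  where "invertible_leading_coeff F d A \<longleftrightarrow>
    (\<exists>s. tau_coeff s A \<noteq> 0\<^sub>m d d \<and> (\<forall>j>s. tau_coeff j A = 0\<^sub>m d d) \<and>
      tau_coeff s A \<in> Units (matrix_ring_over F d))"

definition almost_strictly_pure :: "'a::field set \<Rightarrow> nat \<Rightarrow> ('a poly \<Rightarrow> 'a poly mat) \<Rightarrow> bool"
  where "almost_strictly_pure F d \<psi> \<longleftrightarrow>
    (\<exists>n\<ge>1. invertible_leading_coeff F d (\<psi> (Polynomial.monom 1 n)))"

definition strictly_pure :: "'a::field set \<Rightarrow> nat \<Rightarrow> ('a poly \<Rightarrow> 'a poly mat) \<Rightarrow> bool"
  where "strictly_pure F d \<psi> \<longleftrightarrow> invertible_leading_coeff F d (\<psi> (Polynomial.monom 1 1))"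


section \<open>Bases and tensor products of modules\<close>

definition module_basis :: "'r ring \<Rightarrow> ('r, 'm) module \<Rightarrow> 'm set \<Rightarrow> bool"
  where "module_basis R M B \<longleftrightarrow>
    finite B \<and> B \<subseteq> carrier M \<and>
    (\<forall>m\<in>carrier M. \<exists>!c. c \<in> B \<rightarrow>\<^sub>E carrier R \<and> m = finsum M (\<lambda>b. c b \<odot>\<^bsub>M\<^esub> b) B)"

text \<open>
  The tensor product \<open>N \<otimes>\<^sub>R M\<close> over a commutative ring \<open>R\<close> is the free abelian group on the
  pairs, modulo the subgroup generated by the usual relations. The pure tensor \<open>x \<otimes> m\<close> is the
  coset of \<open>frag_of (x, m)\<close>.
\<close>

definition tensor_free :: "('r, 'n) module \<Rightarrow> ('r, 'm) module \<Rightarrow> ('n \<times> 'm \<Rightarrow>\<^sub>0 int) monoid"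
  where "tensor_free N M = free_Abelian_group (carrier N \<times> carrier M)"

definition tensor_relations ::
    "'r ring \<Rightarrow> ('r, 'n) module \<Rightarrow> ('r, 'm) module \<Rightarrow> ('n \<times> 'm \<Rightarrow>\<^sub>0 int) set"
  where "tensor_relations R N M =
    {frag_of (x \<oplus>\<^bsub>N\<^esub> y, m) - frag_of (x, m) - frag_of (y, m) | x y m.
       x \<in> carrier N \<and> y \<in> carrier N \<and> m \<in> carrier M} \<union>
    {frag_of (x, m \<oplus>\<^bsub>M\<^esub> n) - frag_of (x, m) - frag_of (x, n) | x m n.
       x \<in> carrier N \<and> m \<in> carrier M \<and> n \<in> carrier M} \<union>
    {frag_of (r \<odot>\<^bsub>N\<^esub> x, m) - frag_of (x, r \<odot>\<^bsub>M\<^esub> m) | r x m.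
       r \<in> carrier R \<and> x \<in> carrier N \<and> m \<in> carrier M}"

definition tensor_null ::
    "'r ring \<Rightarrow> ('r, 'n) module \<Rightarrow> ('r, 'm) module \<Rightarrow> ('n \<times> 'm \<Rightarrow>\<^sub>0 int) set"
  where "tensor_null R N M = generate (tensor_free N M) (tensor_relations R N M)"

definition tensor_group ::
    "'r ring \<Rightarrow> ('r, 'n) module \<Rightarrow> ('r, 'm) module \<Rightarrow> ('n \<times> 'm \<Rightarrow>\<^sub>0 int) set monoid"
  where "tensor_group R N M = tensor_free N M Mod tensor_null R N M"

text \<open>
  The additive map with \<open>x \<otimes> m \<mapsto> f x \<otimes> g m\<close>. The union consists of a single coset
  whenever the map on the free group respects the relations.
\<close>

definition tensor_map :: "'r ring \<Rightarrow> ('r, 'n) module \<Rightarrow> ('r, 'm) module \<Rightarrow>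
    ('n \<Rightarrow> 'n) \<Rightarrow> ('m \<Rightarrow> 'm) \<Rightarrow> ('n \<times> 'm \<Rightarrow>\<^sub>0 int) set \<Rightarrow> ('n \<times> 'm \<Rightarrow>\<^sub>0 int) set"
  where "tensor_map R N M f g Z =
    (\<Union>c\<in>Z. tensor_null R N M #>\<^bsub>tensor_free N M\<^esub>
      (frag_extend (\<lambda>(x, m). frag_of (f x, g m)) c))"

lemma tensor_map_coset:
  assumes rels: "tensor_relations R N M \<subseteq> carrier (tensor_free N M)"
    and f: "\<And>x. x \<in> carrier N \<Longrightarrow> f x \<in> carrier N"
    and g: "\<And>m. m \<in> carrier M \<Longrightarrow> g m \<in> carrier M"
    and resp: "frag_extend (\<lambda>(x, m). frag_of (f x, g m)) ` tensor_relations R N M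
                 \<subseteq> tensor_null R N M"
    and c: "c \<in> carrier (tensor_free N M)"
  shows "tensor_map R N M f g (tensor_null R N M #>\<^bsub>tensor_free N M\<^esub> c) =
    tensor_null R N M #>\<^bsub>tensor_free N M\<^esub>
      (frag_extend (\<lambda>(x, m). frag_of (f x, g m)) c)"
proof -
  define G where "G = tensor_free N M"
  define H where "H = tensor_null R N M"
  define h where "h = frag_extend (\<lambda>(x, m). frag_of (f x, g m))"
  interpret G: comm_group G
    unfolding G_def tensor_free_def by (rule abelian_free_Abelian_group)
  have mult: "a \<otimes>\<^bsub>G\<^esub> b = a + b" for a b
    by (simp add: G_def tensor_free_def)
  have H: "subgroup H G"
    unfolding H_def G_def tensor_null_def
    using G.generate_is_subgroup rels by (simp add: G_def)
  have h_carrier: "h a \<in> carrier G" if "a \<in> carrier G" for a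
  proof -
    have "Poly_Mapping.keys (h a) \<subseteq> (\<Union>p\<in>Poly_Mapping.keys a. Poly_Mapping.keys
        ((\<lambda>(x, m). frag_of (f x, g m)) p))"
      unfolding h_def by (rule keys_frag_extend)
    also have "\<dots> \<subseteq> carrier N \<times> carrier M"
      using that f g by (fastforce simp: G_def tensor_free_def split: prod.splits if_splits)
    finally show ?thesis
      by (simp add: G_def tensor_free_def)
  qed
  have "h \<in> hom G G"
    using h_carrier by (auto simp: hom_def mult h_def frag_extend_add)
  then interpret h: group_hom G G h
    by unfold_locales
  have "h ` H = generate G (h ` tensor_relations R N M)"
    unfolding H_def tensor_null_def G_def[symmetric]
    by (rule h.generate_img[symmetric]) (use rels in \<open>simp add: G_def\<close>)
  also have "\<dots> \<subseteq> H"
    using resp H by (intro G.generate_subgroup_incl) (auto simp: H_def h_def)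
  finally have hH: "h ` H \<subseteq> H" .
  have "H #>\<^bsub>G\<^esub> h (a \<otimes>\<^bsub>G\<^esub> c) = H #>\<^bsub>G\<^esub> h c" if "a \<in> H" for a
  proof -
    have a: "a \<in> carrier G" and ha: "h a \<in> H"
      using that H hH subgroup.mem_carrier by fastforce+
    have hc: "h c \<in> carrier G"
      using c h_carrier by (simp add: G_def)
    have "H #>\<^bsub>G\<^esub> h (a \<otimes>\<^bsub>G\<^esub> c) = H #>\<^bsub>G\<^esub> (h a \<otimes>\<^bsub>G\<^esub> h c)"
      using h.hom_mult[OF a] c by (simp add: G_def)
    also have "\<dots> = H #>\<^bsub>G\<^esub> h a #>\<^bsub>G\<^esub> h c"
      using G.coset_mult_assoc[of H "h a" "h c"] hc h_carrier[OF a] subgroup.subset[OF H] by simp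
    also have "H #>\<^bsub>G\<^esub> h a = H"
      using G.coset_join2 H h_carrier[OF a] ha by blast
    finally show ?thesis .
  qed
  moreover have "\<one>\<^bsub>G\<^esub> \<in> H"
    using H by (rule subgroup.one_closed)
  ultimately have "(\<Union>b\<in>H #>\<^bsub>G\<^esub> c. H #>\<^bsub>G\<^esub> h b) = H #>\<^bsub>G\<^esub> h c"
    by (auto simp: r_coset_def)
  then show ?thesis
    by (simp add: tensor_map_def G_def H_def h_def)
qed


section \<open>The module of a t-module, purity\<close>

text \<open>
  The module \<open>M\<^sub>\<phi>\<close> of row vectors over \<open>K{\<tau>}\<close> with its \<open>K[t]\<close>-module structure, in which
  \<open>t\<close> acts as \<open>x \<mapsto> x \<phi>\<^sub>t\<close>. The multiplicative part of the record is not used.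
\<close>

definition assoc_module :: "'a::field set \<Rightarrow> 'a set \<Rightarrow> nat \<Rightarrow> ('a poly \<Rightarrow> 'a poly mat) \<Rightarrow>
    ('a poly, 'a poly mat) module"
  where "assoc_module Fq K d \<phi> =
    \<lparr>carrier = mats_over (polys_over K) 1 d, monoid.mult = undefined, monoid.one = undefined,
     ring.zero = 0\<^sub>m 1 d, ring.add = (+),
     module.smult = (\<lambda>f x. mat 1 d (\<lambda>ij. \<Sum>i\<le>Polynomial.degree f. Polynomial.smult (poly.coeff f i)
       (((\<lambda>y. skew_mat_mult Fq y (\<phi> (Polynomial.monom 1 1))) ^^ i) x $$ ij)))\<rparr>"

definition tau_action :: "'a::field set \<Rightarrow> 'a poly mat \<Rightarrow> 'a poly mat"
  where "tau_action Fq x = map_mat (skew_mult Fq (Polynomial.monom 1 1)) x"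

definition has_rank :: "'a::field set \<Rightarrow> 'a set \<Rightarrow> nat \<Rightarrow> ('a poly \<Rightarrow> 'a poly mat) \<Rightarrow> nat \<Rightarrow> bool"
  where "has_rank Fq K d \<phi> r \<longleftrightarrow>
    (\<exists>B. module_basis (poly_ring_over K) (assoc_module Fq K d \<phi>) B \<and> card B = r)"

definition abelian_t_module ::
    "'a::field set \<Rightarrow> 'a set \<Rightarrow> nat \<Rightarrow> ('a poly \<Rightarrow> 'a poly mat) \<Rightarrow> bool"
  where "abelian_t_module Fq K d \<phi> \<longleftrightarrow> (\<exists>r. has_rank Fq K d \<phi> r)"

text \<open>
  The indeterminate \<open>fls_X\<close> of the type \<open>'a fls\<close> stands for \<open>1/t\<close>, so \<open>t\<close> is \<open>fls_X_inv\<close>, and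
  the power series in \<open>1/t\<close> form the range of \<open>fps_to_fls\<close>.
\<close>

definition laurent_module :: "('a::field poly, 'a fls) module"
  where "laurent_module =
    \<lparr>carrier = UNIV, monoid.mult = (*), monoid.one = 1, ring.zero = 0, ring.add = (+),
     module.smult = (\<lambda>p f. poly (map_poly fls_const p) fls_X_inv * f)\<rparr>"

definition fls_twist :: "'a::field set \<Rightarrow> 'a fls \<Rightarrow> 'a fls"
  where "fls_twist Fq f = Abs_fls (\<lambda>n. fls_nth f n ^ card Fq)"

type_synonym 'a laurent_tensors = "('a fls \<times> 'a poly mat \<Rightarrow>\<^sub>0 int) set"

definition laurent_tensor :: "'a::field set \<Rightarrow> 'a set \<Rightarrow> nat \<Rightarrow> ('a poly \<Rightarrow> 'a poly mat) \<Rightarrow>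
    ('a fls, 'a laurent_tensors) module"
  where "laurent_tensor Fq K d \<phi> =
    (let T = tensor_group (poly_ring_over K) laurent_module (assoc_module Fq K d \<phi>) in
    \<lparr>carrier = carrier T, monoid.mult = undefined, monoid.one = undefined,
     ring.zero = monoid.one T, ring.add = monoid.mult T,
     module.smult = (\<lambda>f. tensor_map (poly_ring_over K) laurent_module (assoc_module Fq K d \<phi>)
       (\<lambda>g. f * g) (\<lambda>m. m))\<rparr>)"

definition tensor_tau :: "'a::field set \<Rightarrow> 'a set \<Rightarrow> nat \<Rightarrow> ('a poly \<Rightarrow> 'a poly mat) \<Rightarrow>
    'a laurent_tensors \<Rightarrow> 'a laurent_tensors"
  where "tensor_tau Fq K d \<phi> =
    tensor_map (poly_ring_over K) laurent_module (assoc_module Fq K d \<phi>)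
      (fls_twist Fq) (tau_action Fq)"

definition power_series_lattice ::
    "('a::field fls, 'm) module \<Rightarrow> 'm set \<Rightarrow> bool"
  where "power_series_lattice V \<Lambda> \<longleftrightarrow>
    (\<exists>B. module_basis ring_of_type_algebra V B \<and>
      \<Lambda> = {finsum V (\<lambda>b. c b \<odot>\<^bsub>V\<^esub> b) B | c. c \<in> B \<rightarrow> range fps_to_fls})"

definition pure_t_module :: "'a::field set \<Rightarrow> 'a set \<Rightarrow> nat \<Rightarrow> ('a poly \<Rightarrow> 'a poly mat) \<Rightarrow> bool"
  where "pure_t_module Fq K d \<phi> \<longleftrightarrow>
    abelian_t_module Fq K d \<phi> \<and>
    (\<exists>u>0. \<exists>v>0. \<exists>\<Lambda>. power_series_lattice (laurent_tensor Fq K d \<phi>) \<Lambda> \<and>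
      (\<lambda>x. fls_X_inv ^ u \<odot>\<^bsub>laurent_tensor Fq K d \<phi>\<^esub> x) ` \<Lambda> =
      (tensor_tau Fq K d \<phi> ^^ v) ` \<Lambda>)"

definition has_weight :: "'a::field set \<Rightarrow> 'a set \<Rightarrow> nat \<Rightarrow> ('a poly \<Rightarrow> 'a poly mat) \<Rightarrow> rat \<Rightarrow> bool"
  where "has_weight Fq K d \<phi> w \<longleftrightarrow> (\<exists>r. has_rank Fq K d \<phi> r \<and> w = of_nat d / of_nat r)"

end

theory Submission
  imports Defs "HOL-Library.Function_Algebras" "Jordan_Normal_Form.Determinant"
begin

text \<open>
  The proof takes place over the algebraic closure and descends to a finite extension at the very
  end. Write \<open>M\<close> for the row vectors of length \<open>d\<close> over \<open>\<K>{\<tau>}\<close>, where \<open>\<K>\<close> is the algebraic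
  closure; \<open>\<tau>\<close> and \<open>t\<close> act on \<open>M\<close> and commute. That \<open>\<phi>\<close> becomes almost strictly pure means that
  \<open>M\<close> has a basis over \<open>\<K>{\<tau>}\<close> in which the matrix of some \<open>t\<^sup>a\<close> has an invertible leading
  coefficient. The base change matrix, its inverse and the inverse of that coefficient have
  finitely many entries, so they are defined over a finite extension \<open>L\<close>, and conjugation by the
  base change gives \<open>\<psi>\<close> (\<open>t_module_conjugate\<close>).

  The basis is read off from a filtration. A lattice \<open>\<Lambda>\<close> with \<open>t\<^sup>u \<Lambda> = \<tau>\<^sup>v \<Lambda>\<close> defines
  subspaces \<open>F\<^sub>i = {x \<in> M. \<forall>j. \<tau>\<^sup>j x \<in> t\<^bsup>k\<^esup> \<Lambda>}\<close> with \<open>k = \<lfloor>u (i + j) / v\<rfloor>\<close>. They are finite-dimensional,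
  they exhaust \<open>M\<close>, an element lies in \<open>F\<^sub>i\<close> exactly if its image under \<open>\<tau>\<close> lies in \<open>F\<^sub>i\<^sub>+\<^sub>1\<close>, and
  exactly if its image under \<open>t\<^sup>a\<close> lies in \<open>F\<^sub>i\<^sub>+\<^sub>b\<close>, whenever \<open>a v = b u\<close> (\<open>filtration_of_pure\<close>).

  Such a filtration is generated by \<open>\<tau>\<close> from some index \<open>N\<close> on: \<open>F\<^sub>i\<^sub>+\<^sub>1 = F\<^sub>i + \<tau> F\<^sub>i\<close> for \<open>i \<ge> N\<close>. Suppose
  that it vanishes below \<open>N\<close>. Then a basis of \<open>F\<^sub>N\<close> over \<open>\<K>\<close> is a basis of \<open>M\<close> over \<open>\<K>{\<tau>}\<close>, and since
  \<open>t\<^sup>a\<close> is injective from \<open>F\<^sub>N\<close> to \<open>F\<^sub>N\<^sub>+\<^sub>b\<close> modulo \<open>F\<^sub>N\<^sub>+\<^sub>b\<^sub>-\<^sub>1\<close>, its leading coefficient is invertible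
  (\<open>leading_coeff_invertible_after_base_change\<close>). In general \<open>F\<close> begins before \<open>N\<close>; in the language of
  vector bundles on a curve, \<open>F\<close> has a splitting type that is not constant. The filtration is then
  replaced by one for which the gap is smaller (\<open>filtration_step\<close>). Both \<open>t\<^sup>a\<close> and \<open>\<tau>\<^sup>b\<close> map
  \<open>F\<^sub>N / F\<^sub>N\<^sub>-\<^sub>1\<close> bijectively to \<open>F\<^sub>N\<^sub>+\<^sub>b / F\<^sub>N\<^sub>+\<^sub>b\<^sub>-\<^sub>1\<close>. By Lang's theorem this quotient has a basis on
  which they agree (\<open>lang_fixed_vectors_span\<close>), and by Steinitz exchange a part of that basis spans a
  complement \<open>A\<close> of the image of the first step of \<open>F\<close>. The new filtration is
  \<open>F\<^sub>i\<^sub>-\<^sub>1 + \<tau>\<^bsup>i-N\<^esup> A\<close> for \<open>i \<ge> N\<close>, continued downwards: it is compatible with \<open>t\<^sup>a\<close> and \<open>\<tau>\<close> because \<open>A\<close>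
  is, the first step has been removed, and \<open>N\<close> has not grown.

  The weight enters by counting the dimension of \<open>M / t\<^sup>a M\<close>. A basis over the polynomial ring gives
  \<open>r a\<close>, and division with remainder by a matrix of degree \<open>b\<close> with invertible leading coefficient
  gives \<open>d b\<close> (\<open>rank_times_eq_dimension_times\<close>). Hence \<open>d / r = u / v\<close>. If \<open>r = d s\<close>, the pair
  \<open>(a, b) = (1, s)\<close> is admissible above, and \<open>\<psi>\<close> is strictly pure. Conversely, a strictly pure \<open>\<psi>\<close> of
  degree \<open>s\<close> has \<open>r = d s\<close>.
\<close>

section \<open>Linear algebra modulo a subspace\<close>

lemma nontrivial_relation:
  fixes A :: "'j \<Rightarrow> 'i \<Rightarrow> 'a::field"
  assumes "finite I" and "finite J" and "card I < card J"
  shows "\<exists>c. (\<exists>j\<in>J. c j \<noteq> 0) \<and> (\<forall>i\<in>I. (\<Sum>j\<in>J. c j * A j i) = 0)"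
  using assms
proof (induction I arbitrary: J A rule: finite_induct)
  case empty
  then have "J \<noteq> {}"
    by auto
  then show ?case
    by (intro exI[of _ "\<lambda>_. 1"]) auto
next
  case (insert i I)
  show ?case
  proof (cases "\<forall>j\<in>J. A j i = 0")
    case True
    obtain c where "\<exists>j\<in>J. c j \<noteq> 0" "\<forall>i\<in>I. (\<Sum>j\<in>J. c j * A j i) = 0"
      using insert.IH[OF insert.prems(1), of A] insert.prems insert.hyps by auto
    then show ?thesis
      using True by (intro exI[of _ c]) auto
  next
    case False
    then obtain j0 where j0: "j0 \<in> J" "A j0 i \<noteq> 0"
      by auto
    define A' where "A' j k = A j k - A j i / A j0 i * A j0 k" for j k
    have "card I < card (J - {j0})"
      using insert j0 by auto
    then obtain c where c: "\<exists>j\<in>J - {j0}. c j \<noteq> 0"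
        "\<forall>k\<in>I. (\<Sum>j\<in>J - {j0}. c j * A' j k) = 0"
      using insert.IH[of "J - {j0}" A'] insert.prems by auto
    define e where "e = - (\<Sum>j\<in>J - {j0}. c j * A j i) / A j0 i"
    have split: "(\<Sum>j\<in>J. (c(j0 := e)) j * A j k) = e * A j0 k + (\<Sum>j\<in>J - {j0}. c j * A j k)" for k
      by (subst sum.remove[OF insert.prems(1) j0(1)]) (auto intro!: sum.cong)
    have "(\<Sum>j\<in>J. (c(j0 := e)) j * A j i) = 0"
      unfolding split using j0 by (simp add: e_def)
    moreover have "(\<Sum>j\<in>J. (c(j0 := e)) j * A j k) = 0" if "k \<in> I" for k
    proof -
      have "(\<Sum>j\<in>J - {j0}. c j * A' j k) =
          (\<Sum>j\<in>J - {j0}. c j * A j k) + e * A j0 k"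
        by (simp add: A'_def e_def algebra_simps sum_subtractf sum_distrib_left sum_distrib_right
            sum_divide_distrib)
      then show ?thesis
        unfolding split using c(2) that by (simp add: add.commute)
    qed
    moreover have "\<exists>j\<in>J. (c(j0 := e)) j \<noteq> 0"
      using c(1) by auto
    ultimately show ?thesis
      by blast
  qed
qed

context vector_space
begin

text \<open>
  Dimensions of quotients are compared without forming them: a family that generates modulo \<open>Z\<close> is
  at least as large as a family that is independent modulo \<open>Z\<close>. Otherwise the coefficients that
  express the second family by the first would satisfy a nontrivial relation.
\<close>

lemma card_le_modulo:
  assumes Z: "subspace Z" and "finite I" and "finite J"
    and g: "\<And>j. j \<in> J \<Longrightarrow> \<exists>c. h j - (\<Sum>i\<in>I. scale (c i) (g i)) \<in> Z"
    and h: "\<And>c. (\<Sum>j\<in>J. scale (c j) (h j)) \<in> Z \<Longrightarrow> \<forall>j\<in>J. c j = 0"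
  shows "card J \<le> card I"
proof (rule ccontr)
  assume "\<not> card J \<le> card I"
  moreover obtain A where A: "\<And>j. j \<in> J \<Longrightarrow> h j - (\<Sum>i\<in>I. scale (A j i) (g i)) \<in> Z"
    using g by metis
  ultimately obtain c where c: "\<exists>j\<in>J. c j \<noteq> 0" "\<forall>i\<in>I. (\<Sum>j\<in>J. c j * A j i) = 0"
    using nontrivial_relation[OF assms(2,3), of A] by auto
  have "(\<Sum>j\<in>J. scale (c j) (h j - (\<Sum>i\<in>I. scale (A j i) (g i)))) \<in> Z"
    by (intro subspace_sum[OF Z] subspace_scale[OF Z] A)
  also have "(\<Sum>j\<in>J. scale (c j) (h j - (\<Sum>i\<in>I. scale (A j i) (g i)))) =
      (\<Sum>j\<in>J. scale (c j) (h j)) - (\<Sum>j\<in>J. \<Sum>i\<in>I. scale (c j * A j i) (g i))"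
    by (simp add: scale_right_diff_distrib sum_subtractf scale_sum_right)
  also have "(\<Sum>j\<in>J. \<Sum>i\<in>I. scale (c j * A j i) (g i)) =
      (\<Sum>i\<in>I. scale (\<Sum>j\<in>J. c j * A j i) (g i))"
    by (subst sum.swap) (simp add: scale_sum_left)
  also have "\<dots> = 0"
    using c(2) by simp
  finally show False
    using h[of c] c(1) by auto
qed

text \<open>
  Steinitz exchange: a basis of the subspace is completed to a basis by elements of \<open>G\<close>, and the
  new elements span a complement. In the main argument \<open>G\<close> consists of vectors fixed by a
  semilinear map, so that the complement inherits their properties.
\<close>

lemma complement_in_spanning_set:
  assumes Z: "subspace Z" and XG: "Z \<subseteq> span G"
  obtains A where "A \<subseteq> G" "independent A" "Z \<inter> span A = {0}"
    "\<And>y. y \<in> span G \<Longrightarrow> \<exists>a\<in>span A. y - a \<in> Z"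
proof -
  obtain b where b: "b \<subseteq> Z" "independent b" "Z \<subseteq> span b"
    using maximal_independent_subset[of Z] by blast
  have Xb: "span b = Z"
    using b Z span_minimal by blast
  obtain B where B: "b \<subseteq> B" "B \<subseteq> b \<union> G" "independent B" "b \<union> G \<subseteq> span B"
    using maximal_independent_subset_extend[of b "b \<union> G"] b by auto
  define A where "A = B - b"
  have BA: "B = b \<union> A" "b \<inter> A = {}"
    using B by (auto simp: A_def)
  have 1: "x = 0" if "x \<in> Z" "x \<in> span A" for x
  proof -
    have r: "representation b x = representation B x" "representation A x = representation B x"
      using representation_extend[OF B(3), of x b] representation_extend[OF B(3), of x A] that Xb B(1)
      by (auto simp: A_def)
    have "representation B x v = 0" for v
      using representation_ne_zero[of b x v] representation_ne_zero[of A x v] r BA(2) by auto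
    moreover have "x \<in> span B"
      using that(1) Xb span_mono[OF B(1)] by blast
    ultimately show "x = 0"
      using sum_nonzero_representation_eq[OF B(3), of x] by simp
  qed
  have 2: "\<exists>a\<in>span A. y - a \<in> Z" if "y \<in> span G" for y
  proof -
    have "y \<in> span (b \<union> A)"
      using that B(4) BA(1) span_mono[of G "span B"] by (auto simp: span_span)
    then obtain x a where "y = x + a" "x \<in> span b" "a \<in> span A"
      unfolding span_Un by auto
    then show ?thesis
      using Xb by (intro bexI[of _ a]) auto
  qed
  show thesis
  proof (rule that[of A])
    show "A \<subseteq> G" "independent A"
      using B independent_mono by (auto simp: A_def)
    show "Z \<inter> span A = {0}"
      using 1 Z subspace_0 span_zero by blast
  qed (use 2 in auto)
qed

lemma complement_containing:
  assumes Z: "subspace Z" and S: "subspace S" and Y: "subspace Y"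
    and sub: "Z \<subseteq> Y" "S \<subseteq> Y" and XS: "Z \<inter> S = {0}"
  obtains C where "subspace C" "S \<subseteq> C" "C \<subseteq> Y" "Z \<inter> C = {0}"
    "\<And>y. y \<in> Y \<Longrightarrow> \<exists>c\<in>C. y - c \<in> Z"
proof -
  have XS': "subspace (span (Z \<union> S))"
    by (rule subspace_span)
  have sYX: "span (Z \<union> S) \<subseteq> span Y"
    by (intro span_mono) (use sub in auto)
  obtain A where A: "A \<subseteq> Y" "independent A" "span (Z \<union> S) \<inter> span A = {0}"
    "\<And>y. y \<in> span Y \<Longrightarrow> \<exists>a\<in>span A. y - a \<in> span (Z \<union> S)"
    using complement_in_spanning_set[OF XS' sYX] by blast
  have sX: "span Z = Z" and sS: "span S = S" and sY: "span Y = Y"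
    using Z S Y by (simp_all add: span_eq_iff)
  have sXS: "x + s \<in> span (Z \<union> S)" if "x \<in> Z" "s \<in> S" for x s
    using that span_base span_add by (metis UnI1 UnI2)
  show thesis
  proof (rule that[of "span (S \<union> A)"])
    show "S \<subseteq> span (S \<union> A)"
      using span_superset by blast
    show "span (S \<union> A) \<subseteq> Y"
      using span_minimal[OF _ Y] A(1) sub by auto
    have "x = 0" if x: "x \<in> Z" "x \<in> span (S \<union> A)" for x
    proof -
      obtain s a where sa: "x = s + a" "s \<in> S" "a \<in> span A"
        using x unfolding span_Un sS by auto
      have "a = x + (- s)"
        using sa by simp
      then have "a \<in> span (Z \<union> S)"
        using sXS[OF x(1), of "-s"] subspace_neg[OF S sa(2)] by simp
      then have "a = 0"
        using A(3) sa(3) by auto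
      then show "x = 0"
        using sa x XS by auto
    qed
    then show "Z \<inter> span (S \<union> A) = {0}"
      using subspace_0[OF Z] span_zero by auto
    fix y assume "y \<in> Y"
    then obtain a where a: "a \<in> span A" "y - a \<in> span (Z \<union> S)"
      using A(4) sY by auto
    then obtain x s where "y - a = x + s" "x \<in> Z" "s \<in> S"
      unfolding span_Un sX sS by auto
    moreover have "s + a \<in> span (S \<union> A)"
      using \<open>s \<in> S\<close> a(1) span_mono[of A "S \<union> A"] span_base[of s "S \<union> A"]
      by (auto intro: span_add)
    moreover have "y - (s + a) = x"
      using \<open>y - a = x + s\<close> by (simp add: algebra_simps)
    ultimately show "\<exists>c\<in>span (S \<union> A). y - c \<in> Z"
      using \<open>x \<in> Z\<close> by metis
  qed simp
qed

end

section \<open>Fixed vectors of semilinear maps\<close>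

lemma artin_schreier_root:
  fixes c :: "'a::alg_closed_field"
  assumes "1 < Q"
  obtains d where "d ^ Q - d = c"
proof -
  define p :: "'a poly" where "p = Polynomial.monom 1 Q - Polynomial.monom 1 1 - [:c:]"
  have "poly.coeff p Q = 1"
    using assms by (simp add: p_def coeff_pCons split: nat.splits)
  then have "Polynomial.degree p \<ge> Q"
    by (intro le_degree) simp
  then obtain d where "poly p d = 0"
    using alg_closed_imp_poly_has_root[of p] assms by auto
  then show thesis
    by (intro that[of d]) (simp add: p_def poly_monom algebra_simps)
qed

text \<open>
  Subtracting \<open>z\<close> and dividing by it leaves a polynomial with constant term \<open>-1\<close>. It is not constant,
  because the exponents are distinct and one coefficient is nonzero, so it has a root, and the root
  is not zero.
\<close>

lemma additive_polynomial_fixed_point: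
  fixes a :: "nat \<Rightarrow> 'a::alg_closed_field"
  assumes Q: "1 < Q" and j0: "j0 < m" "a j0 \<noteq> 0"
  obtains z where "z \<noteq> 0" "(\<Sum>j<m. a j * z ^ (Q ^ (m - j))) = z"
proof -
  define p where "p = (\<Sum>j<m. Polynomial.monom (a j) (Q ^ (m - j) - 1)) - 1"
  have big: "Q ^ (m - j) > 1" if "j < m" for j
    using one_less_power[OF Q, of "m - j"] that by simp
  have inj: "Q ^ (m - i) - 1 = Q ^ (m - j) - 1 \<longleftrightarrow> i = j" if "i < m" "j < m" for i j
  proof -
    have "Q ^ (m - i) - 1 = Q ^ (m - j) - 1 \<longleftrightarrow> Q ^ (m - i) = Q ^ (m - j)"
      using big[OF that(1)] big[OF that(2)] by linarith
    also have "\<dots> \<longleftrightarrow> m - i = m - j"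
      using Q by (simp add: power_inject_exp)
    finally show ?thesis
      using that by auto
  qed
  have "poly.coeff p (Q ^ (m - j0) - 1) = (\<Sum>j<m. if j = j0 then a j else 0)"
    unfolding p_def coeff_diff coeff_sum
    using big[OF j0(1)] inj[OF _ j0(1)] by (auto intro!: sum.cong)
  also have "\<dots> = a j0"
    using j0(1) by simp
  finally have "Polynomial.degree p \<ge> Q ^ (m - j0) - 1"
    using j0(2) by (intro le_degree) simp
  then obtain z where z: "poly p z = 0"
    using alg_closed_imp_poly_has_root[of p] big[OF j0(1)] by fastforce
  have pz: "poly p x = (\<Sum>j<m. a j * x ^ (Q ^ (m - j) - 1)) - 1" for x
    by (simp add: p_def poly_sum poly_monom)
  have "poly p 0 = -1"
    unfolding pz using big by (auto intro!: sum.neutral simp: zero_power)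
  then have "z \<noteq> 0"
    using z by auto
  have "z = z * (\<Sum>j<m. a j * z ^ (Q ^ (m - j) - 1))"
    using z unfolding pz by simp
  also have "\<dots> = (\<Sum>j<m. a j * z ^ (Q ^ (m - j)))"
    unfolding sum_distrib_left
  proof (rule sum.cong[OF refl])
    fix j assume "j \<in> {..<m}"
    then have "z ^ (Q ^ (m - j)) = z * z ^ (Q ^ (m - j) - 1)"
      using Q power_minus_mult[of "Q ^ (m - j)" z] by (simp add: mult.commute)
    then show "z * (a j * z ^ (Q ^ (m - j) - 1)) = a j * z ^ (Q ^ (m - j))"
      by simp
  qed
  finally show thesis
    using that \<open>z \<noteq> 0\<close> by metis
qed

locale alg_closed_vector_space = vector_space scale
  for scale :: "'a::alg_closed_field \<Rightarrow> 'b::ab_group_add \<Rightarrow> 'b"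
begin

text \<open>
  Lang's theorem for the general linear group, in the form that a semilinear bijection of a
  finite-dimensional space over an algebraically closed field has a basis of fixed vectors. Let
  \<open>C1\<close> be the span of the fixed vectors and \<open>x\<close> a vector outside it. The first relation between the
  iterates of \<open>x\<close> modulo \<open>C1\<close> yields a vector \<open>y\<close> outside \<open>C1\<close> that is fixed modulo \<open>C1\<close>. Since
  \<open>f - id\<close> is onto on \<open>C1\<close>, by the Artin-Schreier equation, a correction of \<open>y\<close> by an element of
  \<open>C1\<close> is fixed, which is a contradiction.
\<close>

lemma lang_fixed_vectors_span:
  assumes Q: "1 < Q"
    and frob: "\<And>x y. (x + y :: 'a) ^ Q = x ^ Q + y ^ Q"
    and C: "subspace C" and fin: "finite S" "C \<subseteq> span S"
    and fC: "\<And>x. x \<in> C \<Longrightarrow> f x \<in> C"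
    and fadd: "\<And>x y. x \<in> C \<Longrightarrow> y \<in> C \<Longrightarrow> f (x + y) = f x + f y"
    and fscale: "\<And>c x. x \<in> C \<Longrightarrow> f (scale c x) = scale (c ^ Q) (f x)"
    and finj: "\<And>x. x \<in> C \<Longrightarrow> f x = 0 \<Longrightarrow> x = 0"
  shows "C \<subseteq> span {x \<in> C. f x = x}"
proof (rule ccontr)
  define Fix where "Fix = {x \<in> C. f x = x}"
  define C1 where "C1 = span Fix"
  assume "\<not> C \<subseteq> span {x \<in> C. f x = x}"
  then obtain x where x: "x \<in> C" "x \<notin> C1"
    by (auto simp: C1_def Fix_def)
  have C1: "subspace C1" "C1 \<subseteq> C"
    unfolding C1_def using span_minimal[OF _ C, of Fix] by (auto simp: Fix_def)
  have f0: "f 0 = 0"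
    using fadd[of 0 0] subspace_0[OF C] by simp
  have fminus: "f (x - y) = f x - f y" if "x \<in> C" "y \<in> C" for x y
    using fadd[of "x - y" y] subspace_diff[OF C that] that by simp
  have surj: "\<exists>y\<in>C1. f y = z" if "z \<in> C1" for z
    using that unfolding C1_def
  proof (induction rule: span_induct_alt)
    case base
    then show ?case
      using f0 span_zero by blast
  next
    case (step c v z)
    then obtain y where y: "y \<in> span Fix" "f y = z"
      by auto
    obtain e where e: "e ^ Q = c"
      using nth_root_exists[of Q c] Q by auto
    have yC: "y \<in> C" "v \<in> C" "scale e v \<in> C"
      using y(1) step C1 C subspace_scale by (auto simp: C1_def Fix_def)
    have "f (scale e v + y) = scale c v + z"
      using step yC by (simp add: fadd fscale e y Fix_def)
    then show ?case
      using y step by (intro bexI[of _ "scale e v + y"]) (auto intro: span_add span_scale span_base)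
  qed
  have refl: "y \<in> C1" if y: "y \<in> C" "f y \<in> C1" for y
  proof -
    obtain z where z: "z \<in> C1" "f z = f y"
      using surj[of "f y"] y(2) by auto
    then have "f (y - z) = 0"
      using fminus y C1 by auto
    then have "y - z = 0"
      using finj[of "y - z"] subspace_diff[OF C] y z C1 by blast
    then show ?thesis
      using z by simp
  qed
  have as: "\<exists>y\<in>C1. f y - y = z" if "z \<in> C1" for z
    using that unfolding C1_def
  proof (induction rule: span_induct_alt)
    case base
    then show ?case
      using f0 span_zero by (intro bexI[of _ 0]) auto
  next
    case (step c v z)
    then obtain y where y: "y \<in> span Fix" "f y - y = z"
      by auto
    obtain e where e: "e ^ Q - e = c"
      using artin_schreier_root[OF Q] .
    have yC: "y \<in> C" "v \<in> C" "scale e v \<in> C"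
      using y(1) step C1 C subspace_scale by (auto simp: C1_def Fix_def)
    have "f (scale e v + y) - (scale e v + y) = scale (e ^ Q - e) v + (f y - y)"
      using step yC by (simp add: fadd fscale Fix_def scale_left_diff_distrib)
    then have "f (scale e v + y) - (scale e v + y) = scale c v + z"
      using y e by simp
    then show ?case
      using y step by (intro bexI[of _ "scale e v + y"]) (auto intro: span_add span_scale span_base)
  qed
  define Z where "Z i = (f ^^ i) x" for i
  have XC: "Z i \<in> C" for i
    by (induction i) (auto simp: Z_def x fC)
  have Z_Suc: "f (Z i) = Z (Suc i)" for i
    by (simp add: Z_def)
  define P where "P m \<longleftrightarrow> (\<exists>a. Z m - (\<Sum>i<m. scale (a i) (Z i)) \<in> C1)" for m
  have "\<exists>m. P m"
  proof -
    have "\<exists>A. Z j = (\<Sum>s\<in>S. scale (A s) s)" for j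
      using XC[of j] fin span_finite[OF fin(1)] by (auto simp: subset_iff)
    then obtain A where A: "\<And>j. Z j = (\<Sum>s\<in>S. scale (A j s) s)"
      by metis
    have "card S < card {..card S}"
      by simp
    then obtain c where c: "\<exists>j\<in>{..card S}. c j \<noteq> 0"
        "\<forall>s\<in>S. (\<Sum>j\<in>{..card S}. c j * A j s) = 0"
      using nontrivial_relation[OF fin(1), of "{..card S}" A] by auto
    define m where "m = Max {j \<in> {..card S}. c j \<noteq> 0}"
    have m: "m \<in> {j \<in> {..card S}. c j \<noteq> 0}"
      unfolding m_def by (rule Max_in) (use c in auto)
    have m_max: "c j = 0" if j: "j \<le> card S" "m < j" for j
    proof (rule ccontr)
      assume "c j \<noteq> 0"
      then have "j \<le> m"
        unfolding m_def using j by (intro Max_ge) auto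
      then show False
        using j by simp
    qed
    have "(\<Sum>j\<le>card S. scale (c j) (Z j)) = (\<Sum>s\<in>S. scale (\<Sum>j\<in>{..card S}. c j * A j s) s)"
      unfolding A scale_sum_right scale_sum_left by (subst sum.swap) simp
    also have "\<dots> = 0"
      using c(2) by simp
    also have "(\<Sum>j\<le>card S. scale (c j) (Z j)) = (\<Sum>j\<le>m. scale (c j) (Z j))"
      by (rule sum.mono_neutral_right) (use m m_max in auto)
    also have "\<dots> = scale (c m) (Z m) + (\<Sum>j<m. scale (c j) (Z j))"
      by (simp add: lessThan_Suc_atMost[symmetric])
    finally have "scale (c m) (Z m) = - (\<Sum>j<m. scale (c j) (Z j))"
      by (simp add: eq_neg_iff_add_eq_0)
    then have "scale (inverse (c m)) (scale (c m) (Z m)) =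
        scale (inverse (c m)) (- (\<Sum>j<m. scale (c j) (Z j)))"
      by simp
    then have "Z m = (\<Sum>j<m. scale (- inverse (c m) * c j) (Z j))"
      using m by (simp add: scale_sum_right sum_negf)
    then have "P m"
      unfolding P_def using subspace_0[OF C1(1)]
      by (intro exI[of _ "\<lambda>j. - inverse (c m) * c j"]) simp
    then show ?thesis ..
  qed
  define m where "m = (LEAST m. P m)"
  have "P m" and m_min: "\<And>k. k < m \<Longrightarrow> \<not> P k"
    using LeastI_ex[OF \<open>\<exists>m. P m\<close>] not_less_Least by (auto simp: m_def)
  obtain a where a: "Z m - (\<Sum>i<m. scale (a i) (Z i)) \<in> C1"
    using \<open>P m\<close> P_def by auto
  have "m > 0"
    using a x by (cases m) (auto simp: Z_def)
  then obtain k where k: "m = Suc k"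
    by (cases m) auto
  have "\<exists>j<m. a j \<noteq> 0"
  proof (rule ccontr)
    assume "\<not> ?thesis"
    then have "f (Z k) \<in> C1"
      using a by (simp add: k Z_Suc)
    then have "Z k \<in> C1"
      using refl XC by blast
    then have "P k"
      unfolding P_def by (intro exI[of _ "\<lambda>_. 0"]) simp
    then show False
      using m_min k by auto
  qed
  then obtain j0 where j0: "j0 < m" "a j0 \<noteq> 0"
    by auto
  \<comment> \<open>Solving \<open>f y \<equiv> y\<close> for \<open>y = \<Sum>\<^sub>i c\<^sub>i f\<^sup>i x\<close> gives \<open>c\<^sub>i\<close> as additive polynomials in the
    last coefficient \<open>z\<close>, and one equation for \<open>z\<close>.\<close>
  have "j0 < m" "(a j0) ^ (Q ^ (m - Suc j0)) \<noteq> 0"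
    using j0 by auto
  then obtain z where z: "z \<noteq> 0" "(\<Sum>j<m. (a j) ^ (Q ^ (m - Suc j)) * z ^ (Q ^ (m - j))) = z"
    using additive_polynomial_fixed_point[OF Q, of j0 m "\<lambda>j. (a j) ^ (Q ^ (m - Suc j))"] by metis
  have frob_sum: "(sum g {..<n :: nat} :: 'a) ^ Q = (\<Sum>i<n. g i ^ Q)" for g n
    using Q by (induction n) (auto simp: frob)
  define c where "c i = (\<Sum>j\<le>i. (a j) ^ (Q ^ (i - j)) * z ^ (Q ^ (Suc i - j)))" for i
  have c0: "c 0 = a 0 * z ^ Q"
    by (simp add: c_def)
  have c_Suc: "c (Suc i) = c i ^ Q + a (Suc i) * z ^ Q" for i
  proof -
    have "c i ^ Q = (\<Sum>j\<le>i. (a j) ^ (Q ^ (Suc i - j)) * z ^ (Q ^ (Suc (Suc i) - j)))"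
      unfolding c_def lessThan_Suc_atMost[symmetric] frob_sum
      by (intro sum.cong refl)
        (auto simp: power_mult_distrib Suc_diff_le mult.commute simp flip: power_mult)
    then show ?thesis
      unfolding c_def[of "Suc i"] by simp
  qed
  have ck: "c k = z"
    using z(2) by (simp add: c_def k lessThan_Suc_atMost)
  define y where "y = (\<Sum>i<m. scale (c i) (Z i))"
  define e where "e = Z m - (\<Sum>i<m. scale (a i) (Z i))"
  have e: "e \<in> C1" "Z m = (\<Sum>i<m. scale (a i) (Z i)) + e"
    using a by (auto simp: e_def)
  have sumC: "(\<Sum>i<n. scale (b i) (Z i)) \<in> C" for b n
    by (intro subspace_sum[OF C] subspace_scale[OF C] XC)
  have f_sum: "f (\<Sum>i<n. scale (b i) (Z i)) = (\<Sum>i<n. scale (b i ^ Q) (Z (Suc i)))" for b n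
  proof (induction n)
    case (Suc n)
    then show ?case
      using fadd[OF sumC[of b n] subspace_scale[OF C XC[of n]]]
      by (simp add: fscale[OF XC] Z_Suc)
  qed (simp add: f0)
  have yC: "y \<in> C"
    unfolding y_def by (rule sumC)
  have "f y = y + scale (z ^ Q) e"
  proof -
    have "f y = (\<Sum>i<k. scale (c i ^ Q) (Z (Suc i))) + scale (z ^ Q) (Z m)"
      unfolding y_def f_sum by (simp add: k ck)
    also have "\<dots> = (\<Sum>i<k. scale (c i ^ Q) (Z (Suc i)))
        + (\<Sum>i<Suc k. scale (z ^ Q * a i) (Z i)) + scale (z ^ Q) e"
      using arg_cong[OF e(2), of "scale (z ^ Q)"]
      by (simp only: scale_right_distrib scale_sum_right scale_scale k[symmetric] add.assoc)
    also have "(\<Sum>i<Suc k. scale (z ^ Q * a i) (Z i)) =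
        scale (c 0) (Z 0) + (\<Sum>i<k. scale (z ^ Q * a (Suc i)) (Z (Suc i)))"
      unfolding sum.lessThan_Suc_shift c0 by (simp add: mult.commute)
    also have "(\<Sum>i<k. scale (c i ^ Q) (Z (Suc i))) +
        (scale (c 0) (Z 0) + (\<Sum>i<k. scale (z ^ Q * a (Suc i)) (Z (Suc i)))) =
        scale (c 0) (Z 0) + (\<Sum>i<k. scale (c (Suc i)) (Z (Suc i)))"
      by (simp add: c_Suc scale_left_distrib sum.distrib mult.commute)
    also have "\<dots> = y"
      unfolding y_def k sum.lessThan_Suc_shift ..
    finally show ?thesis .
  qed
  moreover obtain y' where y': "y' \<in> C1" "f y' - y' = - scale (z ^ Q) e"
    using as[of "- scale (z ^ Q) e"] C1(1) e(1) subspace_neg subspace_scale by blast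
  moreover have "y' \<in> C"
    using y' C1 by auto
  ultimately have "f (y + y') = y + y'"
    using fadd[OF yC] by (simp add: algebra_simps)
  then have "y + y' \<in> C1"
    unfolding C1_def using subspace_add[OF C yC \<open>y' \<in> C\<close>] by (intro span_base) (simp add: Fix_def)
  then have "y + y' - y' \<in> C1"
    using y'(1) subspace_diff[OF C1(1)] by blast
  then have "scale (inverse z) y \<in> C1"
    using subspace_scale[OF C1(1)] by simp
  also have "scale (inverse z) y = Z k - (\<Sum>i<k. scale (- inverse z * c i) (Z i))"
    using z(1) by (simp add: y_def k ck scale_right_distrib scale_sum_right sum_negf)
  finally have "P k"
    unfolding P_def by (intro exI[of _ "\<lambda>i. - inverse z * c i"])
  then show False
    using m_min k by auto
qed

end

section \<open>Filtrations compatible with Frobenius\<close>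

text \<open>
  A module over the skew polynomial ring, seen as a vector space with an injective semilinear
  operator. The field is perfect, so images of subspaces under \<open>\<tau>\<close> are subspaces.
\<close>

locale frobenius_space = alg_closed_vector_space scale
  for scale :: "'a::alg_closed_field \<Rightarrow> 'b::ab_group_add \<Rightarrow> 'b" +
  fixes q :: nat and \<tau> :: "'b \<Rightarrow> 'b"
  assumes q: "1 < q"
    and frobenius_add: "\<And>x y. (x + y :: 'a) ^ q = x ^ q + y ^ q"
    and tau_add: "\<tau> (x + y) = \<tau> x + \<tau> y"
    and tau_scale: "\<tau> (scale c x) = scale (c ^ q) (\<tau> x)"
    and tau_inj: "\<tau> x = 0 \<Longrightarrow> x = 0"
begin

lemma frobenius_pow_add: "(x + y :: 'a) ^ (q ^ n) = x ^ (q ^ n) + y ^ (q ^ n)"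
  by (induction n arbitrary: x y) (simp_all add: frobenius_add power_mult mult.commute[of q])

lemma frobenius_pow_root: "\<exists>y. y ^ (q ^ n) = (x :: 'a)"
  using nth_root_exists[of "q ^ n" x] q by simp

lemma tau_pow_add: "(\<tau> ^^ n) (x + y) = (\<tau> ^^ n) x + (\<tau> ^^ n) y"
  by (induction n) (auto simp: tau_add)

lemma tau_pow_0 [simp]: "(\<tau> ^^ n) 0 = 0"
  using tau_pow_add[of n 0 0] by simp

lemma tau_pow_diff: "(\<tau> ^^ n) (x - y) = (\<tau> ^^ n) x - (\<tau> ^^ n) y"
  using tau_pow_add[of n "x - y" y] by simp

lemma tau_pow_scale: "(\<tau> ^^ n) (scale c x) = scale (c ^ (q ^ n)) ((\<tau> ^^ n) x)"
  by (induction n) (auto simp: tau_scale simp flip: power_mult, simp add: mult.commute)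

lemma tau_pow_sum: "(\<tau> ^^ n) (sum f S) = (\<Sum>x\<in>S. (\<tau> ^^ n) (f x))"
  by (induction S rule: infinite_finite_induct) (auto simp: tau_pow_add)

lemma tau_pow_inj: "(\<tau> ^^ n) x = 0 \<Longrightarrow> x = 0"
  by (induction n) (auto dest: tau_inj)

lemma tau_diff: "\<tau> (x - y) = \<tau> x - \<tau> y"
  using tau_pow_diff[of 1] by simp

lemma tau_0: "\<tau> 0 = 0"
  using tau_pow_0[of 1] by simp

lemma subspace_tau_image:
  assumes "subspace S"
  shows "subspace ((\<tau> ^^ n) ` S)"
proof (rule subspaceI)
  show "0 \<in> (\<tau> ^^ n) ` S"
    using subspace_0[OF assms] by (intro image_eqI[of _ _ 0]) auto
next
  fix x y assume "x \<in> (\<tau> ^^ n) ` S" "y \<in> (\<tau> ^^ n) ` S"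
  then show "x + y \<in> (\<tau> ^^ n) ` S"
    using subspace_add[OF assms] by (auto simp flip: tau_pow_add)
next
  fix c :: 'a and x assume x: "x \<in> (\<tau> ^^ n) ` S"
  obtain e where "e ^ (q ^ n) = c"
    using frobenius_pow_root[of n c] by auto
  then show "scale c x \<in> (\<tau> ^^ n) ` S"
    using x subspace_scale[OF assms] by (auto simp flip: tau_pow_scale)
qed

text \<open>
  From the index \<open>N\<close> on, each step of the filtration is generated by the preceding one:
  \<open>F\<^sub>i\<^sub>+\<^sub>1 = F\<^sub>i + \<tau> F\<^sub>i\<close>.
\<close>

definition stable_from :: "(nat \<Rightarrow> 'b set) \<Rightarrow> nat \<Rightarrow> bool"
  where "stable_from F N \<longleftrightarrow> (\<forall>i\<ge>N. \<forall>x\<in>F (Suc i). \<exists>y\<in>F i. x - \<tau> y \<in> F i)"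

end

text \<open>
  A filtration of \<open>M\<close> for which \<open>\<tau>\<close> has degree exactly 1 and \<open>T\<close> has degree exactly \<open>b\<close>, that is, both
  are injective on the graded pieces. In the application \<open>T\<close> is the action of a power of \<open>t\<close>.
\<close>

locale tau_filtration = frobenius_space scale q \<tau>
  for scale :: "'a::alg_closed_field \<Rightarrow> 'b::ab_group_add \<Rightarrow> 'b" and q \<tau> +
  fixes T :: "'b \<Rightarrow> 'b" and b :: nat and M :: "'b set" and F :: "nat \<Rightarrow> 'b set"
  assumes b: "0 < b"
    and T_add: "T (x + y) = T x + T y"
    and T_scale: "T (scale c x) = scale c (T x)"
    and T_tau: "T (\<tau> x) = \<tau> (T x)"
    and subspace_F: "subspace (F i)"
    and F_Suc: "F i \<subseteq> F (Suc i)"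
    and F_fin: "\<exists>S. finite S \<and> F i \<subseteq> span S"
    and F_Union: "(\<Union>i. F i) = M"
    and tau_F: "x \<in> M \<Longrightarrow> \<tau> x \<in> F (Suc i) \<longleftrightarrow> x \<in> F i"
    and T_F: "x \<in> M \<Longrightarrow> T x \<in> F (i + b) \<longleftrightarrow> x \<in> F i"
begin

lemma F_mono: "i \<le> j \<Longrightarrow> F i \<subseteq> F j"
  using lift_Suc_mono_le[of F] F_Suc by blast

lemma F_M: "x \<in> F i \<Longrightarrow> x \<in> M"
  using F_Union by auto

lemma subspace_M: "subspace M"
proof (rule subspaceI)
  show "0 \<in> M"
    using F_M subspace_0 subspace_F by blast
next
  fix x y assume "x \<in> M" "y \<in> M"
  then obtain i j where "x \<in> F i" "y \<in> F j"
    using F_Union by auto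
  then have "x \<in> F (max i j)" "y \<in> F (max i j)"
    using F_mono[of i "max i j"] F_mono[of j "max i j"] by auto
  then show "x + y \<in> M"
    using F_M subspace_add subspace_F by blast
next
  fix c x assume "x \<in> M"
  then show "scale c x \<in> M"
    using F_Union F_M subspace_scale subspace_F by blast
qed

lemma tau_M: "x \<in> M \<Longrightarrow> \<tau> x \<in> M"
  using F_Union tau_F F_M by blast

lemma tau_pow_M: "x \<in> M \<Longrightarrow> (\<tau> ^^ n) x \<in> M"
  by (induction n) (auto simp: tau_M)

lemma tau_pow_F: "x \<in> M \<Longrightarrow> (\<tau> ^^ n) x \<in> F (i + n) \<longleftrightarrow> x \<in> F i"
  by (induction n) (auto simp: tau_F tau_pow_M)

lemma T_0: "T 0 = 0"
  using T_add[of 0 0] by simp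

lemma T_diff: "T (x - y) = T x - T y"
  using T_add[of "x - y" y] by simp

lemma T_sum: "T (sum f S) = (\<Sum>x\<in>S. T (f x))"
  by (induction S rule: infinite_finite_induct) (auto simp: T_add T_0)

lemma T_tau_pow: "T ((\<tau> ^^ n) x) = (\<tau> ^^ n) (T x)"
  by (induction n) (auto simp: T_tau)

lemma T_M: "x \<in> M \<Longrightarrow> T x \<in> M"
  using F_Union T_F F_M by blast

lemma stable_from_pow:
  assumes st: "stable_from F N" and i: "N \<le> Suc i" and x: "x \<in> F (Suc i + n)"
  shows "\<exists>y\<in>F (Suc i). x - (\<tau> ^^ n) y \<in> F (i + n)"
  using x
proof (induction n arbitrary: x)
  case 0
  then show ?case
    using subspace_0[OF subspace_F] by (intro bexI[of _ x]) auto
next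
  case (Suc n)
  obtain y where y: "y \<in> F (Suc i + n)" "x - \<tau> y \<in> F (Suc i + n)"
    using st Suc.prems i unfolding stable_from_def
    by (metis add_Suc_right le_add1 order_trans)
  obtain z where z: "z \<in> F (Suc i)" "y - (\<tau> ^^ n) z \<in> F (i + n)"
    using Suc.IH[OF y(1)] by auto
  have "\<tau> (y - (\<tau> ^^ n) z) \<in> F (Suc (i + n))"
    using tau_F z(2) F_M by blast
  then have "(x - \<tau> y) + \<tau> (y - (\<tau> ^^ n) z) \<in> F (Suc (i + n))"
    using y(2) subspace_add[OF subspace_F] by simp
  then show ?case
    using z(1) by (intro bexI[of _ z]) (auto simp: tau_diff)
qed

text \<open>
  On the graded pieces \<open>T\<close> is injective and \<open>\<tau>\<^sup>b\<close> is bijective, so all dimensions agree and \<open>T\<close> is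
  bijective as well.
\<close>

lemma T_surj_modulo:
  assumes st: "stable_from F (Suc k)" and x: "x \<in> F (Suc k + b)"
  shows "\<exists>y\<in>F (Suc k). x - T y \<in> F (k + b)"
proof (rule ccontr)
  assume no: "\<not> ?thesis"
  obtain S where S: "finite S" "F (Suc k) \<subseteq> span S"
    using F_fin by blast
  obtain G where G: "G \<subseteq> F (Suc k)" "independent G" "F k \<inter> span G = {0}"
      "\<And>y. y \<in> span (F (Suc k)) \<Longrightarrow> \<exists>a\<in>span G. y - a \<in> F k"
    using complement_in_spanning_set[OF subspace_F, of k "F (Suc k)"] F_Suc span_superset by blast
  have finG: "finite G"
    using independent_span_bound[OF S(1) G(2)] G(1) S(2) by auto
  have span_G: "span G \<subseteq> F (Suc k)"
    using G(1) span_minimal subspace_F by blast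
  have coeffs0: "\<forall>g\<in>G. c g = 0" if "(\<Sum>g\<in>G. scale (c g) g) \<in> F k" for c
  proof -
    have "(\<Sum>g\<in>G. scale (c g) g) \<in> span G"
      by (intro span_sum span_scale span_base)
    then have "(\<Sum>g\<in>G. scale (c g) g) = 0"
      using that G(3) by auto
    then show ?thesis
      using G(2) finG independentD by blast
  qed
  \<comment> \<open>The vectors \<open>T g\<close> and \<open>x\<close> would be independent modulo \<open>F (k + b)\<close>, and the
    \<open>\<tau>\<^sup>b g\<close> span.\<close>
  define h where "h g = (case g of None \<Rightarrow> x | Some g \<Rightarrow> T g)" for g
  have "card (insert None (Some ` G)) \<le> card G"
  proof (rule card_le_modulo[OF subspace_F[of "k + b"] finG, of _ h "\<tau> ^^ b"])
    fix j assume "j \<in> insert None (Some ` G)"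
    then have "h j \<in> F (Suc k + b)"
      using x G(1) T_F[of _ "Suc k"] F_M[of _ "Suc k"] by (auto simp: h_def subset_iff)
    then obtain y where y: "y \<in> F (Suc k)" "h j - (\<tau> ^^ b) y \<in> F (k + b)"
      using stable_from_pow[OF st, of k "h j" b] by auto
    obtain a where a: "a \<in> span G" "y - a \<in> F k"
      using G(4)[OF span_base[OF y(1)]] by auto
    obtain u where u: "a = (\<Sum>g\<in>G. scale (u g) g)"
      using a(1) span_finite[OF finG] by auto
    have "(\<tau> ^^ b) (y - a) \<in> F (k + b)"
      using a(2) tau_pow_F F_M by blast
    then have "(h j - (\<tau> ^^ b) y) + (\<tau> ^^ b) (y - a) \<in> F (k + b)"
      using y(2) subspace_add[OF subspace_F] by blast
    then show "\<exists>c. h j - (\<Sum>i\<in>G. scale (c i) ((\<tau> ^^ b) i)) \<in> F (k + b)"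
      by (intro exI[of _ "\<lambda>g. u g ^ (q ^ b)"])
        (simp add: tau_pow_diff u tau_pow_sum tau_pow_scale)
  next
    fix c assume c: "(\<Sum>j\<in>insert None (Some ` G). scale (c j) (h j)) \<in> F (k + b)"
    have eq: "(\<Sum>j\<in>insert None (Some ` G). scale (c j) (h j)) =
        scale (c None) x + T (\<Sum>g\<in>G. scale (c (Some g)) g)"
      using finG by (simp add: sum.reindex h_def T_sum T_scale)
    define y where "y = (\<Sum>g\<in>G. scale (c (Some g)) g)"
    have y: "y \<in> F (Suc k)"
      unfolding y_def using G(1) by (intro subspace_sum[OF subspace_F] subspace_scale[OF subspace_F]) auto
    have "c None = 0"
    proof (rule ccontr)
      assume ne: "c None \<noteq> 0"
      have "scale (inverse (c None)) (scale (c None) x + T y) \<in> F (k + b)"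
        using c subspace_scale[OF subspace_F] by (simp only: eq y_def)
      then have "x - T (scale (- inverse (c None)) y) \<in> F (k + b)"
        using ne by (simp only: T_scale scale_right_distrib scale_scale) simp
      then show False
        using no y subspace_scale[OF subspace_F] by blast
    qed
    then have "T y \<in> F (k + b)"
      using c by (simp add: eq y_def)
    then have "y \<in> F k"
      using T_F F_M y by blast
    then have "\<forall>g\<in>G. c (Some g) = 0"
      unfolding y_def by (rule coeffs0)
    then show "\<forall>j\<in>insert None (Some ` G). c j = 0"
      using \<open>c None = 0\<close> by auto
  qed (use finG in auto)
  also have "card (insert None (Some ` G)) = Suc (card G)"
    using finG by (subst card_insert_disjoint) (auto simp: card_image)
  finally show False
    by simp
qed

text \<open>
  The semilinear map \<open>T\<^sup>-\<^sup>1 \<tau>\<^sup>b\<close> of \<open>F\<^sub>k\<^sub>+\<^sub>1 / F\<^sub>k\<close>, realised on a complement \<open>C\<close> of \<open>F\<^sub>k\<close> that contains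
  \<open>S\<close>, has a basis of fixed vectors. Some of them span a complement of \<open>S\<close>, and \<open>T\<close> and \<open>\<tau>\<^sup>b\<close> have
  the same image of this complement modulo \<open>F\<^sub>k\<^sub>+\<^sub>b\<close>.
\<close>

lemma rational_complement:
  assumes st: "stable_from F (Suc k)"
    and S: "subspace S" "S \<subseteq> F (Suc k)" "F k \<inter> S = {0}"
  obtains A where "subspace A" "A \<subseteq> F (Suc k)"
    "\<And>s a. s \<in> S \<Longrightarrow> a \<in> A \<Longrightarrow> s - a \<in> F k \<Longrightarrow> s = 0"
    "\<And>x. x \<in> F (Suc k) \<Longrightarrow> \<exists>s\<in>S. \<exists>a\<in>A. x - s - a \<in> F k"
    "\<And>a. a \<in> A \<Longrightarrow> \<exists>a'\<in>A. T a - (\<tau> ^^ b) a' \<in> F (k + b)"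
    "\<And>a. a \<in> A \<Longrightarrow> \<exists>a'\<in>A. (\<tau> ^^ b) a - T a' \<in> F (k + b)"
proof -
  obtain C where C: "subspace C" "S \<subseteq> C" "C \<subseteq> F (Suc k)" "F k \<inter> C = {0}"
      "\<And>y. y \<in> F (Suc k) \<Longrightarrow> \<exists>c\<in>C. y - c \<in> F k"
    using complement_containing[OF subspace_F S(1) subspace_F F_Suc S(2,3)] by blast
  have CM: "x \<in> M" if "x \<in> C" for x
    using that C(3) F_M by blast
  have uniq: "y = y'" if "y \<in> C" "y' \<in> C" "x - T y \<in> F (k + b)" "x - T y' \<in> F (k + b)" for x y y'
  proof -
    have "(x - T y') - (x - T y) \<in> F (k + b)"
      using that subspace_diff[OF subspace_F] by blast
    then have "T (y - y') \<in> F (k + b)"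
      by (simp add: T_diff)
    then have "y - y' \<in> F k \<inter> C"
      using T_F CM that subspace_diff[OF C(1)] by blast
    then show ?thesis
      unfolding C(4) by simp
  qed
  have ex: "\<exists>y\<in>C. (\<tau> ^^ b) x - T y \<in> F (k + b)" if "x \<in> C" for x
  proof -
    have "(\<tau> ^^ b) x \<in> F (Suc k + b)"
      using that C(3) tau_pow_F CM by blast
    then obtain y where y: "y \<in> F (Suc k)" "(\<tau> ^^ b) x - T y \<in> F (k + b)"
      using T_surj_modulo[OF st] by blast
    obtain c where c: "c \<in> C" "y - c \<in> F k"
      using C(5)[OF y(1)] by auto
    have "T (y - c) \<in> F (k + b)"
      using c(2) T_F F_M by blast
    then have "((\<tau> ^^ b) x - T y) + T (y - c) \<in> F (k + b)"
      using y(2) subspace_add[OF subspace_F] by blast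
    then show ?thesis
      using c(1) by (intro bexI[of _ c]) (auto simp: T_diff)
  qed
  define f where "f x = (SOME y. y \<in> C \<and> (\<tau> ^^ b) x - T y \<in> F (k + b))" for x
  have f: "f x \<in> C" "(\<tau> ^^ b) x - T (f x) \<in> F (k + b)" if "x \<in> C" for x
    using someI_ex[of "\<lambda>y. y \<in> C \<and> (\<tau> ^^ b) x - T y \<in> F (k + b)"] ex[OF that]
    by (auto simp: f_def)
  have f_eqI: "f x = y" if "x \<in> C" "y \<in> C" "(\<tau> ^^ b) x - T y \<in> F (k + b)" for x y
    using uniq[OF f(1)[OF that(1)] that(2) f(2)[OF that(1)] that(3)] .
  define Fix where "Fix = {x \<in> C. f x = x}"
  have FixC: "span Fix \<subseteq> C"
    by (rule span_minimal[OF _ C(1)]) (auto simp: Fix_def)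
  have "C \<subseteq> span Fix"
  proof -
    obtain G where G: "finite G" "F (Suc k) \<subseteq> span G"
      using F_fin by blast
    show ?thesis
      unfolding Fix_def
    proof (rule lang_fixed_vectors_span[where Q = "q ^ b"])
      show "1 < q ^ b"
        using q b by (rule one_less_power)
      show "C \<subseteq> span G"
        using C(3) G(2) by blast
      show "f (x + y) = f x + f y" if "x \<in> C" "y \<in> C" for x y
      proof (rule f_eqI)
        have "((\<tau> ^^ b) x - T (f x)) + ((\<tau> ^^ b) y - T (f y)) \<in> F (k + b)"
          using f that subspace_add[OF subspace_F] by blast
        then show "(\<tau> ^^ b) (x + y) - T (f x + f y) \<in> F (k + b)"
          by (simp add: tau_pow_add T_add algebra_simps)
      qed (use f that subspace_add[OF C(1)] in auto)
      show "f (scale c x) = scale (c ^ (q ^ b)) (f x)" if "x \<in> C" for c x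
      proof (rule f_eqI)
        have "scale (c ^ (q ^ b)) ((\<tau> ^^ b) x - T (f x)) \<in> F (k + b)"
          using f that subspace_scale[OF subspace_F] by blast
        then show "(\<tau> ^^ b) (scale c x) - T (scale (c ^ (q ^ b)) (f x)) \<in> F (k + b)"
          by (simp add: tau_pow_scale T_scale scale_right_diff_distrib)
      qed (use f that subspace_scale[OF C(1)] in auto)
      show "x = 0" if "x \<in> C" "f x = 0" for x
      proof -
        have "(\<tau> ^^ b) x \<in> F (k + b)"
          using f(2)[OF that(1)] that(2) by (simp add: T_0)
        then have "x \<in> F k"
          using tau_pow_F CM that(1) by blast
        then show ?thesis
          using C(4) that(1) by auto
      qed
    qed (use C(1) G f frobenius_pow_add in auto)
  qed
  then have Fix: "span Fix = C"
    using FixC by blast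
  have "S \<subseteq> span Fix"
    using C(2) Fix by simp
  from complement_in_spanning_set[OF S(1) this]
  obtain G where G: "G \<subseteq> Fix" "S \<inter> span G = {0}"
      "\<And>y. y \<in> span Fix \<Longrightarrow> \<exists>a\<in>span G. y - a \<in> S"
    by metis
  have GC: "span G \<subseteq> C"
    using span_mono[OF G(1)] Fix by simp
  have fixed: "T g - (\<tau> ^^ b) g \<in> F (k + b)" if "g \<in> G" for g
  proof -
    have "(\<tau> ^^ b) g - T g \<in> F (k + b)"
      using f(2)[of g] G(1) that by (auto simp: Fix_def)
    then show ?thesis
      using subspace_neg[OF subspace_F] by fastforce
  qed
  have T_tau: "\<exists>a'\<in>span G. T a - (\<tau> ^^ b) a' \<in> F (k + b)" if "a \<in> span G" for a
    using that
  proof (induction rule: span_induct_alt)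
    case base
    show ?case
      using span_zero subspace_0[OF subspace_F] by (intro bexI[of _ 0]) (auto simp: T_0)
  next
    case (step c g x)
    obtain y where y: "y \<in> span G" "T x - (\<tau> ^^ b) y \<in> F (k + b)"
      using step by auto
    obtain e where e: "e ^ (q ^ b) = c"
      using frobenius_pow_root[of b c] by auto
    have "scale c (T g - (\<tau> ^^ b) g) + (T x - (\<tau> ^^ b) y) \<in> F (k + b)"
      using y(2) fixed[OF step(1)] subspace_scale[OF subspace_F] subspace_add[OF subspace_F] by blast
    also have "scale c (T g - (\<tau> ^^ b) g) + (T x - (\<tau> ^^ b) y) =
        T (scale c g + x) - (\<tau> ^^ b) (scale e g + y)"
      by (simp add: T_add T_scale tau_pow_add tau_pow_scale e scale_right_diff_distrib)
    finally show ?case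
      using span_add[OF span_scale[OF span_base[OF step(1)]] y(1)] by blast
  qed
  have tau_T: "\<exists>a'\<in>span G. (\<tau> ^^ b) a - T a' \<in> F (k + b)" if "a \<in> span G" for a
    using that
  proof (induction rule: span_induct_alt)
    case base
    show ?case
      using span_zero subspace_0[OF subspace_F] by (intro bexI[of _ 0]) (auto simp: T_0)
  next
    case (step c g x)
    obtain y where y: "y \<in> span G" "(\<tau> ^^ b) x - T y \<in> F (k + b)"
      using step by auto
    have "((\<tau> ^^ b) x - T y) - scale (c ^ (q ^ b)) (T g - (\<tau> ^^ b) g) \<in> F (k + b)"
      using y(2) fixed[OF step(1)] subspace_scale[OF subspace_F] subspace_diff[OF subspace_F] by blast
    also have "((\<tau> ^^ b) x - T y) - scale (c ^ (q ^ b)) (T g - (\<tau> ^^ b) g) =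
        (\<tau> ^^ b) (scale c g + x) - T (scale (c ^ (q ^ b)) g + y)"
      by (simp add: T_add T_scale tau_pow_add tau_pow_scale scale_right_diff_distrib)
    finally show ?case
      using span_add[OF span_scale[OF span_base[OF step(1)]] y(1)] by blast
  qed
  show thesis
  proof (rule that[of "span G"])
    show "span G \<subseteq> F (Suc k)"
      using GC C(3) by blast
    show "s = 0" if "s \<in> S" "a \<in> span G" "s - a \<in> F k" for s a
    proof -
      have "s - a \<in> F k \<inter> C"
        using that C(2) GC subspace_diff[OF C(1)] by blast
      then have "s = a"
        unfolding C(4) by simp
      then show ?thesis
        using that G(2) by auto
    qed
    show "\<exists>s\<in>S. \<exists>a\<in>span G. x - s - a \<in> F k" if x: "x \<in> F (Suc k)" for x
    proof -
      obtain c where c: "c \<in> C" "x - c \<in> F k"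
        using C(5)[OF x] by blast
      obtain a where a: "a \<in> span G" "c - a \<in> S"
        using G(3) c(1) Fix by blast
      show ?thesis
        using a c(2) by (intro bexI[of _ "c - a"] bexI[of _ a]) auto
    qed
  qed (use T_tau tau_T in auto)
qed

text \<open>
  With \<open>S\<close> the image of \<open>F\<^sub>m\<^sub>+\<^sub>1\<close> in \<open>F\<^sub>k\<^sub>+\<^sub>1\<close> and \<open>A\<close> a rational complement of it, the new filtration consists of
  the \<open>x\<close> with \<open>\<tau>\<^sup>n x \<in> F\<^sub>i\<^sub>+\<^sub>n\<^sub>-\<^sub>1 + \<tau>\<^bsup>i+n-k-1\<^esup> A\<close> for large \<open>n\<close>. It lies between \<open>F\<^sub>i\<^sub>-\<^sub>1\<close> and \<open>F\<^sub>i\<close>. An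
  element of \<open>F\<^sub>m\<^sub>+\<^sub>1\<close> survives at the index \<open>m + 1\<close> only if its image in \<open>S\<close> lies in \<open>A\<close> modulo \<open>F\<^sub>k\<close>, so it
  is zero. Stability from \<open>k + 1\<close> persists because what \<open>A\<close> misses is \<open>S\<close>, and \<open>S\<close> lies in \<open>\<tau> F\<^sub>k\<close>, as
  \<open>m < k\<close>.
\<close>

lemma filtration_step:
  assumes st: "stable_from F (Suc k)" and zero: "F m = {0}" and mk: "m < k"
  shows "\<exists>F'. tau_filtration scale q \<tau> T b M F' \<and> F' (Suc m) = {0} \<and> stable_from F' (Suc k)"
proof -
  define S where "S = (\<tau> ^^ (k - m)) ` F (Suc m)"
  have S: "subspace S" "S \<subseteq> F (Suc k)" "F k \<inter> S = {0}"
  proof -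
    show "subspace S"
      unfolding S_def by (rule subspace_tau_image[OF subspace_F])
    have *: "(\<tau> ^^ (k - m)) x \<in> F (i + (k - m)) \<longleftrightarrow> x \<in> F i" if "x \<in> F (Suc m)" for x i
      using that tau_pow_F F_M by blast
    show "S \<subseteq> F (Suc k)"
      unfolding S_def using *[of _ "Suc m"] mk by auto
    have "x = 0" if "x \<in> F k" "x \<in> S" for x
    proof -
      obtain y where "y \<in> F (Suc m)" "x = (\<tau> ^^ (k - m)) y"
        using \<open>x \<in> S\<close> by (auto simp: S_def)
      then show ?thesis
        using *[of y m] \<open>x \<in> F k\<close> zero mk by auto
    qed
    then show "F k \<inter> S = {0}"
      using subspace_0[OF subspace_F] subspace_0[OF \<open>subspace S\<close>] by auto
  qed
  obtain A where A: "subspace A" "A \<subseteq> F (Suc k)"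
    and A_S: "\<And>s a. s \<in> S \<Longrightarrow> a \<in> A \<Longrightarrow> s - a \<in> F k \<Longrightarrow> s = 0"
    and A_split: "\<And>x. x \<in> F (Suc k) \<Longrightarrow> \<exists>s\<in>S. \<exists>a\<in>A. x - s - a \<in> F k"
    and T_A: "\<And>a. a \<in> A \<Longrightarrow> \<exists>a'\<in>A. T a - (\<tau> ^^ b) a' \<in> F (k + b)"
    and A_T: "\<And>a. a \<in> A \<Longrightarrow> \<exists>a'\<in>A. (\<tau> ^^ b) a - T a' \<in> F (k + b)"
    using rational_complement[OF st S] by blast
  have AM: "a \<in> M" if "a \<in> A" for a
    using that A(2) F_M by blast
  define W where "W j y \<longleftrightarrow> (\<exists>a\<in>A. y - (\<tau> ^^ j) a \<in> F (k + j))" for j y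
  have W0: "W j y" if "y \<in> F (k + j)" for j y
    unfolding W_def using that subspace_0[OF A(1)] by (intro bexI[of _ 0]) auto
  have W_add: "W j (x + y)" if prem: "W j x" "W j y" for j x y
  proof -
    obtain a a' where "a \<in> A" "x - (\<tau> ^^ j) a \<in> F (k + j)" "a' \<in> A" "y - (\<tau> ^^ j) a' \<in> F (k + j)"
      using prem unfolding W_def by blast
    then show ?thesis
      unfolding W_def
      using subspace_add[OF A(1), of a a']
        subspace_add[OF subspace_F, of "x - (\<tau> ^^ j) a" "k + j" "y - (\<tau> ^^ j) a'"]
      by (intro bexI[of _ "a + a'"]) (auto simp: tau_pow_add algebra_simps)
  qed
  have W_scale: "W j (scale c x)" if prem: "W j x" for j c x
  proof -
    obtain a where a: "a \<in> A" "x - (\<tau> ^^ j) a \<in> F (k + j)"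
      using prem by (auto simp: W_def)
    obtain e where "e ^ (q ^ j) = c"
      using frobenius_pow_root[of j c] by auto
    then show ?thesis
      unfolding W_def using a subspace_scale[OF A(1), of a e] subspace_scale[OF subspace_F a(2), of c]
      by (intro bexI[of _ "scale e a"]) (auto simp: tau_pow_scale scale_right_diff_distrib)
  qed
  have W_tau: "W (j + t) ((\<tau> ^^ t) y) \<longleftrightarrow> W j y" if "y \<in> M" for j t y
  proof -
    have "(\<tau> ^^ t) y - (\<tau> ^^ (j + t)) a = (\<tau> ^^ t) (y - (\<tau> ^^ j) a)" for a
      by (simp add: tau_pow_diff funpow_add add.commute[of j])
    moreover have "y - (\<tau> ^^ j) a \<in> M" if "a \<in> A" for a
      using \<open>y \<in> M\<close> AM[OF that] tau_pow_M subspace_diff[OF subspace_M] by blast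
    ultimately show ?thesis
      unfolding W_def using tau_pow_F[of _ t "k + j"] by (simp add: add.assoc)
  qed
  have W_F: "y \<in> F (Suc k + j)" if prem: "W j y" for j y
  proof -
    obtain a where a: "a \<in> A" "y - (\<tau> ^^ j) a \<in> F (k + j)"
      using prem by (auto simp: W_def)
    have "(\<tau> ^^ j) a \<in> F (Suc k + j)"
      using tau_pow_F[OF AM[OF a(1)], of j "Suc k"] a(1) A(2) by auto
    moreover have "y - (\<tau> ^^ j) a \<in> F (Suc k + j)"
      using a(2) F_Suc[of "k + j"] by auto
    ultimately have "(y - (\<tau> ^^ j) a) + (\<tau> ^^ j) a \<in> F (Suc k + j)"
      using subspace_add[OF subspace_F] by blast
    then show ?thesis
      by simp
  qed
  have W_T: "W (j + b) (T y) \<longleftrightarrow> W j y" if y: "y \<in> M" for j y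
  proof
    assume "W j y"
    then obtain a where a: "a \<in> A" "y - (\<tau> ^^ j) a \<in> F (k + j)"
      by (auto simp: W_def)
    obtain a' where a': "a' \<in> A" "T a - (\<tau> ^^ b) a' \<in> F (k + b)"
      using T_A[OF a(1)] by auto
    have "T (y - (\<tau> ^^ j) a) \<in> F (k + j + b)"
      using a(2) T_F F_M by blast
    moreover have "(\<tau> ^^ j) (T a - (\<tau> ^^ b) a') \<in> F (k + b + j)"
      using a'(2) tau_pow_F F_M by blast
    ultimately have "T (y - (\<tau> ^^ j) a) + (\<tau> ^^ j) (T a - (\<tau> ^^ b) a') \<in> F (k + (j + b))"
      using subspace_add[OF subspace_F] by (simp add: add_ac)
    then show "W (j + b) (T y)"
      unfolding W_def using a'(1)
      by (intro bexI[of _ a']) (auto simp: T_diff tau_pow_diff T_tau_pow funpow_add)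
  next
    assume "W (j + b) (T y)"
    then obtain a where a: "a \<in> A" "T y - (\<tau> ^^ (j + b)) a \<in> F (k + (j + b))"
      by (auto simp: W_def)
    obtain a' where a': "a' \<in> A" "(\<tau> ^^ b) a - T a' \<in> F (k + b)"
      using A_T[OF a(1)] by auto
    have "(\<tau> ^^ j) ((\<tau> ^^ b) a - T a') \<in> F (k + b + j)"
      using a'(2) tau_pow_F F_M by blast
    then have "(T y - (\<tau> ^^ (j + b)) a) + (\<tau> ^^ j) ((\<tau> ^^ b) a - T a') \<in> F (k + j + b)"
      using a(2) subspace_add[OF subspace_F] by (simp add: add_ac)
    then have "T (y - (\<tau> ^^ j) a') \<in> F (k + j + b)"
      by (simp add: T_diff tau_pow_diff T_tau_pow funpow_add)
    then have "y - (\<tau> ^^ j) a' \<in> F (k + j)"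
      using T_F y AM[OF a'(1)] tau_pow_M subspace_diff[OF subspace_M] by blast
    then show "W j y"
      unfolding W_def using a'(1) by blast
  qed
  \<comment> \<open>The exponents \<open>n = k + 1 + t\<close> with \<open>t\<close> large enough make \<open>i + n - k - 1 = i + t\<close> a natural number.\<close>
  define F' where "F' i = {x \<in> M. \<exists>t. W (i + t) ((\<tau> ^^ (Suc k + t)) x)}" for i
  have W_mono: "W (i + t') ((\<tau> ^^ (Suc k + t')) x)"
    if prem: "x \<in> M" "W (i + t) ((\<tau> ^^ (Suc k + t)) x)" "t \<le> t'" for x i t t'
  proof -
    obtain s where s: "t' = t + s"
      using prem(3) le_Suc_ex by blast
    have "W (i + t + s) ((\<tau> ^^ s) ((\<tau> ^^ (Suc k + t)) x))"
      using W_tau[OF tau_pow_M[OF that(1)]] that(2) by blast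
    also have "(\<tau> ^^ s) ((\<tau> ^^ (Suc k + t)) x) = (\<tau> ^^ (s + (Suc k + t))) x"
      by (simp only: funpow_add comp_apply)
    finally show ?thesis
      by (simp add: s add_ac)
  qed
  have F'I: "x \<in> F' i" if "x \<in> M" "W i ((\<tau> ^^ Suc k) x)" for x i
    unfolding F'_def using that by (auto intro: exI[of _ 0])
  have F'_iff: "x \<in> F' (Suc k + e) \<longleftrightarrow> W e x" if "x \<in> M" for x e
  proof -
    have "W (Suc k + e + t) ((\<tau> ^^ (Suc k + t)) x) \<longleftrightarrow> W e x" for t
      using W_tau[OF that, of e "Suc k + t"] by (simp add: add_ac)
    then show ?thesis
      unfolding F'_def using that by simp
  qed
  have F_F': "x \<in> F' (Suc i)" if "x \<in> F i" for x i
  proof (rule F'I[OF F_M[OF that] W0])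
    have "(\<tau> ^^ Suc k) x \<in> F (i + Suc k)"
      using tau_pow_F that F_M by blast
    then show "(\<tau> ^^ Suc k) x \<in> F (k + Suc i)"
      by (simp add: add_ac)
  qed
  have F'_F: "x \<in> F i" if prem: "x \<in> F' i" for x i
  proof -
    obtain t where t: "x \<in> M" "W (i + t) ((\<tau> ^^ (Suc k + t)) x)"
      using prem by (auto simp: F'_def)
    then show ?thesis
      using W_F[OF t(2)] tau_pow_F[OF t(1), of "Suc k + t" i] by (simp add: add_ac)
  qed
  have "tau_filtration scale q \<tau> T b M F'"
  proof unfold_locales
    fix i
    show "subspace (F' i)"
    proof (rule subspaceI)
      show "0 \<in> F' i"
        by (rule F'I[OF subspace_0[OF subspace_M] W0]) (simp add: subspace_0[OF subspace_F] tau_0)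
      show "x + y \<in> F' i" if prem: "x \<in> F' i" "y \<in> F' i" for x y
      proof -
        obtain t t' where t: "x \<in> M" "W (i + t) ((\<tau> ^^ (Suc k + t)) x)"
            "y \<in> M" "W (i + t') ((\<tau> ^^ (Suc k + t')) y)"
          using prem by (auto simp: F'_def)
        then have "W (i + max t t') ((\<tau> ^^ (Suc k + max t t')) (x + y))"
          unfolding tau_pow_add by (intro W_add W_mono[OF t(1,2)] W_mono[OF t(3,4)]) simp_all
        then show ?thesis
          unfolding F'_def using subspace_add[OF subspace_M t(1,3)] by blast
      qed
      show "scale c x \<in> F' i" if prem: "x \<in> F' i" for c x
      proof -
        obtain t where t: "x \<in> M" "W (i + t) ((\<tau> ^^ (Suc k + t)) x)"
          using prem by (auto simp: F'_def)
        then have "W (i + t) ((\<tau> ^^ (Suc k + t)) (scale c x))"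
          unfolding tau_pow_scale by (intro W_scale)
        then show ?thesis
          unfolding F'_def using subspace_scale[OF subspace_M t(1)] by blast
      qed
    qed
    show "F' i \<subseteq> F' (Suc i)"
      using F'_F F_F' by blast
    show "\<exists>S. finite S \<and> F' i \<subseteq> span S"
      using F_fin[of i] F'_F by blast
    fix x assume x: "x \<in> M"
    show "\<tau> x \<in> F' (Suc i) \<longleftrightarrow> x \<in> F' i"
    proof -
      have *: "W (Suc i + t) ((\<tau> ^^ (Suc k + t)) (\<tau> x)) \<longleftrightarrow> W (i + Suc t) ((\<tau> ^^ (Suc k + Suc t)) x)" for t
        by (simp add: funpow_swap1)
      show ?thesis
      proof
        assume "\<tau> x \<in> F' (Suc i)"
        then obtain t where "W (Suc i + t) ((\<tau> ^^ (Suc k + t)) (\<tau> x))"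
          by (auto simp: F'_def)
        then have "W (i + Suc t) ((\<tau> ^^ (Suc k + Suc t)) x)"
          unfolding * .
        then show "x \<in> F' i"
          unfolding F'_def using x by blast
      next
        assume "x \<in> F' i"
        then obtain t where "W (i + t) ((\<tau> ^^ (Suc k + t)) x)"
          by (auto simp: F'_def)
        then have "W (i + Suc t) ((\<tau> ^^ (Suc k + Suc t)) x)"
          by (rule W_mono[OF x]) simp
        then have "W (Suc i + t) ((\<tau> ^^ (Suc k + t)) (\<tau> x))"
          unfolding * .
        then show "\<tau> x \<in> F' (Suc i)"
          unfolding F'_def using tau_M[OF x] by blast
      qed
    qed
    show "T x \<in> F' (i + b) \<longleftrightarrow> x \<in> F' i"
    proof -
      have "W (i + b + t) ((\<tau> ^^ (Suc k + t)) (T x)) \<longleftrightarrow> W (i + t) ((\<tau> ^^ (Suc k + t)) x)" for t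
        using W_T[OF tau_pow_M[OF x], of "i + t" "Suc k + t"] unfolding T_tau_pow
        by (simp only: add_ac)
      then show ?thesis
        unfolding F'_def using x T_M[OF x] by simp
    qed
  next
    show "(\<Union>i. F' i) = M"
      using F'_F F_F' F_Union by blast
  qed (use b T_add T_scale T_tau in auto)
  moreover have "F' (Suc m) = {0}"
  proof -
    have "x = 0" if prem: "x \<in> F' (Suc m)" for x
    proof -
      have x: "x \<in> F (Suc m)" "x \<in> M"
        using F'_F that F_M by auto
      obtain t where t: "W (Suc m + t) ((\<tau> ^^ (Suc k + t)) x)"
        using prem by (auto simp: F'_def)
      have "(\<tau> ^^ (Suc k + t)) x = (\<tau> ^^ (Suc m + t)) ((\<tau> ^^ (k - m)) x)"
      proof -
        have "Suc k + t = (Suc m + t) + (k - m)"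
          using mk by simp
        then show ?thesis
          by (simp only: funpow_add comp_apply)
      qed
      then have "W 0 ((\<tau> ^^ (k - m)) x)"
        using W_tau[OF tau_pow_M[OF x(2), of "k - m"], of 0 "Suc m + t"] t by simp
      then obtain a where "a \<in> A" "(\<tau> ^^ (k - m)) x - a \<in> F k"
        by (auto simp: W_def)
      then have "(\<tau> ^^ (k - m)) x = 0"
        using A_S[of "(\<tau> ^^ (k - m)) x" a] x(1) by (auto simp: S_def)
      then show ?thesis
        by (rule tau_pow_inj)
    qed
    moreover have "0 \<in> F' (Suc m)"
      using F_F' subspace_0[OF subspace_F] by blast
    ultimately show ?thesis
      by blast
  qed
  moreover have "stable_from F' (Suc k)"
    unfolding stable_from_def
  proof (intro allI impI ballI)
    fix i x assume "Suc k \<le> i" and x: "x \<in> F' (Suc i)"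
    then obtain e where e: "i = Suc k + e"
      using le_Suc_ex by blast
    have xM: "x \<in> M"
      using x by (auto simp: F'_def)
    have "W (Suc e) x"
      using F'_iff[OF xM, of "Suc e"] x e by simp
    then obtain a where a: "a \<in> A" "x - (\<tau> ^^ Suc e) a \<in> F (Suc k + e)"
      unfolding W_def by auto
    obtain y where y: "y \<in> F (Suc k)" "x - (\<tau> ^^ Suc e) a - (\<tau> ^^ e) y \<in> F (k + e)"
      using stable_from_pow[OF st _ a(2)] by auto
    obtain s a' where sa: "s \<in> S" "a' \<in> A" "y - s - a' \<in> F k"
      using A_split[OF y(1)] by auto
    obtain s0 where s0: "s0 \<in> F (Suc m)" "s = (\<tau> ^^ (k - m)) s0"
      using sa(1) by (auto simp: S_def)
    define z where "z = (\<tau> ^^ (k - Suc m)) s0"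
    have s_z: "s = \<tau> z"
    proof -
      have "k - m = Suc (k - Suc m)"
        using mk by simp
      then show ?thesis
        using s0(2) by (simp add: z_def)
    qed
    have z: "z \<in> F k"
      using tau_pow_F[of s0 "k - Suc m" "Suc m"] s0(1) F_M mk by (simp add: z_def)
    have tz: "(\<tau> ^^ e) z \<in> F (k + e)"
      using tau_pow_F z F_M by blast
    have r: "(\<tau> ^^ e) (y - s - a') \<in> F (k + e)"
      using tau_pow_F sa(3) F_M by blast
    have F'A: "(\<tau> ^^ e) a \<in> F' i" if "a \<in> A" for a
    proof -
      have "W e ((\<tau> ^^ e) a)"
        unfolding W_def using that subspace_0[OF subspace_F] by (intro bexI[of _ a]) auto
      then show ?thesis
        using F'_iff[OF tau_pow_M[OF AM[OF that]]] e by simp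
    qed
    have F'k: "y \<in> F' i" if "y \<in> F (k + e)" for y
      using F_F'[OF that] e by simp
    have F'_add: "u + v \<in> F' i" if "u \<in> F' i" "v \<in> F' i" for u v
      using subspace_add[OF tau_filtration.subspace_F[OF \<open>tau_filtration scale q \<tau> T b M F'\<close>] that] .
    have "(x - (\<tau> ^^ Suc e) a - (\<tau> ^^ e) y) + (\<tau> ^^ e) (y - s - a') + (\<tau> ^^ e) a' \<in> F' i"
      using F'_add F'k y(2) r F'A sa(2) by blast
    also have "(x - (\<tau> ^^ Suc e) a - (\<tau> ^^ e) y) + (\<tau> ^^ e) (y - s - a') + (\<tau> ^^ e) a' =
        x - \<tau> ((\<tau> ^^ e) a + (\<tau> ^^ e) z)"
      by (simp add: s_z tau_pow_diff tau_pow_add tau_add funpow_swap1 algebra_simps)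
    finally show "\<exists>y\<in>F' i. x - \<tau> y \<in> F' i"
      using F'_add[OF F'A[OF a(1)] F'k[OF tz]] by blast
  qed
  ultimately show ?thesis
    by blast
qed

text \<open>
  If the filtration vanishes at \<open>m\<close> and is stable from \<open>m + 1\<close>, then \<open>M = \<tau> M + F\<^sub>m\<^sub>+\<^sub>1\<close>, and the sum is direct.
  This identifies the dimension of \<open>F\<^sub>m\<^sub>+\<^sub>1\<close> with the rank of \<open>M\<close>.
\<close>

lemma division_by_tau:
  assumes F_m: "F m = {0}" and stable: "stable_from F (Suc m)" and "x \<in> F (m + n)"
  shows "\<exists>y\<in>M. x - \<tau> y \<in> F (Suc m)"
  using assms(3)
proof (induction n arbitrary: x)
  case 0
  then show ?case
    using F_Suc[of m] subspace_0[OF subspace_M]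
    by (intro bexI[of _ 0]) (auto simp: tau_0)
next
  case (Suc n)
  show ?case
  proof (cases n)
    case 0
    then show ?thesis
      using Suc.prems subspace_0[OF subspace_M]
      by (intro bexI[of _ 0]) (auto simp: tau_0)
  next
    case (Suc n')
    then have "Suc m \<le> m + n" "x \<in> F (Suc (m + n))"
      using Suc.prems by simp_all
    then obtain y where y: "y \<in> F (m + n)" "x - \<tau> y \<in> F (m + n)"
      using stable unfolding stable_from_def by blast
    obtain z where z: "z \<in> M" "x - \<tau> y - \<tau> z \<in> F (Suc m)"
      using Suc.IH[OF y(2)] by auto
    then show ?thesis
      using F_M[OF y(1)] subspace_add[OF subspace_M]
      by (intro bexI[of _ "y + z"]) (auto simp: tau_add diff_diff_eq)
  qed
qed

end

context frobenius_space
begin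

text \<open>
  Stability holds as soon as \<open>F\<^sub>i\<close> contains generators \<open>G\<close> of \<open>M\<close> modulo \<open>\<tau> M\<close>: if \<open>x \<in> F\<^sub>i\<^sub>+\<^sub>1\<close> and
  \<open>x - \<tau> y\<close> lies in the span of \<open>G\<close>, then \<open>\<tau> y \<in> F\<^sub>i\<^sub>+\<^sub>1\<close>, so \<open>y \<in> F\<^sub>i\<close>. From there the steps below the
  point of stability are removed one at a time.
\<close>

theorem balanced_filtration_exists:
  assumes "tau_filtration scale q \<tau> T b M F" and "F 0 = {0}"
    and fin: "finite G" "G \<subseteq> M" "\<And>x. x \<in> M \<Longrightarrow> \<exists>y\<in>M. x - \<tau> y \<in> span G"
  shows "\<exists>F' m. tau_filtration scale q \<tau> T b M F' \<and> F' m = {0} \<and> stable_from F' (Suc m)"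
proof -
  interpret tau_filtration scale q \<tau> T b M F
    by fact
  have "\<exists>k. G \<subseteq> F (Suc k)"
    using fin(1,2)
  proof (induction G rule: finite_induct)
    case (insert g G)
    then obtain k i where "G \<subseteq> F (Suc k)" "g \<in> F i"
      using F_Union by auto
    then show ?case
      using F_mono[of "Suc k" "Suc (max i k)"] F_mono[of i "Suc (max i k)"]
      by (intro exI[of _ "max i k"]) (auto simp: le_SucI)
  qed simp
  then obtain k where k: "G \<subseteq> F (Suc k)" ..
  have "stable_from F (Suc k)"
    unfolding stable_from_def
  proof (intro allI impI ballI)
    fix i x assume i: "Suc k \<le> i" and x: "x \<in> F (Suc i)"
    obtain y where y: "y \<in> M" "x - \<tau> y \<in> span G"
      using fin(3) x F_M by blast
    have "span G \<subseteq> F i"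
      using k F_mono[OF i] span_minimal subspace_F by blast
    then have xy: "x - \<tau> y \<in> F i"
      using y(2) by blast
    then have "x - (x - \<tau> y) \<in> F (Suc i)"
      using x F_Suc subspace_diff[OF subspace_F] by blast
    then have "y \<in> F i"
      using tau_F[OF y(1)] by simp
    then show "\<exists>y\<in>F i. x - \<tau> y \<in> F i"
      using xy by blast
  qed
  moreover have "\<exists>F'. tau_filtration scale q \<tau> T b M F' \<and> F' m = {0} \<and> stable_from F' (Suc k)"
    if "m \<le> k" for m
    using that
  proof (induction m)
    case 0
    then show ?case
      using assms(1,2) \<open>stable_from F (Suc k)\<close> by blast
  next
    case (Suc m)
    then obtain F' where F': "tau_filtration scale q \<tau> T b M F'" "F' m = {0}" "stable_from F' (Suc k)"
      by auto
    show ?case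
      using tau_filtration.filtration_step[OF F'(1,3,2)] Suc.prems by simp
  qed
  ultimately show ?thesis
    by blast
qed

end

section \<open>Skew polynomials\<close>

context alg_closed_vector_space
begin

text \<open>
  The linear map that sends the power with exponent \<open>i\<close> to \<open>g i\<close>. Its instances are the actions of
  skew polynomials, where \<open>g i = \<tau>\<^sup>i x\<close>, and of polynomials in \<open>t\<close>, as well as linear maps that are
  given on the basis \<open>\<tau>\<^sup>i\<close>.
\<close>

definition lincomb :: "'a poly \<Rightarrow> (nat \<Rightarrow> 'b) \<Rightarrow> 'b"
  where "lincomb f g = (\<Sum>i\<le>Polynomial.degree f. scale (poly.coeff f i) (g i))"

lemma lincomb_eq:
  assumes "Polynomial.degree f \<le> n"
  shows "lincomb f g = (\<Sum>i\<le>n. scale (poly.coeff f i) (g i))"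
  unfolding lincomb_def
  by (rule sum.mono_neutral_left) (use assms in \<open>auto simp: coeff_eq_0\<close>)

lemma lincomb_add: "lincomb (f + f') g = lincomb f g + lincomb f' g"
proof -
  define n where "n = max (Polynomial.degree f) (Polynomial.degree f')"
  have "Polynomial.degree (f + f') \<le> n"
    unfolding n_def by (rule degree_add_le_max)
  then show ?thesis
    by (simp add: lincomb_eq[of _ n] n_def scale_left_distrib sum.distrib)
qed

lemma lincomb_smult: "lincomb (Polynomial.smult c f) g = scale c (lincomb f g)"
  using degree_smult_le[of c f]
  by (simp add: lincomb_eq[of _ "Polynomial.degree f"] scale_sum_right)

lemma lincomb_0 [simp]: "lincomb 0 g = 0"
  by (simp add: lincomb_def)

lemma lincomb_monom: "lincomb (Polynomial.monom c n) g = scale c (g n)"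
proof -
  have "lincomb (Polynomial.monom c n) g = (\<Sum>i\<le>n. if i = n then scale c (g i) else 0)"
    unfolding lincomb_eq[OF degree_monom_le] by (intro sum.cong) auto
  then show ?thesis
    by simp
qed

lemma lincomb_sum: "lincomb (sum f S) g = (\<Sum>x\<in>S. lincomb (f x) g)"
  by (induction S rule: infinite_finite_induct) (auto simp: lincomb_add)

lemma lincomb_diff: "lincomb (f - f') g = lincomb f g - lincomb f' g"
  using lincomb_add[of "f - f'" f' g] by simp

lemma lincomb_add_right: "lincomb f (\<lambda>i. g i + g' i) = lincomb f g + lincomb f g'"
  by (simp add: lincomb_def scale_right_distrib sum.distrib)

lemma lincomb_in_subspace: "subspace S \<Longrightarrow> (\<And>i. g i \<in> S) \<Longrightarrow> lincomb f g \<in> S"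
  unfolding lincomb_def by (intro subspace_sum subspace_scale)

end

lemma poly_induct_monom [case_names monom add]:
  assumes "\<And>c n. P (Polynomial.monom c n)" and "\<And>f g. P f \<Longrightarrow> P g \<Longrightarrow> P (f + g)"
  shows "P (f :: 'a::comm_monoid_add poly)"
proof -
  have "P (\<Sum>i\<le>n. Polynomial.monom (poly.coeff f i) i)" for n
    by (induction n) (auto intro: assms)
  then show ?thesis
    using poly_as_sum_of_monoms[of f] by metis
qed

context frobenius_space
begin

definition skew_act :: "'a poly \<Rightarrow> 'b \<Rightarrow> 'b"
  where "skew_act f x = lincomb f (\<lambda>i. (\<tau> ^^ i) x)"

lemma skew_act_add: "skew_act (f + g) x = skew_act f x + skew_act g x"
  by (simp add: skew_act_def lincomb_add)

lemma skew_act_diff: "skew_act (f - g) x = skew_act f x - skew_act g x"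
  by (simp add: skew_act_def lincomb_diff)

lemma skew_act_sum: "skew_act (sum f S) x = (\<Sum>s\<in>S. skew_act (f s) x)"
  by (simp add: skew_act_def lincomb_sum)

lemma skew_act_0 [simp]: "skew_act 0 x = 0"
  by (simp add: skew_act_def)

lemma skew_act_monom: "skew_act (Polynomial.monom c n) x = scale c ((\<tau> ^^ n) x)"
  by (simp add: skew_act_def lincomb_monom)

lemma skew_act_1 [simp]: "skew_act 1 x = x"
  using skew_act_monom[of 1 0 x] by (simp add: monom_0 flip: one_pCons)

lemma skew_act_smult: "skew_act (Polynomial.smult c f) x = scale c (skew_act f x)"
  by (simp add: skew_act_def lincomb_smult)

lemma skew_act_add_right: "skew_act f (x + y) = skew_act f x + skew_act f y"
  by (simp add: skew_act_def tau_pow_add lincomb_add_right)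

lemma skew_act_0_right [simp]: "skew_act f 0 = 0"
  using skew_act_add_right[of f 0 0] by simp

lemma skew_act_sum_right: "skew_act f (sum g S) = (\<Sum>s\<in>S. skew_act f (g s))"
  by (induction S rule: infinite_finite_induct) (auto simp: skew_act_add_right)

end

lemma subfield_closed:
  assumes "subfield F (\<AA> :: 'a::field ring)"
  shows "0 \<in> F" "1 \<in> F" "\<And>x y. x \<in> F \<Longrightarrow> y \<in> F \<Longrightarrow> x + y \<in> F"
    "\<And>x y. x \<in> F \<Longrightarrow> y \<in> F \<Longrightarrow> x * y \<in> F" "\<And>x. x \<in> F \<Longrightarrow> - x \<in> F"
    "\<And>x n. x \<in> F \<Longrightarrow> x ^ n \<in> F"
    "\<And>f S. (\<And>s. s \<in> S \<Longrightarrow> f s \<in> F) \<Longrightarrow> sum f S \<in> F"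
proof -
  interpret A: field "\<AA> :: 'a ring"
    by (rule field_from_type_algebra)
  have sr: "subring F \<AA>"
    using assms subfieldE(1) by blast
  show 0: "0 \<in> F" and 1: "1 \<in> F" and add: "\<And>x y. x \<in> F \<Longrightarrow> y \<in> F \<Longrightarrow> x + y \<in> F"
    and mult: "\<And>x y. x \<in> F \<Longrightarrow> y \<in> F \<Longrightarrow> x * y \<in> F"
    using subringE[OF sr] by (auto simp: ring_of_type_algebra_def)
  show "- x \<in> F" if "x \<in> F" for x
  proof -
    have "\<ominus>\<^bsub>\<AA>\<^esub> x = - x"
      by (rule A.minus_equality) (auto simp: ring_of_type_algebra_def)
    then show ?thesis
      using subringE(5)[OF sr that] by simp
  qed
  show "x ^ n \<in> F" if "x \<in> F" for x n
    by (induction n) (auto simp: 1 mult that)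
  show "sum f S \<in> F" if "\<And>s. s \<in> S \<Longrightarrow> f s \<in> F" for f :: "'c \<Rightarrow> 'a" and S
    using that by (induction S rule: infinite_finite_induct) (auto simp: 0 add)
qed

locale frobenius_field =
  fixes Fq :: "'a::alg_closed_field set"
  assumes subfield_Fq: "subfield Fq \<AA>" and finite_Fq: "finite Fq"
begin

abbreviation q :: nat where "q \<equiv> card Fq"

lemma q_gt_1: "1 < q"
proof -
  have "card {0, 1 :: 'a} \<le> q"
    using subfield_closed(1,2)[OF subfield_Fq] finite_Fq by (intro card_mono) auto
  then show ?thesis
    by simp
qed

lemma zero_pow_q [simp]: "(0 :: 'a) ^ q = 0" "(0 :: 'a) ^ q ^ n = 0"
  using q_gt_1 by (simp_all add: power_0_left)

text \<open>
  Multiplication by \<open>x\<close> permutes the nonzero elements of the finite field, so it does not change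
  their product.
\<close>

lemma Fq_pow:
  assumes "x \<in> Fq"
  shows "x ^ q = x"
proof (cases "x = 0")
  case True
  then show ?thesis
    using q_gt_1 by simp
next
  case False
  define S where "S = Fq - {0}"
  have S: "finite S" "card S = q - 1"
    using finite_Fq subfield_closed(1)[OF subfield_Fq] by (auto simp: S_def)
  have "(*) x ` S \<subseteq> S"
    using False assms subfield_closed(4)[OF subfield_Fq] by (auto simp: S_def)
  moreover have "inj_on ((*) x) S"
    using False by (auto simp: inj_on_def)
  ultimately have "bij_betw ((*) x) S S"
    using endo_inj_surj[OF S(1)] by (auto simp: bij_betw_def)
  then have "(\<Prod>y\<in>S. x * y) = (\<Prod>y\<in>S. y)"
    by (rule prod.reindex_bij_betw)
  then have "x ^ (q - 1) * \<Prod>S = \<Prod>S"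
    by (simp add: prod.distrib S(2))
  moreover have "\<Prod>S \<noteq> 0"
    using S(1) by (simp add: S_def)
  ultimately have "x ^ (q - 1) = 1"
    by simp
  then show ?thesis
    using power_minus_mult[of q x] q_gt_1 by simp
qed

text \<open>
  The polynomial \<open>(X + 1)\<^sup>q - X\<^sup>q - 1\<close> has degree less than \<open>q\<close> and vanishes on the \<open>q\<close> elements of the
  finite field, so it is zero. The general identity follows by homogeneity.
\<close>

lemma frobenius_add: "(x + y :: 'a) ^ q = x ^ q + y ^ q"
proof -
  define p :: "'a poly" where "p = [:1, 1:] ^ q - Polynomial.monom 1 q - 1"
  have deg: "Polynomial.degree ([:1, 1:] ^ q :: 'a poly) = q"
    by (simp add: degree_power_eq)
  have "poly.coeff ([:1, 1:] ^ q :: 'a poly) q = 1"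
    using lead_coeff_power[of "[:1, 1:] :: 'a poly" q] by (simp add: deg)
  then have "poly.coeff p n = 0" if "n \<ge> q" for n
    using that q_gt_1 coeff_eq_0[of "[:1, 1:] ^ q :: 'a poly" n] deg
    by (cases "n = q") (auto simp: p_def)
  then have "p = 0 \<or> Polynomial.degree p < q"
    by (metis leading_coeff_0_iff not_le)
  have "Fq \<subseteq> {x. poly p x = 0}"
  proof
    fix x assume "x \<in> Fq"
    then have "(1 + x) ^ q = 1 + x" "x ^ q = x"
      using Fq_pow subfield_closed(2,3)[OF subfield_Fq] by blast+
    then show "x \<in> {x. poly p x = 0}"
      by (simp add: p_def poly_monom)
  qed
  have "p = 0"
  proof (rule ccontr)
    assume "p \<noteq> 0"
    have "q \<le> card {x. poly p x = 0}"
      using \<open>Fq \<subseteq> {x. poly p x = 0}\<close> poly_roots_finite[OF \<open>p \<noteq> 0\<close>] by (intro card_mono)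
    also have "\<dots> \<le> Polynomial.degree p"
      using \<open>p \<noteq> 0\<close> by (rule card_poly_roots_bound)
    finally show False
      using \<open>p = 0 \<or> Polynomial.degree p < q\<close> \<open>p \<noteq> 0\<close> by simp
  qed
  have *: "(1 + z) ^ q = z ^ q + 1" for z :: 'a
  proof -
    have "poly p z = 0"
      using \<open>p = 0\<close> by simp
    then show ?thesis
      unfolding p_def by (simp add: poly_monom algebra_simps)
  qed
  show ?thesis
  proof (cases "y = 0")
    case True
    then show ?thesis
      using q_gt_1 by simp
  next
    case False
    then have "x + y = y * (1 + x / y)"
      by (simp add: field_simps)
    then have "(x + y) ^ q = y ^ q * ((x / y) ^ q + 1)"
      by (simp only: power_mult_distrib *)
    also have "\<dots> = x ^ q + y ^ q"
      using False by (simp add: power_divide distrib_left)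
    finally show ?thesis .
  qed
qed

text \<open>
  The skew polynomial ring is itself a space with a semilinear operator, left multiplication by \<open>\<tau>\<close>,
  and the skew product is the action of its left factor.
\<close>

definition poly_tau :: "'a poly \<Rightarrow> 'a poly"
  where "poly_tau f = skew_mult Fq (Polynomial.monom 1 1) f"

lemma coeff_poly_tau: "poly.coeff (poly_tau f) n = (if n = 0 then 0 else poly.coeff f (n - 1) ^ q)"
proof -
  have "poly_tau f = (\<Sum>j\<le>Polynomial.degree f. Polynomial.monom (poly.coeff f j ^ q) (Suc j))"
    by (simp add: poly_tau_def skew_mult_def degree_monom_eq atMost_Suc)
  then have "poly.coeff (poly_tau f) n =
      (\<Sum>j\<le>Polynomial.degree f. if Suc j = n then poly.coeff f j ^ q else 0)"
    by (simp add: coeff_sum)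
  also have "\<dots> = (if n = 0 then 0 else poly.coeff f (n - 1) ^ q)"
    using q_gt_1 by (cases n) (auto simp: coeff_eq_0)
  finally show ?thesis .
qed

lemma poly_tau_monom: "poly_tau (Polynomial.monom c n) = Polynomial.monom (c ^ q) (Suc n)"
proof (rule poly_eqI)
  fix m
  show "poly.coeff (poly_tau (Polynomial.monom c n)) m =
      poly.coeff (Polynomial.monom (c ^ q) (Suc n)) m"
    by (cases m) (simp_all add: coeff_poly_tau)
qed

sublocale poly: frobenius_space Polynomial.smult q poly_tau
proof unfold_locales
  show "1 < q"
    by (rule q_gt_1)
  show "poly_tau (f + g) = poly_tau f + poly_tau g" for f g
    by (auto simp: poly_eq_iff coeff_poly_tau frobenius_add)
  show "poly_tau (Polynomial.smult c f) = Polynomial.smult (c ^ q) (poly_tau f)" for c f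
    by (auto simp: poly_eq_iff coeff_poly_tau power_mult_distrib)
  show "f = 0" if "poly_tau f = 0" for f
  proof (rule poly_eqI)
    fix n
    have "poly.coeff (poly_tau f) (Suc n) = 0"
      using that by simp
    then show "poly.coeff f n = poly.coeff 0 n"
      by (simp add: coeff_poly_tau)
  qed
qed (auto simp: frobenius_add smult_add_right smult_add_left)

lemma coeff_poly_tau_pow:
  "poly.coeff ((poly_tau ^^ i) f) n = (if n < i then 0 else poly.coeff f (n - i) ^ (q ^ i))"
proof (induction i arbitrary: n)
  case (Suc i)
  show ?case
  proof (cases n)
    case 0
    then show ?thesis
      by (simp add: coeff_poly_tau)
  next
    case (Suc m)
    have "(0 :: 'a) ^ q = 0"
      using q_gt_1 by simp
    then show ?thesis
      using Suc.IH[of m] Suc by (simp add: coeff_poly_tau mult.commute flip: power_mult)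
  qed
qed simp

lemma skew_mult_eq: "skew_mult Fq f g = poly.skew_act f g"
proof -
  have "(poly_tau ^^ i) g = (\<Sum>j\<le>Polynomial.degree g. Polynomial.monom (poly.coeff g j ^ (q ^ i)) (i + j))" for i
  proof (rule poly_eqI)
    fix n
    have *: "(\<Sum>j\<le>Polynomial.degree g. if i + j = n then poly.coeff g j ^ (q ^ i) else 0) =
        (if n < i then 0 else poly.coeff g (n - i) ^ (q ^ i))"
    proof (cases "n < i")
      case False
      then have "i + j = n \<longleftrightarrow> j = n - i" for j
        by auto
      then have "(\<Sum>j\<le>Polynomial.degree g. if i + j = n then poly.coeff g j ^ (q ^ i) else 0) =
          (if n - i \<le> Polynomial.degree g then poly.coeff g (n - i) ^ (q ^ i) else 0)"
        by simp
      also have "\<dots> = poly.coeff g (n - i) ^ (q ^ i)"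
        using q_gt_1 by (auto simp: coeff_eq_0)
      finally show ?thesis
        using False by simp
    qed (auto intro!: sum.neutral)
    then show "poly.coeff ((poly_tau ^^ i) g) n =
        poly.coeff (\<Sum>j\<le>Polynomial.degree g. Polynomial.monom (poly.coeff g j ^ (q ^ i)) (i + j)) n"
      by (simp add: coeff_poly_tau_pow coeff_sum)
  qed
  then show ?thesis
    by (simp add: skew_mult_def poly.skew_act_def poly.lincomb_def poly.scale_sum_right smult_monom)
qed

lemma coeff_skew_mult:
  "poly.coeff (skew_mult Fq f g) n = (\<Sum>i\<le>n. poly.coeff f i * poly.coeff g (n - i) ^ (q ^ i))"
proof -
  have "poly.coeff (skew_mult Fq f g) n =
      (\<Sum>i\<le>max n (Polynomial.degree f). poly.coeff f i * poly.coeff ((poly_tau ^^ i) g) n)"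
    by (simp add: skew_mult_eq poly.skew_act_def coeff_sum
      poly.lincomb_eq[of f "max n (Polynomial.degree f)"])
  also have "\<dots> = (\<Sum>i\<le>n. poly.coeff f i * poly.coeff g (n - i) ^ (q ^ i))"
    by (rule sum.mono_neutral_cong_right) (auto simp: coeff_poly_tau_pow)
  finally show ?thesis .
qed

end

locale frobenius_module = frobenius_field Fq + frobenius_space scale "card Fq" \<tau>
  for Fq :: "'a::alg_closed_field set" and scale :: "'a \<Rightarrow> 'b::ab_group_add \<Rightarrow> 'b" and \<tau>
begin

lemma skew_act_tau: "skew_act (poly_tau f) x = \<tau> (skew_act f x)"
proof (induction f rule: poly_induct_monom)
  case (monom c n)
  show ?case
    by (simp add: poly_tau_monom skew_act_monom tau_scale)
next
  case (add f g)
  then show ?case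
    by (simp add: poly.tau_add skew_act_add tau_add)
qed

lemma skew_act_tau_pow: "skew_act ((poly_tau ^^ n) f) x = (\<tau> ^^ n) (skew_act f x)"
  by (induction n) (auto simp: skew_act_tau)

lemma skew_act_mult: "skew_act (skew_mult Fq f g) x = skew_act f (skew_act g x)"
proof (induction f rule: poly_induct_monom)
  case (monom c n)
  then show ?case
    by (simp add: skew_mult_eq poly.skew_act_monom skew_act_monom skew_act_smult skew_act_tau_pow)
next
  case (add f g)
  then show ?case
    by (simp add: skew_mult_eq poly.skew_act_add skew_act_add)
qed

end

context frobenius_field
begin

lemmas skew_mult_add_left = poly.skew_act_add[folded skew_mult_eq]
  and skew_mult_add_right = poly.skew_act_add_right[folded skew_mult_eq]
  and skew_mult_0_left [simp] = poly.skew_act_0[folded skew_mult_eq]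
  and skew_mult_0_right [simp] = poly.skew_act_0_right[folded skew_mult_eq]
  and skew_mult_1_left [simp] = poly.skew_act_1[folded skew_mult_eq]
  and skew_mult_smult_left = poly.skew_act_smult[folded skew_mult_eq]

lemma skew_mult_1_right [simp]: "skew_mult Fq f 1 = f"
proof (rule poly_eqI)
  fix n
  have "poly.coeff (skew_mult Fq f 1) n = (\<Sum>i\<le>n. if i = n then poly.coeff f i else 0)"
    unfolding coeff_skew_mult using q_gt_1 by (intro sum.cong) (auto simp: one_pCons coeff_pCons split: nat.splits)
  then show "poly.coeff (skew_mult Fq f 1) n = poly.coeff f n"
    by simp
qed

lemma skew_mult_closed:
  assumes F: "subfield F \<AA>" and "f \<in> polys_over F" "g \<in> polys_over F"
  shows "skew_mult Fq f g \<in> polys_over F"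
  using assms(2,3)
  by (auto simp: polys_over_def coeff_skew_mult image_subset_iff
      intro!: subfield_closed(7)[OF F] subfield_closed(4)[OF F] subfield_closed(6)[OF F])

end

section \<open>Row vectors and matrices of skew polynomials\<close>

text \<open>
  A row vector is a function on the natural numbers that vanishes from \<open>d\<close> on. In this way the row
  vectors of all lengths share one type, on which addition is pointwise.
\<close>

definition row_space :: "nat \<Rightarrow> (nat \<Rightarrow> 'a::zero poly) set"
  where "row_space d = {x. \<forall>k\<ge>d. x k = 0}"

definition unit_row :: "nat \<Rightarrow> nat \<Rightarrow> 'a::comm_semiring_1 poly"
  where "unit_row k = (\<lambda>l. if l = k then 1 else 0)"

definition mat_row :: "'a::zero poly mat \<Rightarrow> nat \<Rightarrow> nat \<Rightarrow> 'a poly"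
  where "mat_row A k = (\<lambda>l. if l < dim_col A then A $$ (k, l) else 0)"

definition row_scale :: "'a::comm_semiring_0 \<Rightarrow> (nat \<Rightarrow> 'a poly) \<Rightarrow> nat \<Rightarrow> 'a poly"
  where "row_scale c x = (\<lambda>k. Polynomial.smult c (x k))"

lemma row_scale_apply [simp]: "row_scale c x k = Polynomial.smult c (x k)"
  by (simp add: row_scale_def)

lemma sum_fun_apply: "(sum f S) k = (\<Sum>s\<in>S. f s k)"
  by (induction S rule: infinite_finite_induct) auto

lemma unit_row_in: "k < d \<Longrightarrow> unit_row k \<in> row_space d"
  by (auto simp: unit_row_def row_space_def)

lemma mat_row_in: "dim_col A = d \<Longrightarrow> mat_row A k \<in> row_space d"
  by (auto simp: mat_row_def row_space_def)

context frobenius_field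
begin

definition row_tau :: "(nat \<Rightarrow> 'a poly) \<Rightarrow> nat \<Rightarrow> 'a poly"
  where "row_tau x = (\<lambda>k. poly_tau (x k))"

definition row_mul :: "(nat \<Rightarrow> 'a poly) \<Rightarrow> 'a poly mat \<Rightarrow> nat \<Rightarrow> 'a poly"
  where "row_mul x A = (\<lambda>l. if l < dim_col A
    then \<Sum>k<dim_row A. skew_mult Fq (x k) (A $$ (k, l)) else 0)"

lemma row_tau_apply [simp]: "row_tau x k = poly_tau (x k)"
  by (simp add: row_tau_def)

sublocale rows: frobenius_space row_scale q row_tau
proof unfold_locales
  show "x = 0" if "row_tau x = 0" for x
  proof
    fix k
    show "x k = 0 k"
      using fun_cong[OF that, of k] poly.tau_inj[of "x k"] by simp
  qed
  show "1 < q"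
    by (rule q_gt_1)
qed (auto simp: fun_eq_iff smult_add_right smult_add_left frobenius_add poly.tau_add poly.tau_scale)

sublocale rows_module: frobenius_module Fq row_scale row_tau
  by unfold_locales

lemma row_tau_pow_apply: "(row_tau ^^ n) x k = (poly_tau ^^ n) (x k)"
  by (induction n arbitrary: x) auto

lemma row_act_apply: "rows.skew_act f x k = skew_mult Fq f (x k)"
  by (simp add: rows.skew_act_def rows.lincomb_def sum_fun_apply row_tau_pow_apply
      skew_mult_eq poly.skew_act_def poly.lincomb_def)

lemma subspace_row_space: "rows.subspace (row_space d)"
  by (rule rows.subspaceI) (auto simp: row_space_def)

lemma row_tau_in: "x \<in> row_space d \<Longrightarrow> row_tau x \<in> row_space d"
  by (auto simp: row_space_def poly.tau_0)

lemma row_mul_eq: "row_mul x A = (\<Sum>k<dim_row A. rows.skew_act (x k) (mat_row A k))"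
  by (auto simp: row_mul_def fun_eq_iff sum_fun_apply row_act_apply mat_row_def)

lemma row_mul_in: "dim_col A = d \<Longrightarrow> row_mul x A \<in> row_space d"
  by (auto simp: row_mul_def row_space_def)

lemma row_mul_add: "row_mul (x + y) A = row_mul x A + row_mul y A"
  by (simp add: row_mul_eq rows.skew_act_add sum.distrib)

lemma row_mul_0 [simp]: "row_mul 0 A = 0"
  by (simp add: row_mul_eq)

lemma row_mul_diff: "row_mul (x - y) A = row_mul x A - row_mul y A"
  using row_mul_add[of "x - y" y] by simp

lemma row_mul_sum: "row_mul (sum f S) A = (\<Sum>s\<in>S. row_mul (f s) A)"
  using sum_comp_morphism[of "\<lambda>x. row_mul x A" f S] by (simp add: row_mul_add comp_def)

lemma row_mul_act: "row_mul (rows.skew_act f x) A = rows.skew_act f (row_mul x A)"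
  by (simp add: row_mul_eq rows.skew_act_sum_right row_act_apply rows_module.skew_act_mult)

lemma row_mul_scale: "row_mul (row_scale c x) A = row_scale c (row_mul x A)"
  using row_mul_act[of "Polynomial.monom c 0" x A] by (simp add: rows.skew_act_monom)

lemma row_mul_tau: "row_mul (row_tau x) A = row_tau (row_mul x A)"
  using row_mul_act[of "Polynomial.monom 1 1" x A] by (simp add: rows.skew_act_monom)

lemma row_mul_unit: "k < dim_row A \<Longrightarrow> row_mul (unit_row k) A = mat_row A k"
proof -
  assume k: "k < dim_row A"
  have "row_mul (unit_row k) A = (\<Sum>j<dim_row A. if j = k then mat_row A j else 0)"
    unfolding row_mul_eq by (intro sum.cong) (auto simp: unit_row_def)
  then show ?thesis
    using k by simp
qed

lemma mat_row_mult:
  assumes "k < dim_row A" "dim_row B = dim_col A"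
  shows "mat_row (skew_mat_mult Fq A B) k = row_mul (mat_row A k) B"
  using assms by (auto simp: fun_eq_iff mat_row_def row_mul_def skew_mat_mult_def)

lemma row_mul_mult:
  assumes "dim_row B = dim_col A"
  shows "row_mul x (skew_mat_mult Fq A B) = row_mul (row_mul x A) B"
proof -
  have "row_mul x (skew_mat_mult Fq A B) =
      (\<Sum>k<dim_row A. rows.skew_act (x k) (row_mul (mat_row A k) B))"
    unfolding row_mul_eq[of x "skew_mat_mult Fq A B"] using assms
    by (intro sum.cong) (auto simp: mat_row_mult, simp add: skew_mat_mult_def)
  then show ?thesis
    by (simp add: row_mul_eq[of x A] row_mul_sum row_mul_act)
qed

lemma row_decomp: "x \<in> row_space d \<Longrightarrow> x = (\<Sum>k<d. rows.skew_act (x k) (unit_row k))"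
proof
  fix l assume x: "x \<in> row_space d"
  have "(\<Sum>k<d. rows.skew_act (x k) (unit_row k)) l = (\<Sum>k<d. if k = l then x k else 0)"
    unfolding sum_fun_apply by (intro sum.cong) (auto simp: row_act_apply unit_row_def)
  also have "\<dots> = x l"
    using x by (auto simp: row_space_def)
  finally show "x l = (\<Sum>k<d. rows.skew_act (x k) (unit_row k)) l" ..
qed

lemma tau_unit_row_apply: "(row_tau ^^ j) (unit_row k) l = (if l = k then Polynomial.monom 1 j else 0)"
proof -
  have "(poly_tau ^^ j) (1 :: 'a poly) = Polynomial.monom 1 j"
  proof (induction j)
    case 0
    show ?case
      by (simp add: monom_0 one_pCons)
  next
    case (Suc j)
    then show ?case
      by (simp add: poly_tau_monom)
  qed
  then show ?thesis
    by (simp add: row_tau_pow_apply unit_row_def)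
qed

lemma skew_mat_mult_dim [simp]:
  "dim_row (skew_mat_mult Fq A B) = dim_row A" "dim_col (skew_mat_mult Fq A B) = dim_col B"
  by (simp_all add: skew_mat_mult_def)

lemma mat_row_one: "k < d \<Longrightarrow> mat_row (1\<^sub>m d :: 'a poly mat) k = unit_row k"
  by (auto simp: mat_row_def unit_row_def fun_eq_iff)

lemma row_mul_one: "x \<in> row_space d \<Longrightarrow> row_mul x (1\<^sub>m d) = x"
  using row_decomp[of x d] by (simp add: row_mul_eq mat_row_one)

lemma mat_eqI_rows:
  assumes "A \<in> carrier_mat d d" "B \<in> carrier_mat d d"
    and "\<And>k. k < d \<Longrightarrow> mat_row A k = mat_row B k"
  shows "A = B"
proof (rule eq_matI)
  fix k l assume "k < dim_row B" "l < dim_col B"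
  then show "A $$ (k, l) = B $$ (k, l)"
    using assms(1,2) fun_cong[OF assms(3), of k l] by (auto simp: mat_row_def)
qed (use assms in auto)

lemma skew_mat_mult_carrier [intro, simp]:
  "A \<in> carrier_mat d e \<Longrightarrow> B \<in> carrier_mat e f \<Longrightarrow> skew_mat_mult Fq A B \<in> carrier_mat d f"
  by (auto simp: skew_mat_mult_def)

lemma skew_mat_mult_assoc:
  assumes "A \<in> carrier_mat d d" "B \<in> carrier_mat d d" "C \<in> carrier_mat d d"
  shows "skew_mat_mult Fq (skew_mat_mult Fq A B) C = skew_mat_mult Fq A (skew_mat_mult Fq B C)"
proof (rule mat_eqI_rows)
  fix k assume "k < d"
  moreover have "skew_mat_mult Fq A B \<in> carrier_mat d d" "skew_mat_mult Fq B C \<in> carrier_mat d d"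
    using assms by auto
  ultimately show "mat_row (skew_mat_mult Fq (skew_mat_mult Fq A B) C) k =
      mat_row (skew_mat_mult Fq A (skew_mat_mult Fq B C)) k"
    using assms carrier_matD by (metis mat_row_mult row_mul_mult)
qed (use assms in auto)

lemma skew_mat_mult_one [simp]:
  assumes "A \<in> carrier_mat d d"
  shows "skew_mat_mult Fq A (1\<^sub>m d) = A" "skew_mat_mult Fq (1\<^sub>m d) A = A"
proof -
  show "skew_mat_mult Fq A (1\<^sub>m d) = A"
    by (rule mat_eqI_rows[of _ d])
      (use assms skew_mat_mult_carrier[of A d d "1\<^sub>m d" d] in \<open>auto simp: mat_row_mult row_mul_one mat_row_in\<close>)
  show "skew_mat_mult Fq (1\<^sub>m d) A = A"
    by (rule mat_eqI_rows[of _ d])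
      (use assms skew_mat_mult_carrier[of "1\<^sub>m d" d d A d] in \<open>auto simp: mat_row_mult mat_row_one row_mul_unit\<close>)
qed

text \<open>
  The rows of degree less than \<open>n\<close> in \<open>\<tau>\<close>; the index 0 gives the zero row.
\<close>

definition degree_less :: "nat \<Rightarrow> nat \<Rightarrow> (nat \<Rightarrow> 'a poly) set"
  where "degree_less d n = {x \<in> row_space d. \<forall>k. \<forall>j\<ge>n. poly.coeff (x k) j = 0}"

lemma row_degree_bound:
  assumes "x \<in> row_space d"
  obtains n where "x \<in> degree_less d n"
proof -
  define n where "n = Suc (\<Sum>k<d. Polynomial.degree (x k))"
  have "poly.coeff (x k) j = 0" if "j \<ge> n" for k j
  proof (cases "k < d")
    case True
    then have "Polynomial.degree (x k) \<le> (\<Sum>k<d. Polynomial.degree (x k))"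
      by (intro member_le_sum) auto
    then show ?thesis
      using that by (intro coeff_eq_0) (simp add: n_def)
  next
    case False
    then show ?thesis
      using assms by (simp add: row_space_def)
  qed
  then show thesis
    using assms by (intro that[of n]) (auto simp: degree_less_def)
qed

lemma degree_less_mono: "m \<le> n \<Longrightarrow> degree_less d m \<subseteq> degree_less d n"
  by (auto simp: degree_less_def)

lemma degree_less_0: "x \<in> degree_less d 0 \<Longrightarrow> x = 0"
  by (auto simp: degree_less_def fun_eq_iff poly_eq_iff)

lemma degree_less_row_space: "x \<in> degree_less d n \<Longrightarrow> x \<in> row_space d"
  by (simp add: degree_less_def)

lemma degree_less_SucD:
  assumes "x \<in> degree_less d (Suc n)" and "\<And>k. poly.coeff (x k) n = 0"
  shows "x \<in> degree_less d n"
proof -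
  have "poly.coeff (x k) j = 0" if "n \<le> j" for j k
    using assms that by (cases "j = n") (auto simp: degree_less_def)
  then show ?thesis
    using assms(1) by (simp add: degree_less_def)
qed

lemma subspace_degree_less: "rows.subspace (degree_less d n)"
  by (rule rows.subspaceI) (auto simp: degree_less_def row_space_def)

lemma poly_tau_division: "\<exists>g. f = poly_tau g + [:poly.coeff f 0:]"
proof (induction f rule: poly_induct_monom)
  case (monom c n)
  show ?case
  proof (cases n)
    case 0
    then show ?thesis
      by (intro exI[of _ 0]) (simp add: monom_0 poly.tau_0)
  next
    case (Suc m)
    obtain e where "e ^ q = c"
      using poly.frobenius_pow_root[of 1 c] by auto
    then have "Polynomial.monom c n = poly_tau (Polynomial.monom e m)"
      using Suc by (simp add: poly_tau_monom)
    then show ?thesis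
      using Suc by (intro exI[of _ "Polynomial.monom e m"]) (simp add: coeff_poly_tau)
  qed
next
  case (add f g)
  then obtain f' g' where "f = poly_tau f' + [:poly.coeff f 0:]" "g = poly_tau g' + [:poly.coeff g 0:]"
    by auto
  then have "f + g = poly_tau (f' + g') + [:poly.coeff (f + g) 0:]"
    by (simp add: poly.tau_add) (metis (no_types, lifting) add.assoc add.left_commute add_pCons add_0)
  then show ?case ..
qed

text \<open>
  Division by \<open>\<tau>\<close> on the left, which is possible because the field is perfect: the constant
  coefficients are the remainder.
\<close>

lemma row_tau_division:
  assumes "x \<in> row_space d"
  shows "\<exists>y\<in>row_space d. x = row_tau y + (\<Sum>i<d. row_scale (poly.coeff (x i) 0) (unit_row i))"
proof -
  have "\<forall>k. \<exists>g. x k = poly_tau g + [:poly.coeff (x k) 0:]"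
    using poly_tau_division by blast
  from choice[OF this] obtain g where g: "\<And>k. x k = poly_tau (g k) + [:poly.coeff (x k) 0:]"
    by blast
  define y where "y = (\<lambda>k. if k < d then g k else 0)"
  have "x l = (row_tau y + (\<Sum>i<d. row_scale (poly.coeff (x i) 0) (unit_row i))) l" for l
  proof -
    have "(\<Sum>i<d. row_scale (poly.coeff (x i) 0) (unit_row i)) l =
        (\<Sum>i<d. if i = l then [:poly.coeff (x i) 0:] else 0)"
      unfolding sum_fun_apply by (intro sum.cong) (auto simp: unit_row_def)
    also have "\<dots> = (if l < d then [:poly.coeff (x l) 0:] else 0)"
      by simp
    finally show ?thesis
      using g[of l] assms by (auto simp: y_def row_space_def poly.tau_0)
  qed
  then have "x = row_tau y + (\<Sum>i<d. row_scale (poly.coeff (x i) 0) (unit_row i))"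
    by (rule ext)
  moreover have "y \<in> row_space d"
    by (simp add: y_def row_space_def)
  ultimately show ?thesis
    by blast
qed

lemma skew_act_in_filtration:
  assumes "tau_filtration row_scale (card Fq) row_tau T b M F"
    and "\<And>j. j \<ge> n \<Longrightarrow> poly.coeff f j = 0" and "e \<in> F (Suc m)" and "F m = {0}"
  shows "rows.skew_act f e \<in> F (m + n)"
proof -
  interpret tau_filtration row_scale "card Fq" row_tau T b M F
    by fact
  have "row_scale (poly.coeff f i) ((row_tau ^^ i) e) \<in> F (m + n)" for i
  proof (cases "i < n")
    case True
    have "(row_tau ^^ i) e \<in> F (Suc m + i)"
      using tau_pow_F assms(3) F_M by blast
    then show ?thesis
      using F_mono[of "Suc m + i" "m + n"] True rows.subspace_scale[OF subspace_F] by auto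
  qed (use assms(2) rows.subspace_0[OF subspace_F] in auto)
  then show ?thesis
    unfolding rows.skew_act_def rows.lincomb_def by (intro rows.subspace_sum[OF subspace_F])
qed

end

section \<open>Bases adapted to a balanced filtration\<close>

text \<open>
  The filtration is balanced: it vanishes up to an index \<open>m\<close> and is generated by \<open>\<tau>\<close> from \<open>m + 1\<close> on.
\<close>

locale balanced_filtration = frobenius_field Fq +
  tau_filtration row_scale "card Fq" row_tau "\<lambda>x. row_mul x A" b "row_space d" F
  for Fq :: "'a::alg_closed_field set" and A b d F +
  fixes m :: nat
  assumes A: "A \<in> carrier_mat d d" and F_m: "F m = {0}" and stable: "rows.stable_from F (Suc m)"
begin

text \<open>
  Both a basis of \<open>F\<^sub>m\<^sub>+\<^sub>1\<close> and the unit rows are bases of \<open>M\<close> modulo \<open>\<tau> M\<close>, so a basis of \<open>F\<^sub>m\<^sub>+\<^sub>1\<close> has \<open>d\<close>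
  elements.
\<close>

lemma basis_exists:
  obtains e where "\<And>k. k < d \<Longrightarrow> e k \<in> F (Suc m)"
    "\<And>c. (\<Sum>k<d. row_scale (c k) (e k)) = 0 \<Longrightarrow> \<forall>k<d. c k = 0"
    "\<And>x. x \<in> F (Suc m) \<Longrightarrow> \<exists>c. x = (\<Sum>k<d. row_scale (c k) (e k))"
proof -
  obtain S where S: "finite S" "F (Suc m) \<subseteq> rows.span S"
    using F_fin by blast
  obtain E where E: "E \<subseteq> F (Suc m)" "rows.independent E" "F (Suc m) \<subseteq> rows.span E"
    using rows.maximal_independent_subset[of "F (Suc m)"] by blast
  have finE: "finite E"
    using rows.independent_span_bound[OF S(1) E(2)] E(1) S(2) by auto
  define Z where "Z = (row_tau ^^ 1) ` row_space d"
  have Z: "rows.subspace Z"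
    unfolding Z_def by (rule rows.subspace_tau_image[OF subspace_row_space])
  have "card E \<le> card {..<d}"
  proof (rule rows.card_le_modulo[OF Z _ finE, where g = unit_row and h = "\<lambda>x. x"])
    fix x assume "x \<in> E"
    then have "x \<in> row_space d"
      using E(1) F_M by blast
    then obtain y where "y \<in> row_space d"
        "x = row_tau y + (\<Sum>i<d. row_scale (poly.coeff (x i) 0) (unit_row i))"
      using row_tau_division by blast
    then show "\<exists>c. x - (\<Sum>i<d. row_scale (c i) (unit_row i)) \<in> Z"
      unfolding Z_def by (intro exI[of _ "\<lambda>i. poly.coeff (x i) 0"] image_eqI[of _ _ y])
        (auto simp: algebra_simps)
  next
    fix c assume "(\<Sum>x\<in>E. row_scale (c x) x) \<in> Z"
    then obtain y where y: "y \<in> row_space d" "row_tau y = (\<Sum>x\<in>E. row_scale (c x) x)"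
      by (auto simp: Z_def)
    have "row_tau y \<in> F (Suc m)"
      unfolding y(2) using E(1) rows.subspace_scale[OF subspace_F]
      by (intro rows.subspace_sum[OF subspace_F]) auto
    then have "y = 0"
      using tau_F[OF y(1)] F_m by auto
    then have "(\<Sum>x\<in>E. row_scale (c x) x) = 0"
      using y(2) by (simp add: rows.tau_0)
    then show "\<forall>x\<in>E. c x = 0"
      using rows.independentD[OF E(2) finE] by blast
  qed simp
  moreover have "card {..<d} \<le> card E"
  proof (rule rows.card_le_modulo[OF Z finE, where h = unit_row and g = "\<lambda>x. x"])
    fix i assume "i \<in> {..<d}"
    then have "unit_row i \<in> row_space d"
      by (simp add: unit_row_in)
    then obtain n where n: "unit_row i \<in> F n"
      using F_Union by blast
    then have "unit_row i \<in> F (m + n)"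
      using F_mono[of n "m + n"] by auto
    then obtain y where y: "y \<in> row_space d" "unit_row i - row_tau y \<in> F (Suc m)"
      using division_by_tau[OF F_m stable] by blast
    then obtain c where "unit_row i - row_tau y = (\<Sum>x\<in>E. row_scale (c x) x)"
      using E(3) rows.span_finite[OF finE] by blast
    then show "\<exists>c. unit_row i - (\<Sum>x\<in>E. row_scale (c x) x) \<in> Z"
      unfolding Z_def using y(1) by (intro exI[of _ c] image_eqI[of _ _ y]) (auto simp: algebra_simps)
  next
    fix c assume "(\<Sum>i<d. row_scale (c i) (unit_row i)) \<in> Z"
    then obtain y where y: "row_tau y = (\<Sum>i<d. row_scale (c i) (unit_row i))"
      by (auto simp: Z_def)
    show "\<forall>i\<in>{..<d}. c i = 0"
    proof
      fix l assume "l \<in> {..<d}"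
      have "(\<Sum>i<d. row_scale (c i) (unit_row i)) l = (\<Sum>i<d. if i = l then [:c i:] else 0)"
        unfolding sum_fun_apply by (intro sum.cong) (auto simp: unit_row_def)
      also have "\<dots> = [:c l:]"
        using \<open>l \<in> {..<d}\<close> by simp
      finally have "poly_tau (y l) = [:c l:]"
        using fun_cong[OF y, of l] by simp
      then show "c l = 0"
        using coeff_poly_tau[of "y l" 0] by simp
    qed
  qed simp
  ultimately have "card E = d"
    by simp
  then obtain e where e: "bij_betw e {..<d} E"
    using ex_bij_betw_nat_finite[OF finE] by (auto simp: atLeast0LessThan)
  have reindex: "(\<Sum>k<d. row_scale (c (e k)) (e k)) = (\<Sum>x\<in>E. row_scale (c x) x)" for c
    using sum.reindex_bij_betw[OF e, of "\<lambda>x. row_scale (c x) x"] .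
  show thesis
  proof (rule that[of e])
    show "e k \<in> F (Suc m)" if "k < d" for k
      using that e E(1) by (auto simp: bij_betw_def)
    show "\<forall>k<d. c k = 0" if "(\<Sum>k<d. row_scale (c k) (e k)) = 0" for c
    proof -
      define c' where "c' x = c (inv_into {..<d} e x)" for x
      have c': "c' (e k) = c k" if "k < d" for k
        using that e by (simp add: c'_def bij_betw_def inv_into_f_f)
      have "(\<Sum>k<d. row_scale (c' (e k)) (e k)) = 0"
        using that c' by simp
      then have "\<forall>x\<in>E. c' x = 0"
        unfolding reindex using rows.independentD[OF E(2) finE] by blast
      then show ?thesis
        using c' e by (auto simp: bij_betw_def)
    qed
    show "\<exists>c. x = (\<Sum>k<d. row_scale (c k) (e k))" if x: "x \<in> F (Suc m)" for x
    proof -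
      obtain c where "x = (\<Sum>x\<in>E. row_scale (c x) x)"
        using x E(3) rows.span_finite[OF finE] by blast
      then show ?thesis
        unfolding reindex[symmetric] by (intro exI[of _ "\<lambda>k. c (e k)"])
    qed
  qed
qed

text \<open>
  The part of degree \<open>n\<close> of the combination is \<open>\<tau>\<^sup>n\<close> applied to a linear combination of the \<open>e\<^sub>k\<close> whose
  coefficients are the roots of order \<open>q\<^sup>n\<close> of the top coefficients. If the whole lies in \<open>F\<^sub>m\<^sub>+\<^sub>n\<close>, so does
  this part, and the linear combination lies in \<open>F\<^sub>m = 0\<close>.
\<close>

lemma leading_term:
  assumes e: "\<And>k. k < d \<Longrightarrow> e k \<in> F (Suc m)"
    and indep: "\<And>c. (\<Sum>k<d. row_scale (c k) (e k)) = 0 \<Longrightarrow> \<forall>k<d. c k = 0"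
    and x: "x \<in> degree_less d (Suc n)" and xF: "(\<Sum>k<d. rows.skew_act (x k) (e k)) \<in> F (m + n)"
  shows "x \<in> degree_less d n"
proof -
  define top where "top k = Polynomial.monom (poly.coeff (x k) n) n" for k
  have low: "poly.coeff (x k - top k) j = 0" if "j \<ge> n" for j k
    using that x by (cases "j = n") (auto simp: top_def degree_less_def)
  have eM: "e k \<in> row_space d" if "k < d" for k
    using e[OF that] F_M by blast
  have "(\<Sum>k<d. rows.skew_act (x k - top k) (e k)) \<in> F (m + n)"
    using skew_act_in_filtration[OF tau_filtration_axioms low e F_m]
    by (intro rows.subspace_sum[OF subspace_F]) auto
  then have "(\<Sum>k<d. rows.skew_act (x k) (e k)) - (\<Sum>k<d. rows.skew_act (x k - top k) (e k)) \<in> F (m + n)"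
    using xF rows.subspace_diff[OF subspace_F] by blast
  then have topF: "(\<Sum>k<d. rows.skew_act (top k) (e k)) \<in> F (m + n)"
    by (simp add: rows.skew_act_diff sum_subtractf)
  have "\<forall>k. \<exists>c. c ^ (q ^ n) = poly.coeff (x k) n"
    using poly.frobenius_pow_root by blast
  from choice[OF this] obtain c where c: "\<And>k. c k ^ (q ^ n) = poly.coeff (x k) n"
    by blast
  have "(\<Sum>k<d. rows.skew_act (top k) (e k)) = (row_tau ^^ n) (\<Sum>k<d. row_scale (c k) (e k))"
    by (simp add: top_def rows.skew_act_monom rows.tau_pow_sum rows.tau_pow_scale c)
  moreover have "(\<Sum>k<d. row_scale (c k) (e k)) \<in> row_space d"
    using eM by (intro rows.subspace_sum[OF subspace_row_space] rows.subspace_scale[OF subspace_row_space]) auto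
  ultimately have "(\<Sum>k<d. row_scale (c k) (e k)) \<in> F m"
    using topF tau_pow_F[of "\<Sum>k<d. row_scale (c k) (e k)" n m] by simp
  then have "\<forall>k<d. c k = 0"
    using indep F_m by blast
  then have "poly.coeff (x k) n = 0" if "k < d" for k
    using c[of k] that by simp
  then have "poly.coeff (x k) n = 0" for k
    using x by (cases "k < d") (auto simp: degree_less_def row_space_def)
  then show ?thesis
    by (rule degree_less_SucD[OF x])
qed

text \<open>
  The rows of \<open>U\<close> are a basis of \<open>F\<^sub>m\<^sub>+\<^sub>1\<close>. Multiplication by \<open>U\<close> identifies the rows of degree less than \<open>n\<close>
  with \<open>F\<^sub>m\<^sub>+\<^sub>n\<close>, so the filtration turns into the one by degree, and \<open>P = U A U\<^sup>-\<^sup>1\<close> raises degrees by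
  exactly \<open>b\<close>. A row in the kernel of the leading coefficient of \<open>P\<close> would be raised by less than \<open>b\<close>.
\<close>

theorem leading_coeff_invertible_after_base_change:
  obtains U U' C where "U \<in> carrier_mat d d" "U' \<in> carrier_mat d d" "C \<in> carrier_mat d d"
    "skew_mat_mult Fq U U' = 1\<^sub>m d" "skew_mat_mult Fq U' U = 1\<^sub>m d"
    "\<And>j. j > b \<Longrightarrow> tau_coeff j (skew_mat_mult Fq (skew_mat_mult Fq U A) U') = 0\<^sub>m d d"
    "tau_coeff b (skew_mat_mult Fq (skew_mat_mult Fq U A) U') * C = 1\<^sub>m d"
    "C * tau_coeff b (skew_mat_mult Fq (skew_mat_mult Fq U A) U') = 1\<^sub>m d"
proof -
  obtain e where e: "\<And>k. k < d \<Longrightarrow> e k \<in> F (Suc m)"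
    and indep: "\<And>c. (\<Sum>k<d. row_scale (c k) (e k)) = 0 \<Longrightarrow> \<forall>k<d. c k = 0"
    and spn: "\<And>x. x \<in> F (Suc m) \<Longrightarrow> \<exists>c. x = (\<Sum>k<d. row_scale (c k) (e k))"
    using basis_exists by blast
  have eM: "e k \<in> row_space d" if "k < d" for k
    using e[OF that] F_M by blast
  define U where "U = mat d d (\<lambda>(k, l). e k l)"
  have U: "U \<in> carrier_mat d d"
    by (simp add: U_def)
  have U_row: "mat_row U k = e k" if "k < d" for k
    using eM[OF that] that by (auto simp: U_def mat_row_def fun_eq_iff row_space_def)
  have mulU: "row_mul x U = (\<Sum>k<d. rows.skew_act (x k) (e k))" for x
    using U_row U by (simp add: row_mul_eq)
  have mulU_F: "row_mul x U \<in> F (m + n)" if "x \<in> degree_less d n" for x n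
    unfolding mulU using that
    by (intro rows.subspace_sum[OF subspace_F] skew_act_in_filtration[OF tau_filtration_axioms _ e F_m])
      (auto simp: degree_less_def)
  have F_mulU: "x \<in> degree_less d n" if x: "x \<in> row_space d" "row_mul x U \<in> F (m + n)" for x n
  proof -
    obtain N where N: "x \<in> degree_less d N"
      using row_degree_bound[OF x(1)] by blast
    have "x \<in> degree_less d (n + i) \<Longrightarrow> x \<in> degree_less d n" for i
    proof (induction i)
      case (Suc i)
      have "row_mul x U \<in> F (m + (n + i))"
        using x(2) F_mono[of "m + n" "m + (n + i)"] by auto
      have "x \<in> degree_less d (n + i)"
      proof (rule leading_term[where e = e])
        show "(\<Sum>k<d. rows.skew_act (x k) (e k)) \<in> F (m + (n + i))"
          using \<open>row_mul x U \<in> F (m + (n + i))\<close> unfolding mulU .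
        show "\<forall>k<d. c k = 0" if "(\<Sum>k<d. row_scale (c k) (e k)) = 0" for c
          by (rule indep[OF that])
      qed (use e Suc.prems in auto)
      then show ?case
        by (rule Suc.IH)
    qed simp
    moreover have "x \<in> degree_less d (n + N)"
      using N by (auto simp: degree_less_def)
    ultimately show ?thesis
      by blast
  qed
  have inj: "x = 0" if "x \<in> row_space d" "row_mul x U = 0" for x
  proof -
    have "x \<in> degree_less d 0"
      using F_mulU[of x 0] that F_m by simp
    then show ?thesis
      by (rule degree_less_0)
  qed
  have surj_F: "\<exists>x\<in>row_space d. row_mul x U = y" if "y \<in> F (m + n)" for y n
    using that
  proof (induction n arbitrary: y)
    case 0
    then have "y = 0"
      using F_m by auto
    then have "row_mul 0 U = y"
      by simp
    then show ?case
      using rows.subspace_0[OF subspace_row_space, of d] by blast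
  next
    case (Suc n)
    show ?case
    proof (cases n)
      case 0
      then have "y \<in> F (Suc m)"
        using Suc.prems by simp
      then obtain c where c: "y = (\<Sum>k<d. row_scale (c k) (e k))"
        using spn by blast
      define x where "x = (\<lambda>k. if k < d then Polynomial.monom (c k) 0 else 0)"
      have "row_mul x U = y"
        unfolding mulU c by (intro sum.cong) (auto simp: x_def rows.skew_act_monom)
      moreover have "x \<in> row_space d"
        by (simp add: x_def row_space_def)
      ultimately show ?thesis
        by blast
    next
      case (Suc n')
      then have "Suc m \<le> m + n" "y \<in> F (Suc (m + n))"
        using Suc.prems by simp_all
      then obtain z where z: "z \<in> F (m + n)" "y - row_tau z \<in> F (m + n)"
        using stable unfolding rows.stable_from_def by blast
      obtain x where x: "x \<in> row_space d" "row_mul x U = z"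
        using Suc.IH[OF z(1)] by blast
      obtain x' where x': "x' \<in> row_space d" "row_mul x' U = y - row_tau z"
        using Suc.IH[OF z(2)] by blast
      have "row_mul (row_tau x + x') U = row_tau z + (y - row_tau z)"
        unfolding row_mul_add row_mul_tau x(2) x'(2) ..
      then have "row_mul (row_tau x + x') U = y"
        by simp
      then show ?thesis
        using rows.subspace_add[OF subspace_row_space row_tau_in[OF x(1)] x'(1)] by blast
    qed
  qed
  have surj: "\<exists>x\<in>row_space d. row_mul x U = y" if y: "y \<in> row_space d" for y
  proof -
    obtain n where "y \<in> F n"
      using y F_Union by blast
    then have "y \<in> F (m + n)"
      using F_mono[of n "m + n"] by auto
    then show ?thesis
      by (rule surj_F)
  qed
  have "\<forall>k. \<exists>x. k < d \<longrightarrow> x \<in> row_space d \<and> row_mul x U = unit_row k"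
    using surj unit_row_in by blast
  from choice[OF this] obtain g where g: "\<And>k. k < d \<Longrightarrow> g k \<in> row_space d"
      "\<And>k. k < d \<Longrightarrow> row_mul (g k) U = unit_row k"
    by blast
  define U' where "U' = mat d d (\<lambda>(k, l). g k l)"
  have U': "U' \<in> carrier_mat d d"
    by (simp add: U'_def)
  have U'_row: "mat_row U' k = g k" if "k < d" for k
    using g(1)[OF that] that by (auto simp: U'_def mat_row_def fun_eq_iff row_space_def)
  have U'U: "skew_mat_mult Fq U' U = 1\<^sub>m d"
    using U U' by (intro mat_eqI_rows[of _ d] skew_mat_mult_carrier)
      (auto simp: mat_row_mult U'_row g mat_row_one)
  have mulU_U': "row_mul (row_mul x U) U' = x" if "x \<in> row_space d" for x
  proof -
    have "row_mul (row_mul (row_mul x U) U') U = row_mul (row_mul x U) (skew_mat_mult Fq U' U)"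
      using U U' by (simp add: row_mul_mult)
    also have "\<dots> = row_mul x U"
      unfolding U'U by (intro row_mul_one row_mul_in carrier_matD(2)[OF U])
    finally have "row_mul (row_mul (row_mul x U) U' - x) U = 0"
      by (simp add: row_mul_diff)
    moreover have "row_mul (row_mul x U) U' - x \<in> row_space d"
      using that row_mul_in[OF carrier_matD(2)[OF U']] rows.subspace_diff[OF subspace_row_space]
      by blast
    ultimately have "row_mul (row_mul x U) U' - x = 0"
      using inj by blast
    then show ?thesis
      by simp
  qed
  have UU': "skew_mat_mult Fq U U' = 1\<^sub>m d"
  proof (rule mat_eqI_rows[of _ d])
    fix k assume k: "k < d"
    have "mat_row (skew_mat_mult Fq U U') k = row_mul (row_mul (unit_row k) U) U'"
      using k U U' by (simp add: mat_row_mult row_mul_unit)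
    then show "mat_row (skew_mat_mult Fq U U') k = mat_row (1\<^sub>m d) k"
      using k by (simp add: mulU_U' unit_row_in mat_row_one)
  qed (use U U' in auto)
  define P where "P = skew_mat_mult Fq (skew_mat_mult Fq U A) U'"
  have P: "P \<in> carrier_mat d d"
    using U U' A by (intro carrier_matI) (simp_all add: P_def)
  have PU: "row_mul (row_mul x P) U = row_mul (row_mul x U) A" for x
  proof -
    have "row_mul (row_mul x P) U = row_mul (row_mul (row_mul (row_mul x U) A) U') U"
      using U U' A by (simp add: P_def row_mul_mult)
    also have "\<dots> = row_mul (row_mul (row_mul x U) A) (skew_mat_mult Fq U' U)"
      using U U' by (simp add: row_mul_mult)
    also have "\<dots> = row_mul (row_mul x U) A"
      unfolding U'U by (intro row_mul_one row_mul_in carrier_matD(2)[OF A])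
    finally show ?thesis .
  qed
  have P_degree: "row_mul x P \<in> degree_less d (n + b) \<longleftrightarrow> x \<in> degree_less d n"
    if "x \<in> row_space d" for x n
  proof -
    have "row_mul x P \<in> degree_less d (n + b) \<longleftrightarrow> row_mul (row_mul x P) U \<in> F (m + (n + b))"
      using F_mulU mulU_F row_mul_in[OF carrier_matD(2)[OF P]] by blast
    also have "\<dots> \<longleftrightarrow> row_mul x U \<in> F (m + n)"
      unfolding PU using T_F[OF row_mul_in[OF carrier_matD(2)[OF U]], of x "m + n"] by (simp add: add.assoc)
    also have "\<dots> \<longleftrightarrow> x \<in> degree_less d n"
      using F_mulU mulU_F that by blast
    finally show ?thesis .
  qed
  have coeff_P: "poly.coeff (P $$ (k, l)) j = 0" if "j > b" "k < d" "l < d" for j k l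
  proof -
    have "unit_row k \<in> degree_less d 1"
      using that(2) unit_row_in[of k d] by (auto simp: degree_less_def unit_row_def)
    then have "mat_row P k \<in> degree_less d (1 + b)"
      using P_degree[of "unit_row k" 1] unit_row_in[OF that(2)] P that(2) by (simp add: row_mul_unit)
    then have "poly.coeff (mat_row P k l) j = 0"
      using that(1) by (simp add: degree_less_def)
    then show ?thesis
      using that P by (simp add: mat_row_def)
  qed
  define B where "B = tau_coeff b P"
  have B: "B \<in> carrier_mat d d"
    using P by (simp add: B_def tau_coeff_def)
  have "det B \<noteq> 0"
  proof
    assume "det B = 0"
    then have "det (transpose_mat B) = 0"
      using det_transpose[OF B] by simp
    then obtain v where v: "v \<in> carrier_vec d" "v \<noteq> 0\<^sub>v d" "transpose_mat B *\<^sub>v v = 0\<^sub>v d"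
      using det_0_iff_vec_prod_zero_field[of "transpose_mat B" d] B by auto
    define x where "x = (\<lambda>k. if k < d then Polynomial.monom (v $ k) 0 else 0)"
    have x: "x \<in> row_space d"
      by (simp add: x_def row_space_def)
    have mulx: "row_mul x P l = (\<Sum>k<d. Polynomial.smult (v $ k) (P $$ (k, l)))" if "l < d" for l
      using that P
      by (auto simp: row_mul_def x_def skew_mult_eq poly.skew_act_monom intro!: sum.cong)
    have "poly.coeff (row_mul x P l) j = 0" if "j \<ge> 0 + b" for j l
    proof (cases "l < d")
      case True
      have "poly.coeff (row_mul x P l) j = (\<Sum>k<d. v $ k * poly.coeff (P $$ (k, l)) j)"
        using mulx[OF True] by (simp add: coeff_sum)
      also have "\<dots> = 0"
      proof (cases "j = b")
        case True
        have "0 = (transpose_mat B *\<^sub>v v) $ l"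
          using v(3) \<open>l < d\<close> by simp
        also have "\<dots> = (\<Sum>k<d. B $$ (k, l) * v $ k)"
          using B v(1) \<open>l < d\<close> by (auto simp: scalar_prod_def atLeast0LessThan intro!: sum.cong)
        also have "\<dots> = (\<Sum>k<d. v $ k * poly.coeff (P $$ (k, l)) j)"
          using P \<open>l < d\<close> True by (intro sum.cong) (auto simp: B_def tau_coeff_def)
        finally show ?thesis
          by simp
      next
        case False
        then show ?thesis
          using coeff_P that \<open>l < d\<close> by (intro sum.neutral) auto
      qed
      finally show ?thesis .
    next
      case False
      then show ?thesis
        using P by (simp add: row_mul_def)
    qed
    then have "row_mul x P \<in> degree_less d (0 + b)"
      using row_mul_in[of P d] P by (auto simp: degree_less_def)
    then have "x \<in> degree_less d 0"
      using P_degree[OF x] by blast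
    then have "poly.coeff (x k) 0 = 0" for k
      by (auto simp: degree_less_def)
    then have "v $ k = 0" if "k < d" for k
      using that by (metis (no_types, lifting) coeff_monom x_def)
    then have "v = 0\<^sub>v d"
      using v(1) by auto
    then show False
      using v(2) by blast
  qed
  then obtain C where C: "C \<in> carrier_mat d d" "B * C = 1\<^sub>m d" "C * B = 1\<^sub>m d"
    using det_non_zero_imp_unit[OF B, of "()"] by (auto simp: Units_def ring_mat_def)
  show thesis
  proof (rule that[OF U U' C(1) UU' U'U])
    fix j assume "b < j"
    then show "tau_coeff j (skew_mat_mult Fq (skew_mat_mult Fq U A) U') = 0\<^sub>m d d"
      using coeff_P P unfolding P_def[symmetric] by (intro eq_matI) (auto simp: tau_coeff_def)
  qed (use C in \<open>auto simp: B_def P_def\<close>)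
qed

end

section \<open>Division by a matrix with invertible leading coefficient\<close>

text \<open>
  A matrix \<open>P\<close> of degree \<open>b\<close> in \<open>\<tau>\<close>, together with an inverse \<open>C\<close> of its leading coefficient.
\<close>

locale leading_invertible = frobenius_field Fq for Fq :: "'a::alg_closed_field set" +
  fixes d b :: nat and P :: "'a poly mat" and C :: "'a mat"
  assumes P: "P \<in> carrier_mat d d" and C: "C \<in> carrier_mat d d"
    and P_degree: "\<And>j. j > b \<Longrightarrow> tau_coeff j P = 0\<^sub>m d d"
    and P_C: "tau_coeff b P * C = 1\<^sub>m d" and C_P: "C * tau_coeff b P = 1\<^sub>m d"
begin

abbreviation B :: "'a mat" where "B \<equiv> tau_coeff b P"

lemma coeff_P:
  assumes "j > b" "k < d" "l < d"
  shows "poly.coeff (P $$ (k, l)) j = 0"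
proof -
  have "tau_coeff j P $$ (k, l) = 0"
    unfolding P_degree[OF assms(1)] using assms by simp
  then show ?thesis
    using P assms by (simp add: tau_coeff_def)
qed

text \<open>
  In the product \<open>z P\<close> the leading coefficient of \<open>P\<close> appears with its entries raised to the power
  \<open>q\<^sup>n\<close>, because it passes \<open>\<tau>\<^sup>n\<close>. The twisted matrix is still invertible, which makes division by \<open>P\<close> on
  the right possible.
\<close>

lemma coeff_row_mul_top:
  assumes z: "z \<in> degree_less d (Suc n)" and l: "l < d"
  shows "poly.coeff (row_mul z P l) (n + b) = (\<Sum>k<d. poly.coeff (z k) n * B $$ (k, l) ^ (q ^ n))"
proof -
  have "poly.coeff (row_mul z P l) (n + b) =
      (\<Sum>k<d. poly.coeff (skew_mult Fq (z k) (P $$ (k, l))) (n + b))"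
    using l P by (simp add: row_mul_def coeff_sum)
  also have "\<dots> = (\<Sum>k<d. poly.coeff (z k) n * B $$ (k, l) ^ (q ^ n))"
  proof (rule sum.cong[OF refl])
    fix k assume k: "k \<in> {..<d}"
    have "poly.coeff (skew_mult Fq (z k) (P $$ (k, l))) (n + b) =
        (\<Sum>i\<in>{n}. poly.coeff (z k) i * poly.coeff (P $$ (k, l)) (n + b - i) ^ (q ^ i))"
      unfolding coeff_skew_mult
    proof (rule sum.mono_neutral_right)
      show "\<forall>i\<in>{..n + b} - {n}. poly.coeff (z k) i * poly.coeff (P $$ (k, l)) (n + b - i) ^ (q ^ i) = 0"
      proof
        fix i assume "i \<in> {..n + b} - {n}"
        then consider "i < n" | "Suc n \<le> i"
          by fastforce
        then show "poly.coeff (z k) i * poly.coeff (P $$ (k, l)) (n + b - i) ^ (q ^ i) = 0"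
        proof cases
          case 1
          then show ?thesis
            using coeff_P[of "n + b - i" k l] k l by simp
        next
          case 2
          then show ?thesis
            using z by (simp add: degree_less_def)
        qed
      qed
    qed auto
    then show "poly.coeff (skew_mult Fq (z k) (P $$ (k, l))) (n + b) =
        poly.coeff (z k) n * B $$ (k, l) ^ (q ^ n)"
      using k l P by (simp add: tau_coeff_def)
  qed
  finally show ?thesis .
qed

lemma row_mul_degree:
  assumes z: "z \<in> degree_less d (Suc n)"
  shows "row_mul z P \<in> degree_less d (Suc (n + b))"
proof -
  have "poly.coeff (row_mul z P l) j = 0" if j: "Suc (n + b) \<le> j" for j l
  proof (cases "l < d")
    case True
    have "poly.coeff (z k) i * poly.coeff (P $$ (k, l)) (j - i) ^ (q ^ i) = 0" if "k < d" for k i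
    proof (cases "Suc n \<le> i")
      case True
      then show ?thesis
        using z by (simp add: degree_less_def)
    next
      case False
      then show ?thesis
        using coeff_P[of "j - i" k l] that \<open>l < d\<close> j by simp
    qed
    then have "poly.coeff (skew_mult Fq (z k) (P $$ (k, l))) j = 0" if "k < d" for k
      unfolding coeff_skew_mult using that by (intro sum.neutral) auto
    then show ?thesis
      using True P by (simp add: row_mul_def coeff_sum)
  next
    case False
    then show ?thesis
      using P by (simp add: row_mul_def)
  qed
  then show ?thesis
    using row_mul_in[OF carrier_matD(2)[OF P]] by (simp add: degree_less_def)
qed

lemma frobenius_mat_mult:
  assumes "A \<in> carrier_mat d d" "A' \<in> carrier_mat d d" "A * A' = 1\<^sub>m d" "h < d" "l < d"
  shows "(\<Sum>k<d. A $$ (h, k) ^ (q ^ n) * A' $$ (k, l) ^ (q ^ n)) = (if h = l then 1 else 0 :: 'a)"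
proof -
  have "(\<Sum>k<d. A $$ (h, k) * A' $$ (k, l)) = (A * A') $$ (h, l)"
    using assms(1,2,4,5) by (simp add: scalar_prod_def atLeast0LessThan)
  also have "\<dots> = (if h = l then 1 else 0)"
    unfolding assms(3) using assms(4,5) by simp
  finally have "(\<Sum>k<d. A $$ (h, k) * A' $$ (k, l)) ^ (q ^ n) = (if h = l then 1 else 0)"
    by simp
  moreover have "(sum f {..<m :: nat} :: 'a) ^ (q ^ n) = (\<Sum>k<m. f k ^ (q ^ n))" for f m
    by (induction m) (auto simp: poly.frobenius_pow_add)
  ultimately show ?thesis
    by (simp add: power_mult_distrib)
qed

lemma B_carrier: "B \<in> carrier_mat d d"
  using P by (simp add: tau_coeff_def)

lemma division:
  assumes "x \<in> row_space d"
  shows "\<exists>z\<in>row_space d. x - row_mul z P \<in> degree_less d b"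
proof -
  have "\<exists>z\<in>row_space d. x - row_mul z P \<in> degree_less d b" if "x \<in> degree_less d n" for x n
    using that
  proof (induction n arbitrary: x)
    case 0
    then have "x - row_mul 0 P \<in> degree_less d b"
      using degree_less_mono[of 0 b d] by auto
    then show ?case
      using rows.subspace_0[OF subspace_row_space] by blast
  next
    case (Suc n)
    show ?case
    proof (cases "Suc n \<le> b")
      case True
      then have "x - row_mul 0 P \<in> degree_less d b"
        using degree_less_mono[of "Suc n" b d] Suc.prems by auto
      then show ?thesis
        using rows.subspace_0[OF subspace_row_space] by blast
    next
      case False
      define i where "i = n - b"
      then have n: "n = i + b"
        using False by simp
      \<comment> \<open>The row \<open>w\<close> solves the equation that the top coefficient of \<open>w \<tau>\<^sup>i P\<close> is that of \<open>x\<close>.\<close>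
      define w where "w k = (\<Sum>h<d. poly.coeff (x h) n * C $$ (h, k) ^ (q ^ i))" for k
      define y where "y = (\<lambda>k. if k < d then Polynomial.monom (w k) i else 0)"
      have y: "y \<in> degree_less d (Suc i)"
        by (auto simp: y_def degree_less_def row_space_def)
      have top: "poly.coeff (row_mul y P l) n = poly.coeff (x l) n" for l
      proof (cases "l < d")
        case True
        have "poly.coeff (row_mul y P l) n = (\<Sum>k<d. w k * B $$ (k, l) ^ (q ^ i))"
          unfolding n coeff_row_mul_top[OF y True] by (intro sum.cong) (auto simp: y_def)
        also have "\<dots> = (\<Sum>h<d. \<Sum>k<d. poly.coeff (x h) n * (C $$ (h, k) ^ (q ^ i) * B $$ (k, l) ^ (q ^ i)))"
          unfolding w_def sum_distrib_right by (subst sum.swap) (simp only: mult.assoc)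
        also have "\<dots> = (\<Sum>h<d. poly.coeff (x h) n * (if h = l then 1 else 0))"
          unfolding sum_distrib_left[symmetric]
          using frobenius_mat_mult[OF C B_carrier C_P _ True, of _ i] by (intro sum.cong) auto
        also have "\<dots> = poly.coeff (x l) n"
          using True by (simp add: if_distrib cong: if_cong)
        finally show ?thesis .
      next
        case False
        then show ?thesis
          using P Suc.prems by (simp add: row_mul_def degree_less_def row_space_def)
      qed
      have "x - row_mul y P \<in> degree_less d (Suc n)"
        using rows.subspace_diff[OF subspace_degree_less Suc.prems] row_mul_degree[OF y] n by simp
      then have "x - row_mul y P \<in> degree_less d n"
        by (rule degree_less_SucD) (simp add: top)
      then obtain z where z: "z \<in> row_space d" "x - row_mul y P - row_mul z P \<in> degree_less d b"
        using Suc.IH by blast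
      have "x - row_mul (y + z) P \<in> degree_less d b"
        using z(2) by (simp add: row_mul_add diff_diff_eq)
      then show ?thesis
        using rows.subspace_add[OF subspace_row_space degree_less_row_space[OF y] z(1)] by blast
    qed
  qed
  then show ?thesis
    using row_degree_bound[OF assms] by metis
qed

lemma remainder_unique:
  assumes z: "z \<in> row_space d" "row_mul z P \<in> degree_less d b"
  shows "z = 0"
proof -
  have step: "z \<in> degree_less d n" if zn: "z \<in> degree_less d (Suc n)" for n
  proof -
    have 0: "(\<Sum>k<d. poly.coeff (z k) n * B $$ (k, l) ^ (q ^ n)) = 0" if "l < d" for l
      using coeff_row_mul_top[OF zn that] z(2) by (simp add: degree_less_def)
    have "poly.coeff (z h) n = 0" if h: "h < d" for h
    proof -
      have "0 = (\<Sum>l<d. (\<Sum>k<d. poly.coeff (z k) n * B $$ (k, l) ^ (q ^ n)) * C $$ (l, h) ^ (q ^ n))"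
        using 0 by simp
      also have "\<dots> = (\<Sum>k<d. \<Sum>l<d. poly.coeff (z k) n * (B $$ (k, l) ^ (q ^ n) * C $$ (l, h) ^ (q ^ n)))"
        unfolding sum_distrib_right by (subst sum.swap) (simp only: mult.assoc)
      also have "\<dots> = (\<Sum>k<d. poly.coeff (z k) n * (if k = h then 1 else 0))"
        unfolding sum_distrib_left[symmetric]
        using frobenius_mat_mult[OF B_carrier C P_C _ h, of _ n] by (intro sum.cong) auto
      also have "\<dots> = poly.coeff (z h) n"
        using h by (simp add: if_distrib cong: if_cong)
      finally show ?thesis
        by simp
    qed
    then have "poly.coeff (z h) n = 0" for h
      using z(1) by (cases "h < d") (auto simp: row_space_def)
    then show ?thesis
      by (rule degree_less_SucD[OF zn])
  qed
  have "z \<in> degree_less d n \<Longrightarrow> z \<in> degree_less d 0" for n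
    by (induction n) (auto dest: step)
  then show ?thesis
    using row_degree_bound[OF z(1)] degree_less_0 by metis
qed

end

section \<open>The rank\<close>

context frobenius_field
begin

definition t_act :: "'a poly mat \<Rightarrow> 'a poly \<Rightarrow> (nat \<Rightarrow> 'a poly) \<Rightarrow> nat \<Rightarrow> 'a poly"
  where "t_act A f x = rows.lincomb f (\<lambda>i. ((\<lambda>y. row_mul y A) ^^ i) x)"

text \<open>
  The rows \<open>g 0, ..., g (r - 1)\<close> form a basis of the row space over the polynomial ring of the
  algebraically closed field, where \<open>t\<close> acts as right multiplication by \<open>A\<close>.
\<close>

definition t_basis :: "nat \<Rightarrow> 'a poly mat \<Rightarrow> nat \<Rightarrow> (nat \<Rightarrow> nat \<Rightarrow> 'a poly) \<Rightarrow> bool"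
  where "t_basis d A r g \<longleftrightarrow> (\<forall>l<r. g l \<in> row_space d) \<and>
    (\<forall>x\<in>row_space d. \<exists>f. x = (\<Sum>l<r. t_act A (f l) (g l))) \<and>
    (\<forall>f. (\<Sum>l<r. t_act A (f l) (g l)) = 0 \<longrightarrow> (\<forall>l<r. f l = 0))"

lemma row_mul_pow_add:
  "((\<lambda>y. row_mul y A) ^^ i) (x + y) = ((\<lambda>y. row_mul y A) ^^ i) x + ((\<lambda>y. row_mul y A) ^^ i) y"
  by (induction i arbitrary: x y) (simp_all add: row_mul_add funpow_swap1 del: funpow.simps(2) add: funpow_Suc_right)

lemma row_mul_pow_scale:
  "((\<lambda>y. row_mul y A) ^^ i) (row_scale c x) = row_scale c (((\<lambda>y. row_mul y A) ^^ i) x)"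
  by (induction i arbitrary: x) (simp_all add: row_mul_scale funpow_swap1 del: funpow.simps(2) add: funpow_Suc_right)

lemma row_mul_pow_in:
  "dim_col A = d \<Longrightarrow> x \<in> row_space d \<Longrightarrow> ((\<lambda>y. row_mul y A) ^^ i) x \<in> row_space d"
  by (cases i) (simp_all add: row_mul_in)

lemma t_act_monom: "t_act A (Polynomial.monom c n) x = row_scale c (((\<lambda>y. row_mul y A) ^^ n) x)"
  by (simp add: t_act_def rows.lincomb_monom)

lemma t_act_add: "t_act A (f + g) x = t_act A f x + t_act A g x"
  by (simp add: t_act_def rows.lincomb_add)

lemma t_act_diff: "t_act A (f - g) x = t_act A f x - t_act A g x"
  by (simp add: t_act_def rows.lincomb_diff)

lemma t_act_sum: "t_act A (sum f S) x = (\<Sum>s\<in>S. t_act A (f s) x)"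
  by (simp add: t_act_def rows.lincomb_sum)

lemma t_act_0 [simp]: "t_act A 0 x = 0"
  by (simp add: t_act_def)

lemma t_act_monom_mult:
  "t_act A (Polynomial.monom 1 n * f) x = ((\<lambda>y. row_mul y A) ^^ n) (t_act A f x)"
proof (induction f rule: poly_induct_monom)
  case (monom c m)
  show ?case
    by (simp only: mult_monom t_act_monom row_mul_pow_scale funpow_add comp_apply mult_1)
next
  case (add f g)
  show ?case
    by (simp only: distrib_left t_act_add row_mul_pow_add add)
qed

text \<open>
  Let \<open>Z\<close> be \<open>t\<^sup>a M\<close>. The elements \<open>t\<^sup>j g\<^sub>l\<close> with \<open>j < a\<close> form a basis of \<open>M\<close> modulo \<open>Z\<close>, because the \<open>g\<^sub>l\<close>
  form a basis over the polynomial ring. The elements \<open>\<tau>\<^sup>j u\<^sub>k\<close> with \<open>j < b\<close>, where the \<open>u\<^sub>k\<close> are the rows of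
  \<open>U\<close>, form another one, by division with remainder by \<open>P\<close>, which is \<open>t\<^sup>a\<close> in the coordinates of \<open>U\<close>.
\<close>

lemma rank_times_eq_dimension_times:
  assumes basis: "t_basis d A r g" and A: "A \<in> carrier_mat d d" and Aa: "\<And>x. x \<in> row_space d \<Longrightarrow> row_mul x Aa = ((\<lambda>y. row_mul y A) ^^ a) x"
    and Aa_carrier: "Aa \<in> carrier_mat d d"
    and P: "leading_invertible Fq d b P C"
    and U: "U \<in> carrier_mat d d" "U' \<in> carrier_mat d d"
      "skew_mat_mult Fq U U' = 1\<^sub>m d" "skew_mat_mult Fq U' U = 1\<^sub>m d"
    and PU: "skew_mat_mult Fq P U = skew_mat_mult Fq U Aa"
  shows "r * a = d * b"
proof -
  interpret P: leading_invertible Fq d b P C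
    by fact
  have Pc: "P \<in> carrier_mat d d"
    by (rule P.P)
  define Z where "Z = (\<lambda>x. row_mul x Aa) ` row_space d"
  have Z: "rows.subspace Z"
  proof (rule rows.subspaceI)
    show "0 \<in> Z"
      unfolding Z_def using rows.subspace_0[OF subspace_row_space, of d]
      by (intro image_eqI[of _ _ 0]) (auto simp only: row_mul_0)
    show "x + y \<in> Z" if "x \<in> Z" "y \<in> Z" for x y
      using that rows.subspace_add[OF subspace_row_space] unfolding Z_def
      by (auto simp only: row_mul_add[symmetric] intro!: imageI)
    show "row_scale c x \<in> Z" if "x \<in> Z" for c x
      using that rows.subspace_scale[OF subspace_row_space] unfolding Z_def
      by (auto simp only: row_mul_scale[symmetric] intro!: imageI)
  qed
  have g: "g l \<in> row_space d" if "l < r" for l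
    using basis that by (simp add: t_basis_def)
  have U_U': "row_mul (row_mul x U) U' = x" if "x \<in> row_space d" for x
    using row_mul_mult[of U' U x] U row_mul_one[OF that] by simp
  have U'_U: "row_mul (row_mul x U') U = x" if "x \<in> row_space d" for x
    using row_mul_mult[of U U' x] U row_mul_one[OF that] by simp
  have PU_row: "row_mul (row_mul x P) U = row_mul (row_mul x U) Aa" for x
    using row_mul_mult[of U P x] row_mul_mult[of Aa U x] U Pc Aa_carrier PU by simp
  have in_U: "row_mul x U \<in> row_space d" "row_mul x U' \<in> row_space d" "row_mul x P \<in> row_space d" for x
    using row_mul_in U Pc by auto
  define h1 where "h1 = (\<lambda>(l, j). ((\<lambda>y. row_mul y A) ^^ j) (g l))"
  define h2 where "h2 = (\<lambda>(k, j). row_mul ((row_tau ^^ j) (unit_row k)) U)"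
  define I where "I = {..<r} \<times> {..<a}"
  define J where "J = {..<d} \<times> {..<b}"
  have sum_h1: "(\<Sum>i\<in>I. row_scale (c i) (h1 i)) =
      (\<Sum>l<r. t_act A (\<Sum>j<a. Polynomial.monom (c (l, j)) j) (g l))" for c
    unfolding I_def sum.cartesian_product' t_act_sum by (simp add: h1_def t_act_monom)
  have sum_h2: "(\<Sum>i\<in>J. row_scale (c i) (h2 i)) =
      row_mul (\<lambda>k. if k < d then \<Sum>j<b. Polynomial.monom (c (k, j)) j else 0) U" for c
  proof -
    have "(\<lambda>k. if k < d then \<Sum>j<b. Polynomial.monom (c (k, j)) j else 0) =
        (\<Sum>k<d. \<Sum>j<b. row_scale (c (k, j)) ((row_tau ^^ j) (unit_row k)))" (is "?L = ?R")
    proof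
      fix l
      have "row_scale (c (k, j)) ((row_tau ^^ j) (unit_row k)) l =
          (if k = l then Polynomial.monom (c (k, j)) j else 0)" for k j
        by (auto simp: tau_unit_row_apply smult_monom)
      then have "?R l = (\<Sum>k<d. if k = l then \<Sum>j<b. Polynomial.monom (c (k, j)) j else 0)"
        unfolding sum_fun_apply by (intro sum.cong) auto
      then show "?L l = ?R l"
        by simp
    qed
    then show ?thesis
      unfolding J_def sum.cartesian_product'
      by (simp add: h2_def row_mul_sum row_mul_scale)
  qed
  have span1: "\<exists>c. x - (\<Sum>i\<in>I. row_scale (c i) (h1 i)) \<in> Z" if x: "x \<in> row_space d" for x
  proof -
    obtain f where f: "x = (\<Sum>l<r. t_act A (f l) (g l))"
      using basis x unfolding t_basis_def by blast
    define c where "c = (\<lambda>(l, j). poly.coeff (f l) j)"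
    have split: "f l = (\<Sum>j<a. Polynomial.monom (c (l, j)) j) + Polynomial.monom 1 a * poly_shift a (f l)" for l
    proof (rule poly_eqI)
      fix n
      have "(\<Sum>j<a. poly.coeff (Polynomial.monom (c (l, j)) j) n) =
          (\<Sum>j<a. if j = n then poly.coeff (f l) n else 0)"
        by (intro sum.cong) (auto simp: c_def)
      then show "poly.coeff (f l) n = poly.coeff ((\<Sum>j<a. Polynomial.monom (c (l, j)) j) +
          Polynomial.monom 1 a * poly_shift a (f l)) n"
        by (simp add: coeff_sum coeff_monom_mult coeff_poly_shift)
    qed
    have tg: "t_act A (poly_shift a (f l)) (g l) \<in> row_space d" if "l < r" for l
    proof -
      have "((\<lambda>y. row_mul y A) ^^ i) (g l) \<in> row_space d" for i
        using that A g by (intro row_mul_pow_in) auto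
      then show ?thesis
        unfolding t_act_def by (rule rows.lincomb_in_subspace[OF subspace_row_space])
    qed
    have "x - (\<Sum>i\<in>I. row_scale (c i) (h1 i)) =
        (\<Sum>l<r. t_act A (f l) (g l) - t_act A (\<Sum>j<a. Polynomial.monom (c (l, j)) j) (g l))"
      unfolding sum_h1 f by (simp only: sum_subtractf)
    also have "\<dots> = (\<Sum>l<r. row_mul (t_act A (poly_shift a (f l)) (g l)) Aa)"
    proof (rule sum.cong[OF refl])
      fix l assume "l \<in> {..<r}"
      then show "t_act A (f l) (g l) - t_act A (\<Sum>j<a. Polynomial.monom (c (l, j)) j) (g l) =
          row_mul (t_act A (poly_shift a (f l)) (g l)) Aa"
        using arg_cong[OF split[of l], of "\<lambda>f. t_act A f (g l)"]
        by (simp only: t_act_add t_act_monom_mult Aa[OF tg] lessThan_iff) (simp only: add_diff_cancel_left')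
    qed
    also have "\<dots> = row_mul (\<Sum>l<r. t_act A (poly_shift a (f l)) (g l)) Aa"
      by (simp only: row_mul_sum)
    also have "\<dots> \<in> Z"
      unfolding Z_def using tg by (intro imageI rows.subspace_sum[OF subspace_row_space]) auto
    finally show ?thesis
      by (intro exI[of _ c])
  qed
  have indep1: "\<forall>i\<in>I. c i = 0" if prem: "(\<Sum>i\<in>I. row_scale (c i) (h1 i)) \<in> Z" for c
  proof -
    obtain y where y: "y \<in> row_space d" "(\<Sum>i\<in>I. row_scale (c i) (h1 i)) = row_mul y Aa"
      using prem by (auto simp: Z_def)
    obtain f where f: "y = (\<Sum>l<r. t_act A (f l) (g l))"
      using basis y(1) unfolding t_basis_def by blast
    have "row_mul y Aa = ((\<lambda>y. row_mul y A) ^^ a) y"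
      by (rule Aa[OF y(1)])
    also have "\<dots> = (\<Sum>l<r. t_act A (Polynomial.monom 1 a * f l) (g l))"
      unfolding f t_act_monom_mult
      using sum_comp_morphism[of "(\<lambda>y. row_mul y A) ^^ a" "\<lambda>l. t_act A (f l) (g l)" "{..<r}"]
        row_mul_pow_scale[of a A 0 0]
      by (simp add: row_mul_pow_add comp_def)
    finally have "(\<Sum>l<r. t_act A ((\<Sum>j<a. Polynomial.monom (c (l, j)) j) - Polynomial.monom 1 a * f l) (g l)) = 0"
      using y(2) unfolding sum_h1 by (simp add: t_act_diff sum_subtractf)
    then have eq: "(\<Sum>j<a. Polynomial.monom (c (l, j)) j) = Polynomial.monom 1 a * f l" if "l < r" for l
      using basis that unfolding t_basis_def by fastforce
    have "c (l, j) = 0" if "l < r" "j < a" for l j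
    proof -
      have "c (l, j) = poly.coeff (\<Sum>j<a. Polynomial.monom (c (l, j)) j) j"
        using that by (simp add: coeff_sum)
      also have "\<dots> = 0"
        unfolding eq[OF that(1)] using that(2) by (simp add: coeff_monom_mult)
      finally show ?thesis .
    qed
    then show ?thesis
      by (auto simp: I_def)
  qed
  have span2: "\<exists>c. x - (\<Sum>i\<in>J. row_scale (c i) (h2 i)) \<in> Z" if x: "x \<in> row_space d" for x
  proof -
    obtain z where z: "z \<in> row_space d" "row_mul x U' - row_mul z P \<in> degree_less d b"
      using P.division[OF in_U(2)] by blast
    define y where "y = row_mul x U' - row_mul z P"
    have y: "y \<in> degree_less d b"
      using z(2) by (simp add: y_def)
    define c where "c = (\<lambda>(k, j). poly.coeff (y k) j)"
    have "y = (\<lambda>k. if k < d then \<Sum>j<b. Polynomial.monom (c (k, j)) j else 0)"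
    proof
      fix k
      show "y k = (if k < d then \<Sum>j<b. Polynomial.monom (c (k, j)) j else 0)"
      proof (cases "k < d")
        case True
        have "poly.coeff (y k) n = (\<Sum>j<b. if j = n then poly.coeff (y k) j else 0)" for n
          using y by (auto simp: degree_less_def)
        then show ?thesis
          using True by (simp add: poly_eq_iff coeff_sum c_def)
      qed (use y in \<open>auto simp: degree_less_def row_space_def\<close>)
    qed
    then have "(\<Sum>i\<in>J. row_scale (c i) (h2 i)) = row_mul y U"
      unfolding sum_h2 by simp
    also have "\<dots> = x - row_mul (row_mul z U) Aa"
      by (simp add: y_def row_mul_diff U'_U[OF x] PU_row)
    finally have "x - (\<Sum>i\<in>J. row_scale (c i) (h2 i)) = row_mul (row_mul z U) Aa"
      by simp
    then show ?thesis
      using in_U(1) unfolding Z_def by blast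
  qed
  have indep2: "\<forall>i\<in>J. c i = 0" if "(\<Sum>i\<in>J. row_scale (c i) (h2 i)) \<in> Z" for c
  proof -
    define y where "y = (\<lambda>k. if k < d then \<Sum>j<b. Polynomial.monom (c (k, j)) j else 0)"
    have coeff_y: "poly.coeff (y k) n = (if k < d \<and> n < b then c (k, n) else 0)" for k n
      by (auto simp: y_def coeff_sum)
    have y: "y \<in> degree_less d b"
      by (auto simp: degree_less_def coeff_y) (simp add: row_space_def y_def)
    have "row_mul y U \<in> Z"
      using that unfolding sum_h2 y_def .
    then obtain z where z: "z \<in> row_space d" "row_mul y U = row_mul z Aa"
      by (auto simp: Z_def)
    have "row_mul y U = row_mul (row_mul (row_mul z U') P) U"
      unfolding PU_row U'_U[OF z(1)] by (rule z(2))
    then have "y = row_mul (row_mul z U') P"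
      using U_U'[OF degree_less_row_space[OF y]] U_U'[OF in_U(3)] by metis
    then have "row_mul z U' = 0"
      using P.remainder_unique[OF in_U(2)] y by metis
    then have "y = 0"
      using \<open>y = row_mul (row_mul z U') P\<close> by simp
    then show ?thesis
      using coeff_y by (auto simp: J_def fun_eq_iff) (metis coeff_0)
  qed
  have h1_in: "h1 i \<in> row_space d" if "i \<in> I" for i
    using that A g by (auto simp: I_def h1_def intro!: row_mul_pow_in)
  have h2_in: "h2 i \<in> row_space d" for i
    using in_U by (cases i) (simp add: h2_def)
  have "card I \<le> card J"
    by (rule rows.card_le_modulo[OF Z _ _ span2[OF h1_in] indep1]) (auto simp: I_def J_def)
  moreover have "card J \<le> card I"
    by (rule rows.card_le_modulo[OF Z _ _ span1[OF h2_in] indep2]) (auto simp: I_def J_def)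
  ultimately show ?thesis
    by (simp add: I_def J_def)
qed

end

section \<open>Coordinates over the polynomial ring\<close>

lemma sum_in_closed:
  fixes f :: "'i \<Rightarrow> 'b::comm_monoid_add"
  assumes "0 \<in> S" and "\<And>x y. x \<in> S \<Longrightarrow> y \<in> S \<Longrightarrow> x + y \<in> S" and "\<And>i. i \<in> I \<Longrightarrow> f i \<in> S"
  shows "sum f I \<in> S"
  using assms(3) by (induction I rule: infinite_finite_induct) (auto intro: assms(1,2))

definition rows_over :: "'a::field set \<Rightarrow> nat \<Rightarrow> (nat \<Rightarrow> 'a poly) set"
  where "rows_over K d = {x \<in> row_space d. \<forall>k. x k \<in> polys_over K}"

lemma polys_over_iff: "f \<in> polys_over K \<longleftrightarrow> (\<forall>i. poly.coeff f i \<in> K)"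
  by (auto simp: polys_over_def)

lemma polys_over_closed:
  assumes K: "subfield K (\<AA> :: 'a::field ring)"
  shows "0 \<in> polys_over K" "1 \<in> polys_over K"
    "\<And>f g. f \<in> polys_over K \<Longrightarrow> g \<in> polys_over K \<Longrightarrow> f + g \<in> polys_over K"
    "\<And>f g. f \<in> polys_over K \<Longrightarrow> g \<in> polys_over K \<Longrightarrow> f * g \<in> polys_over K"
    "\<And>f. f \<in> polys_over K \<Longrightarrow> - f \<in> polys_over K"
    "\<And>f g. f \<in> polys_over K \<Longrightarrow> g \<in> polys_over K \<Longrightarrow> f - g \<in> polys_over K"
    "\<And>c f. c \<in> K \<Longrightarrow> f \<in> polys_over K \<Longrightarrow> Polynomial.smult c f \<in> polys_over K"
    "\<And>c n. c \<in> K \<Longrightarrow> Polynomial.monom c n \<in> polys_over K"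
  using subfield_closed[OF K]
  by (auto simp: polys_over_iff coeff_mult one_pCons coeff_pCons diff_conv_add_uminus
      simp del: add_uminus_conv_diff split: nat.splits intro!: subfield_closed(7)[OF K])

context frobenius_field
begin

definition frob_poly :: "'a poly \<Rightarrow> 'a poly"
  where "frob_poly f = map_poly (\<lambda>c. c ^ q) f"

lemma coeff_frob_poly [simp]: "poly.coeff (frob_poly f) n = poly.coeff f n ^ q"
  by (simp add: frob_poly_def coeff_map_poly)

lemma frob_poly_add: "frob_poly (f + g) = frob_poly f + frob_poly g"
  by (simp add: poly_eq_iff frobenius_add)

lemma frob_poly_monom: "frob_poly (Polynomial.monom c n) = Polynomial.monom (c ^ q) n"
  by (simp add: poly_eq_iff)

lemma row_tau_sum: "row_tau (sum f S) = (\<Sum>s\<in>S. row_tau (f s))"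
  using rows.tau_pow_sum[of 1 f S] by simp

lemma t_act_tau: "row_tau (t_act A f x) = t_act A (frob_poly f) (row_tau x)"
proof (induction f rule: poly_induct_monom)
  case (monom c n)
  have "row_tau (((\<lambda>y. row_mul y A) ^^ n) x) = ((\<lambda>y. row_mul y A) ^^ n) (row_tau x)"
  proof (induction n)
    case (Suc n)
    then show ?case
      by (simp only: funpow.simps comp_apply row_mul_tau[symmetric])
  qed (simp only: funpow.simps id_apply)
  then show ?case
    by (simp only: frob_poly_monom t_act_monom rows.tau_scale)
next
  case (add f g)
  then show ?case
    by (simp only: frob_poly_add t_act_add rows.tau_add)
qed

text \<open>
  The rows \<open>\<tau>\<^sup>j e\<^sub>k\<close> span the row space. They have coefficients 0 and 1, hence lie over every subfield, so
  this is how statements about rows over \<open>K\<close> are extended to the algebraic closure.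
\<close>

lemma row_space_subset:
  assumes "rows.subspace S" and "\<And>k j. k < d \<Longrightarrow> (row_tau ^^ j) (unit_row k) \<in> S"
  shows "row_space d \<subseteq> S"
proof
  fix x :: "nat \<Rightarrow> 'a poly" assume "x \<in> row_space d"
  then have "x = (\<Sum>k<d. rows.skew_act (x k) (unit_row k))"
    by (rule row_decomp)
  also have "\<dots> \<in> S"
    unfolding rows.skew_act_def
    by (intro rows.subspace_sum[OF assms(1)] rows.lincomb_in_subspace[OF assms(1)]) (use assms(2) in auto)
  finally show "x \<in> S" .
qed

end

locale t_matrix = frobenius_field Fq for Fq :: "'a::alg_closed_field set" +
  fixes K :: "'a set" and d :: nat and A :: "'a poly mat"
  assumes K: "subfield K \<AA>" and A: "A \<in> carrier_mat d d"
    and A_K: "\<And>k l. k < d \<Longrightarrow> l < d \<Longrightarrow> A $$ (k, l) \<in> polys_over K"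
begin

lemma rows_over_0: "0 \<in> rows_over K d"
  using polys_over_closed(1)[OF K] by (simp add: rows_over_def row_space_def)

lemma rows_over_add: "x \<in> rows_over K d \<Longrightarrow> y \<in> rows_over K d \<Longrightarrow> x + y \<in> rows_over K d"
  using polys_over_closed(3)[OF K] by (simp add: rows_over_def row_space_def)

lemma rows_over_scale: "c \<in> K \<Longrightarrow> x \<in> rows_over K d \<Longrightarrow> row_scale c x \<in> rows_over K d"
  using polys_over_closed(7)[OF K] by (simp add: rows_over_def row_space_def)

lemma rows_over_tau_unit: "k < d \<Longrightarrow> (row_tau ^^ j) (unit_row k) \<in> rows_over K d"
  using polys_over_closed(1)[OF K] polys_over_closed(8)[OF K, of 1] subfield_closed(2)[OF K]
  by (simp add: rows_over_def row_space_def tau_unit_row_apply)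

lemma rows_over_tau: "x \<in> rows_over K d \<Longrightarrow> row_tau x \<in> rows_over K d"
  using subfield_closed(1)[OF K] subfield_closed(6)[OF K]
  by (auto simp: rows_over_def row_space_def polys_over_iff coeff_poly_tau poly.tau_0)

lemma rows_over_mul:
  assumes "x \<in> rows_over K d"
  shows "row_mul x A \<in> rows_over K d"
proof -
  have "row_mul x A l \<in> polys_over K" for l
  proof (cases "l < d")
    case True
    have "(\<Sum>k<d. skew_mult Fq (x k) (A $$ (k, l))) \<in> polys_over K"
      using assms A_K True
      by (intro sum_in_closed polys_over_closed[OF K] skew_mult_closed[OF K]) (auto simp: rows_over_def)
    then show ?thesis
      using True A by (simp add: row_mul_def)
  next
    case False
    then show ?thesis
      using A polys_over_closed(1)[OF K] by (simp add: row_mul_def)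
  qed
  then show ?thesis
    using row_mul_in[OF carrier_matD(2)[OF A]] by (simp add: rows_over_def)
qed

end

text \<open>
  The module of row vectors over \<open>K\<close> is free over \<open>K[t]\<close> with basis \<open>g\<close>, and \<open>p\<close> are the coordinates in
  this basis.
\<close>

locale t_motive = t_matrix Fq K d A for Fq :: "'a::alg_closed_field set" and K d A +
  fixes r :: nat and g :: "nat \<Rightarrow> nat \<Rightarrow> 'a poly" and p :: "(nat \<Rightarrow> 'a poly) \<Rightarrow> nat \<Rightarrow> 'a poly"
  assumes g: "\<And>l. l < r \<Longrightarrow> g l \<in> rows_over K d"
    and p_K: "\<And>x l. x \<in> rows_over K d \<Longrightarrow> p x l \<in> polys_over K"
    and p_sum: "\<And>x. x \<in> rows_over K d \<Longrightarrow> x = (\<Sum>l<r. t_act A (p x l) (g l))"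
    and p_indep: "\<And>f. (\<And>l. f l \<in> polys_over K) \<Longrightarrow> (\<Sum>l<r. t_act A (f l) (g l)) = 0 \<Longrightarrow> \<forall>l<r. f l = 0"
begin

lemma coordinate_unique:
  assumes x: "x \<in> rows_over K d" and f: "\<And>l. f l \<in> polys_over K" "x = (\<Sum>l<r. t_act A (f l) (g l))"
    and "l < r"
  shows "p x l = f l"
proof -
  have "(\<Sum>l<r. t_act A (p x l - f l) (g l)) = x - x"
    unfolding t_act_diff sum_subtractf p_sum[OF x, symmetric] f(2)[symmetric] ..
  then have "\<forall>l<r. p x l - f l = 0"
    using p_K[OF x] f(1) by (intro p_indep polys_over_closed[OF K]) simp_all
  then show ?thesis
    using assms(4) by simp
qed

lemma p_add: "x \<in> rows_over K d \<Longrightarrow> y \<in> rows_over K d \<Longrightarrow> l < r \<Longrightarrow> p (x + y) l = p x l + p y l"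
proof (rule coordinate_unique)
  assume x: "x \<in> rows_over K d" and y: "y \<in> rows_over K d"
  show "x + y = (\<Sum>l<r. t_act A (p x l + p y l) (g l))"
    unfolding t_act_add sum.distrib p_sum[OF x, symmetric] p_sum[OF y, symmetric] ..
  show "x + y \<in> rows_over K d"
    by (rule rows_over_add[OF x y])
  show "p x l + p y l \<in> polys_over K" for l
    by (intro polys_over_closed(3)[OF K] p_K x y)
qed

lemma p_0: "l < r \<Longrightarrow> p 0 l = 0"
  using p_add[OF rows_over_0 rows_over_0, of l] by (metis add_0 add_cancel_right_left)

lemma p_scale: "c \<in> K \<Longrightarrow> x \<in> rows_over K d \<Longrightarrow> l < r \<Longrightarrow> p (row_scale c x) l = Polynomial.smult c (p x l)"
proof (rule coordinate_unique)
  assume c: "c \<in> K" and x: "x \<in> rows_over K d"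
  have "row_scale c x = row_scale c (\<Sum>l<r. t_act A (p x l) (g l))"
    using p_sum[OF x] by simp
  then show "row_scale c x = (\<Sum>l<r. t_act A (Polynomial.smult c (p x l)) (g l))"
    by (simp only: rows.scale_sum_right t_act_def rows.lincomb_smult)
  show "row_scale c x \<in> rows_over K d"
    by (rule rows_over_scale[OF c x])
  show "Polynomial.smult c (p x l) \<in> polys_over K" for l
    by (intro polys_over_closed(7)[OF K] p_K c x)
qed

lemma p_mul: "x \<in> rows_over K d \<Longrightarrow> l < r \<Longrightarrow> p (row_mul x A) l = Polynomial.monom 1 1 * p x l"
proof (rule coordinate_unique)
  assume x: "x \<in> rows_over K d"
  have "row_mul x A = row_mul (\<Sum>l<r. t_act A (p x l) (g l)) A"
    using p_sum[OF x] by simp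
  then show "row_mul x A = (\<Sum>l<r. t_act A (Polynomial.monom 1 1 * p x l) (g l))"
    by (simp only: row_mul_sum t_act_monom_mult One_nat_def funpow.simps comp_apply id_apply)
qed (use p_K rows_over_mul polys_over_closed(4,8)[OF K] subfield_closed(2)[OF K] in auto)

lemma p_g: "k < r \<Longrightarrow> l < r \<Longrightarrow> p (g k) l = (if l = k then 1 else 0)"
proof (rule coordinate_unique)
  assume "k < r"
  have "t_act A (if l = k then 1 else 0) (g l) = (if l = k then g l else 0)" for l
    using t_act_monom[of A 1 0] by (simp add: monom_0 one_pCons)
  then show "g k = (\<Sum>l<r. t_act A (if l = k then 1 else 0) (g l))"
    using \<open>k < r\<close> by simp
qed (use g polys_over_closed(1,2)[OF K] in auto)

text \<open>
  The linear extension of the coordinates \<open>p\<close> to rows over the algebraic closure. It is linear over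
  the polynomial ring and inverse to \<open>f \<mapsto> \<Sum>\<^sub>l f\<^sub>l g\<^sub>l\<close> (\<open>t_coords_t_act_sum\<close>, \<open>sum_t_coords\<close>). Thus \<open>g\<close> remains
  a basis after extension of scalars.
\<close>

definition t_coords :: "(nat \<Rightarrow> 'a poly) \<Rightarrow> nat \<Rightarrow> 'a poly"
  where "t_coords x l = (\<Sum>k<d. poly.lincomb (x k) (\<lambda>j. p ((row_tau ^^ j) (unit_row k)) l))"

lemma t_coords_add: "t_coords (x + y) l = t_coords x l + t_coords y l"
  by (simp add: t_coords_def poly.lincomb_add sum.distrib)

lemma t_coords_scale: "t_coords (row_scale c x) l = Polynomial.smult c (t_coords x l)"
  by (simp add: t_coords_def poly.lincomb_smult poly.scale_sum_right)

lemma t_coords_0 [simp]: "t_coords 0 l = 0"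
  by (simp add: t_coords_def)

lemma t_coords_sum: "t_coords (sum f S) l = (\<Sum>s\<in>S. t_coords (f s) l)"
  using sum_comp_morphism[of "\<lambda>x. t_coords x l" f S] by (simp add: t_coords_add comp_def)

lemma t_coords_tau_unit: "k < d \<Longrightarrow> t_coords ((row_tau ^^ j) (unit_row k)) l = p ((row_tau ^^ j) (unit_row k)) l"
proof -
  assume k: "k < d"
  have "t_coords ((row_tau ^^ j) (unit_row k)) l =
      (\<Sum>k'<d. if k' = k then p ((row_tau ^^ j) (unit_row k)) l else 0)"
    unfolding t_coords_def by (intro sum.cong) (auto simp: tau_unit_row_apply poly.lincomb_monom)
  then show ?thesis
    using k by simp
qed

lemma t_coords_eq_p:
  assumes "x \<in> rows_over K d" "l < r"
  shows "t_coords x l = p x l"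
proof -
  define S where "S = {x \<in> rows_over K d. t_coords x l = p x l}"
  have S0: "0 \<in> S"
    using rows_over_0 p_0[OF assms(2)] by (simp add: S_def)
  have S_add: "x + y \<in> S" if "x \<in> S" "y \<in> S" for x y
    using that rows_over_add p_add assms(2) by (simp add: S_def t_coords_add)
  have "x = (\<Sum>k<d. \<Sum>j\<le>Polynomial.degree (x k).
      row_scale (poly.coeff (x k) j) ((row_tau ^^ j) (unit_row k)))"
    using row_decomp[of x d] assms(1)
    by (simp add: rows_over_def rows.skew_act_def rows.lincomb_def)
  also have "\<dots> \<in> S"
  proof (intro sum_in_closed S0 S_add)
    fix k j assume k: "k \<in> {..<d}"
    have "poly.coeff (x k) j \<in> K"
      using assms(1) by (simp add: rows_over_def polys_over_iff)
    then show "row_scale (poly.coeff (x k) j) ((row_tau ^^ j) (unit_row k)) \<in> S"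
      using k rows_over_scale rows_over_tau_unit p_scale assms(2) t_coords_tau_unit by (simp add: S_def t_coords_scale)
  qed
  finally show ?thesis
    by (simp add: S_def)
qed

lemma t_coords_mul: "x \<in> row_space d \<Longrightarrow> l < r \<Longrightarrow> t_coords (row_mul x A) l = Polynomial.monom 1 1 * t_coords x l"
proof -
  assume x: "x \<in> row_space d" and l: "l < r"
  have "row_space d \<subseteq> {x. t_coords (row_mul x A) l = Polynomial.monom 1 1 * t_coords x l}"
  proof (rule row_space_subset)
    show "rows.subspace {x. t_coords (row_mul x A) l = Polynomial.monom 1 1 * t_coords x l}"
      by (rule rows.subspaceI) (simp_all add: row_mul_add row_mul_scale t_coords_add t_coords_scale distrib_left)
    show "(row_tau ^^ j) (unit_row k) \<in> {x. t_coords (row_mul x A) l = Polynomial.monom 1 1 * t_coords x l}"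
      if "k < d" for k j
      using t_coords_eq_p[OF rows_over_mul[OF rows_over_tau_unit[OF that]] l] p_mul[OF rows_over_tau_unit[OF that] l]
        t_coords_tau_unit[OF that] by simp
  qed
  then show ?thesis
    using x by blast
qed

lemma t_coords_mul_pow:
  "x \<in> row_space d \<Longrightarrow> l < r \<Longrightarrow>
    t_coords (((\<lambda>y. row_mul y A) ^^ n) x) l = Polynomial.monom 1 n * t_coords x l"
proof (induction n)
  case 0
  show ?case
    by (simp add: monom_0 flip: one_pCons)
next
  case (Suc n)
  have "t_coords (((\<lambda>y. row_mul y A) ^^ Suc n) x) l = Polynomial.monom 1 1 * t_coords (((\<lambda>y. row_mul y A) ^^ n) x) l"
    unfolding funpow.simps comp_apply
    using Suc.prems row_mul_pow_in[OF carrier_matD(2)[OF A]] by (intro t_coords_mul)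
  then show ?case
    using Suc by (simp add: mult.assoc[symmetric] mult_monom)
qed

lemma t_coords_t_act: "x \<in> row_space d \<Longrightarrow> l < r \<Longrightarrow> t_coords (t_act A f x) l = f * t_coords x l"
proof (induction f rule: poly_induct_monom)
  case (monom c n)
  have "t_coords (t_act A (Polynomial.monom c n) x) l = Polynomial.smult c (Polynomial.monom 1 n * t_coords x l)"
    by (simp only: t_act_monom t_coords_scale t_coords_mul_pow[OF monom])
  also have "\<dots> = Polynomial.monom c n * t_coords x l"
    by (simp add: smult_monom flip: mult_smult_left)
  finally show ?case .
next
  case (add f f')
  then show ?case
    by (simp only: t_act_add t_coords_add distrib_right)
qed

lemma g_in: "l < r \<Longrightarrow> g l \<in> row_space d"
  using g by (simp add: rows_over_def)

lemma t_coords_t_act_sum: "l < r \<Longrightarrow> t_coords (\<Sum>k<r. t_act A (f k) (g k)) l = f l"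
proof -
  assume l: "l < r"
  have "t_coords (\<Sum>k<r. t_act A (f k) (g k)) l = (\<Sum>k<r. if k = l then f k else 0)"
    unfolding t_coords_sum
  proof (rule sum.cong[OF refl])
    fix k assume "k \<in> {..<r}"
    then show "t_coords (t_act A (f k) (g k)) l = (if k = l then f k else 0)"
      using l p_g by (auto simp: t_coords_t_act[OF g_in] t_coords_eq_p[OF g])
  qed
  then show ?thesis
    using l by simp
qed

lemma sum_t_coords: "x \<in> row_space d \<Longrightarrow> (\<Sum>l<r. t_act A (t_coords x l) (g l)) = x"
proof -
  assume x: "x \<in> row_space d"
  have "row_space d \<subseteq> {x. (\<Sum>l<r. t_act A (t_coords x l) (g l)) = x}"
  proof (rule row_space_subset)
    show "rows.subspace {x. (\<Sum>l<r. t_act A (t_coords x l) (g l)) = x}"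
    proof (rule rows.subspaceI)
      show "0 \<in> {x. (\<Sum>l<r. t_act A (t_coords x l) (g l)) = x}"
        by simp
      show "x + y \<in> {x. (\<Sum>l<r. t_act A (t_coords x l) (g l)) = x}"
        if "x \<in> {x. (\<Sum>l<r. t_act A (t_coords x l) (g l)) = x}" "y \<in> {x. (\<Sum>l<r. t_act A (t_coords x l) (g l)) = x}" for x y
        using that by (simp add: t_coords_add t_act_add sum.distrib)
      show "row_scale c x \<in> {x. (\<Sum>l<r. t_act A (t_coords x l) (g l)) = x}"
        if "x \<in> {x. (\<Sum>l<r. t_act A (t_coords x l) (g l)) = x}" for c x
      proof -
        have "(\<Sum>l<r. t_act A (t_coords (row_scale c x) l) (g l)) = row_scale c (\<Sum>l<r. t_act A (t_coords x l) (g l))"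
          by (simp only: t_coords_scale t_act_def rows.lincomb_smult rows.scale_sum_right)
        then show ?thesis
          using that by simp
      qed
    qed
    show "(row_tau ^^ j) (unit_row k) \<in> {x. (\<Sum>l<r. t_act A (t_coords x l) (g l)) = x}" if "k < d" for k j
      using p_sum[OF rows_over_tau_unit[OF that, of j]] t_coords_tau_unit[OF that] by simp
  qed
  then show ?thesis
    using x by blast
qed

lemma t_basis_g: "t_basis d A r g"
  unfolding t_basis_def
proof (intro conjI allI impI ballI)
  show "\<exists>f. x = (\<Sum>l<r. t_act A (f l) (g l))" if "x \<in> row_space d" for x
    using sum_t_coords[OF that] by (intro exI[of _ "t_coords x"]) simp
  show "f l = 0" if "(\<Sum>l<r. t_act A (f l) (g l)) = 0" "l < r" for f l
    using t_coords_t_act_sum[OF that(2), of f] that(1) by simp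
qed (rule g_in)

lemma t_coords_tau:
  assumes x: "x \<in> row_space d" and k: "k < r"
  shows "t_coords (row_tau x) k = (\<Sum>l<r. frob_poly (t_coords x l) * t_coords (row_tau (g l)) k)"
proof -
  have "row_tau x = row_tau (\<Sum>l<r. t_act A (t_coords x l) (g l))"
    using sum_t_coords[OF x] by simp
  also have "\<dots> = (\<Sum>l<r. t_act A (frob_poly (t_coords x l)) (row_tau (g l)))"
    by (simp only: row_tau_sum t_act_tau)
  finally show ?thesis
    using k by (simp add: t_coords_sum t_coords_t_act row_tau_in g_in)
qed

end

section \<open>Maps out of the tensor product\<close>

text \<open>
  A balanced biadditive map \<open>h\<close> and the additive map that it induces on the tensor product. Only such
  maps out of the tensor product are needed; they transport the lattice into coordinates.
\<close>

locale tensor_functional =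
  fixes R :: "'r ring" and N :: "('r, 'n) module" and M :: "('r, 'm) module"
    and h :: "'n \<Rightarrow> 'm \<Rightarrow> 'c::ring_1"
  assumes N_add: "\<And>x y. x \<in> carrier N \<Longrightarrow> y \<in> carrier N \<Longrightarrow> x \<oplus>\<^bsub>N\<^esub> y \<in> carrier N"
    and M_add: "\<And>x y. x \<in> carrier M \<Longrightarrow> y \<in> carrier M \<Longrightarrow> x \<oplus>\<^bsub>M\<^esub> y \<in> carrier M"
    and N_smult: "\<And>a x. a \<in> carrier R \<Longrightarrow> x \<in> carrier N \<Longrightarrow> a \<odot>\<^bsub>N\<^esub> x \<in> carrier N"
    and M_smult: "\<And>a x. a \<in> carrier R \<Longrightarrow> x \<in> carrier M \<Longrightarrow> a \<odot>\<^bsub>M\<^esub> x \<in> carrier M"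
    and h_add_left: "\<And>x y m. x \<in> carrier N \<Longrightarrow> y \<in> carrier N \<Longrightarrow> m \<in> carrier M \<Longrightarrow>
      h (x \<oplus>\<^bsub>N\<^esub> y) m = h x m + h y m"
    and h_add_right: "\<And>x m n. x \<in> carrier N \<Longrightarrow> m \<in> carrier M \<Longrightarrow> n \<in> carrier M \<Longrightarrow>
      h x (m \<oplus>\<^bsub>M\<^esub> n) = h x m + h x n"
    and h_smult: "\<And>a x m. a \<in> carrier R \<Longrightarrow> x \<in> carrier N \<Longrightarrow> m \<in> carrier M \<Longrightarrow>
      h (a \<odot>\<^bsub>N\<^esub> x) m = h x (a \<odot>\<^bsub>M\<^esub> m)"
begin

abbreviation "free \<equiv> tensor_free N M"
abbreviation "null \<equiv> tensor_null R N M"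
abbreviation "tensor \<equiv> tensor_group R N M"

sublocale free: comm_group free
  unfolding tensor_free_def by (rule abelian_free_Abelian_group)

lemma free_mult [simp]: "a \<otimes>\<^bsub>free\<^esub> b = a + b"
  and free_one [simp]: "\<one>\<^bsub>free\<^esub> = 0"
  and free_carrier: "c \<in> carrier free \<longleftrightarrow> Poly_Mapping.keys c \<subseteq> carrier N \<times> carrier M"
  by (simp_all add: tensor_free_def)

lemma frag_of_in_free: "x \<in> carrier N \<Longrightarrow> m \<in> carrier M \<Longrightarrow> frag_of (x, m) \<in> carrier free"
  by (simp add: free_carrier)

lemma free_diff: "a \<in> carrier free \<Longrightarrow> b \<in> carrier free \<Longrightarrow> a - b \<in> carrier free"
  using keys_diff[of a b] by (auto simp: free_carrier)

lemma free_inv: "a \<in> carrier free \<Longrightarrow> inv\<^bsub>free\<^esub> a = - a"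
  by (rule free.inv_equality) (simp_all add: free_carrier)

lemma relations_left: "x \<in> carrier N \<Longrightarrow> y \<in> carrier N \<Longrightarrow> m \<in> carrier M \<Longrightarrow>
    frag_of (x \<oplus>\<^bsub>N\<^esub> y, m) - frag_of (x, m) - frag_of (y, m) \<in> tensor_relations R N M"
  and relations_right: "x \<in> carrier N \<Longrightarrow> m \<in> carrier M \<Longrightarrow> n \<in> carrier M \<Longrightarrow>
    frag_of (x, m \<oplus>\<^bsub>M\<^esub> n) - frag_of (x, m) - frag_of (x, n) \<in> tensor_relations R N M"
  and relations_balanced: "a \<in> carrier R \<Longrightarrow> x \<in> carrier N \<Longrightarrow> m \<in> carrier M \<Longrightarrow>
    frag_of (a \<odot>\<^bsub>N\<^esub> x, m) - frag_of (x, a \<odot>\<^bsub>M\<^esub> m) \<in> tensor_relations R N M"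
  unfolding tensor_relations_def by blast+

lemma relations_subset: "tensor_relations R N M \<subseteq> carrier free"
  unfolding tensor_relations_def
  by (auto intro!: free_diff frag_of_in_free N_add M_add N_smult M_smult)

lemma null_subgroup: "subgroup null free"
  unfolding tensor_null_def by (rule free.generate_is_subgroup[OF relations_subset])

lemma null_normal: "null \<lhd> free"
  by (rule free.subgroup_imp_normal[OF null_subgroup])

lemma tensor_carrier: "Z \<in> carrier tensor \<longleftrightarrow> (\<exists>c\<in>carrier free. Z = null #>\<^bsub>free\<^esub> c)"
  by (auto simp: tensor_group_def FactGroup_def RCOSETS_def)

lemma tensor_mult:
  "a \<in> carrier free \<Longrightarrow> b \<in> carrier free \<Longrightarrow>
    (null #>\<^bsub>free\<^esub> a) \<otimes>\<^bsub>tensor\<^esub> (null #>\<^bsub>free\<^esub> b) = null #>\<^bsub>free\<^esub> (a + b)"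
  using normal.rcos_sum[OF null_normal, of a b] by (simp add: tensor_group_def)

lemma tensor_comm_group: "comm_group tensor"
proof -
  interpret group tensor
    unfolding tensor_group_def by (rule normal.factorgroup_is_group[OF null_normal])
  show ?thesis
    by unfold_locales (auto simp: tensor_carrier tensor_mult add.commute)
qed

definition functional :: "('n \<times> 'm \<Rightarrow>\<^sub>0 int) \<Rightarrow> 'c"
  where "functional c = (\<Sum>z\<in>Poly_Mapping.keys c. of_int (Poly_Mapping.lookup c z) * h (fst z) (snd z))"

lemma functional_eq:
  assumes "finite S" "Poly_Mapping.keys c \<subseteq> S"
  shows "functional c = (\<Sum>z\<in>S. of_int (Poly_Mapping.lookup c z) * h (fst z) (snd z))"
  unfolding functional_def
  by (rule sum.mono_neutral_left) (use assms in \<open>auto simp: in_keys_iff\<close>)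

lemma functional_diff: "functional (a - b) = functional a - functional b"
proof -
  define S where "S = Poly_Mapping.keys a \<union> Poly_Mapping.keys b"
  have "finite S" "Poly_Mapping.keys (a - b) \<subseteq> S"
    using keys_diff[of a b] by (auto simp: S_def)
  then show ?thesis
    by (simp add: functional_eq[of S] S_def lookup_minus left_diff_distrib sum_subtractf)
qed

lemma functional_0 [simp]: "functional 0 = 0"
  by (simp add: functional_def)

lemma functional_add: "functional (a + b) = functional a + functional b"
  using functional_diff[of "a + b" b] by simp

lemma functional_minus: "functional (- a) = - functional a"
  using functional_diff[of 0 a] by simp

lemma functional_sum: "functional (sum f S) = (\<Sum>s\<in>S. functional (f s))"
  by (induction S rule: infinite_finite_induct) (auto simp: functional_add)

lemma functional_frag_of [simp]: "functional (frag_of (x, m)) = h x m"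
  by (simp add: functional_def)

lemma functional_null:
  assumes "a \<in> null"
  shows "functional a = 0"
proof -
  define k where "k = {a \<in> carrier free. functional a = 0}"
  have "subgroup k free"
  proof (rule subgroup.intro)
    show "inv\<^bsub>free\<^esub> x \<in> k" if "x \<in> k" for x
      using that free.inv_closed[of x] by (simp add: k_def free_inv functional_minus)
  qed (use free.m_closed free.one_closed in \<open>auto simp: k_def functional_add\<close>)
  moreover have "functional a = 0" if "a \<in> tensor_relations R N M" for a
    using that unfolding tensor_relations_def
    by (auto simp: functional_diff h_add_left h_add_right h_smult)
  then have "tensor_relations R N M \<subseteq> k"
    using relations_subset unfolding k_def by blast
  ultimately have "null \<subseteq> k"
    unfolding tensor_null_def by (intro free.generate_subgroup_incl)
  then show ?thesis
    using assms by (auto simp: k_def)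
qed

text \<open>
  The value on a coset is that on any representative, by \<open>quotient_functional_coset\<close>.
\<close>

definition quotient_functional :: "('n \<times> 'm \<Rightarrow>\<^sub>0 int) set \<Rightarrow> 'c"
  where "quotient_functional Z = functional (SOME c. c \<in> Z)"

lemma quotient_functional_coset:
  assumes "c \<in> carrier free"
  shows "quotient_functional (null #>\<^bsub>free\<^esub> c) = functional c"
proof -
  have "c \<in> null #>\<^bsub>free\<^esub> c"
    by (rule free.rcos_self[OF assms null_subgroup])
  then have "(SOME c'. c' \<in> null #>\<^bsub>free\<^esub> c) \<in> null #>\<^bsub>free\<^esub> c"
    by (rule someI)
  then show ?thesis
    unfolding quotient_functional_def by (auto simp: r_coset_def functional_add functional_null)
qed

lemma quotient_functional_mult:
  assumes "Z \<in> carrier tensor" "Z' \<in> carrier tensor"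
  shows "quotient_functional (Z \<otimes>\<^bsub>tensor\<^esub> Z') = quotient_functional Z + quotient_functional Z'"
  using assms free.m_closed
  by (auto simp: tensor_carrier tensor_mult quotient_functional_coset functional_add)

lemma quotient_functional_one: "quotient_functional \<one>\<^bsub>tensor\<^esub> = 0"
proof -
  have "\<one>\<^bsub>tensor\<^esub> = null #>\<^bsub>free\<^esub> 0"
    using free.coset_mult_one[OF subgroup.subset[OF null_subgroup]]
    by (simp add: tensor_group_def FactGroup_def)
  then show ?thesis
    using quotient_functional_coset[of 0] free.one_closed by simp
qed

lemma finsum_quotient_functional:
  fixes V :: "('f, ('n \<times> 'm \<Rightarrow>\<^sub>0 int) set) module"
  assumes V: "carrier V = carrier tensor" "ring.zero V = \<one>\<^bsub>tensor\<^esub>" "ring.add V = monoid.mult tensor"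
    and "finite B" and "\<And>b. b \<in> B \<Longrightarrow> f b \<in> carrier tensor"
  shows "finsum V f B \<in> carrier tensor \<and>
    quotient_functional (finsum V f B) = (\<Sum>b\<in>B. quotient_functional (f b))"
proof -
  interpret comm_group tensor
    by (rule tensor_comm_group)
  have "comm_monoid (add_monoid V)"
    by unfold_locales (use m_assoc m_comm in \<open>auto simp: V\<close>)
  then interpret V: abelian_monoid V
    by (rule abelian_monoid.intro)
  show ?thesis
    using assms(4,5)
  proof (induction B rule: finite_induct)
    case empty
    then show ?case
      using one_closed by (simp add: V quotient_functional_one)
  next
    case (insert b B)
    then have "finsum V f (insert b B) = f b \<otimes>\<^bsub>tensor\<^esub> finsum V f B"
      using V.finsum_insert[of B b f] by (simp add: V Pi_def)
    then show ?case
      using insert m_closed by (simp add: quotient_functional_mult)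
  qed
qed

text \<open>
  The hypotheses say that \<open>f\<close> and \<open>g\<close> are semilinear for the same map \<open>s\<close> of the ring of scalars. Then
  \<open>f \<otimes> g\<close> sends each defining relation to a defining relation. Multiplication by a Laurent series is the
  case where \<open>s\<close> is the identity, and for \<open>\<tau>\<close> the map \<open>s\<close> raises all coefficients to the power \<open>q\<close>.
\<close>

lemma coset_map:
  assumes f: "\<And>x. x \<in> carrier N \<Longrightarrow> f x \<in> carrier N"
    and g: "\<And>m. m \<in> carrier M \<Longrightarrow> g m \<in> carrier M"
    and f_add: "\<And>x y. x \<in> carrier N \<Longrightarrow> y \<in> carrier N \<Longrightarrow> f (x \<oplus>\<^bsub>N\<^esub> y) = f x \<oplus>\<^bsub>N\<^esub> f y"
    and g_add: "\<And>x y. x \<in> carrier M \<Longrightarrow> y \<in> carrier M \<Longrightarrow> g (x \<oplus>\<^bsub>M\<^esub> y) = g x \<oplus>\<^bsub>M\<^esub> g y"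
    and s: "\<And>a. a \<in> carrier R \<Longrightarrow> s a \<in> carrier R"
    and f_smult: "\<And>a x. a \<in> carrier R \<Longrightarrow> x \<in> carrier N \<Longrightarrow> f (a \<odot>\<^bsub>N\<^esub> x) = s a \<odot>\<^bsub>N\<^esub> f x"
    and g_smult: "\<And>a x. a \<in> carrier R \<Longrightarrow> x \<in> carrier M \<Longrightarrow> g (a \<odot>\<^bsub>M\<^esub> x) = s a \<odot>\<^bsub>M\<^esub> g x"
    and c: "c \<in> carrier free"
  shows "tensor_map R N M f g (null #>\<^bsub>free\<^esub> c) =
      null #>\<^bsub>free\<^esub> frag_extend (\<lambda>(x, m). frag_of (f x, g m)) c"
    "frag_extend (\<lambda>(x, m). frag_of (f x, g m)) c \<in> carrier free"
proof -
  have "frag_extend (\<lambda>(x, m). frag_of (f x, g m)) a \<in> tensor_relations R N M"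
    if "a \<in> tensor_relations R N M" for a
  proof -
    from that consider
      (left) x y m where "a = frag_of (x \<oplus>\<^bsub>N\<^esub> y, m) - frag_of (x, m) - frag_of (y, m)"
        "x \<in> carrier N" "y \<in> carrier N" "m \<in> carrier M"
    | (right) x m n where "a = frag_of (x, m \<oplus>\<^bsub>M\<^esub> n) - frag_of (x, m) - frag_of (x, n)"
        "x \<in> carrier N" "m \<in> carrier M" "n \<in> carrier M"
    | (balanced) e x m where "a = frag_of (e \<odot>\<^bsub>N\<^esub> x, m) - frag_of (x, e \<odot>\<^bsub>M\<^esub> m)"
        "e \<in> carrier R" "x \<in> carrier N" "m \<in> carrier M"
      unfolding tensor_relations_def by blast
    then show ?thesis
    proof cases
      case left
      then show ?thesis
        using relations_left[OF f f g] by (simp add: frag_extend_diff f_add)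
    next
      case right
      then show ?thesis
        using relations_right[OF f g g] by (simp add: frag_extend_diff g_add)
    next
      case balanced
      then show ?thesis
        using relations_balanced[OF s f g] by (simp add: frag_extend_diff f_smult g_smult)
    qed
  qed
  then have resp: "frag_extend (\<lambda>(x, m). frag_of (f x, g m)) ` tensor_relations R N M \<subseteq> null"
    unfolding tensor_null_def by (auto intro: generate.incl)
  show "tensor_map R N M f g (null #>\<^bsub>free\<^esub> c) =
      null #>\<^bsub>free\<^esub> frag_extend (\<lambda>(x, m). frag_of (f x, g m)) c"
    by (rule tensor_map_coset[OF relations_subset f g resp c])
  show "frag_extend (\<lambda>(x, m). frag_of (f x, g m)) c \<in> carrier free"
    using c unfolding free_carrier
  proof (induction rule: frag_induction)
    case (diff a b)
    then show ?case
      using keys_diff by (fastforce simp: frag_extend_diff)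
  qed (use f g in auto)
qed

end

section \<open>Laurent series in the inverse of the indeterminate\<close>

context frobenius_field
begin

lemma fls_twist_nth [simp]: "fls_nth (fls_twist Fq f) n = fls_nth f n ^ q"
proof -
  have "\<forall>n < fls_subdegree f. fls_nth f n ^ q = 0"
    by simp
  then show ?thesis
    unfolding fls_twist_def by (rule nth_Abs_fls_lower_bound)
qed

lemma fls_twist_add: "fls_twist Fq (f + g) = fls_twist Fq f + fls_twist Fq g"
  by (intro fls_eqI) (simp add: frobenius_add)

lemma fls_twist_0 [simp]: "fls_twist Fq 0 = 0"
  by (intro fls_eqI) simp

lemma fls_twist_eq_0: "fls_twist Fq f = 0 \<Longrightarrow> f = 0"
  by (intro fls_eqI) (metis fls_twist_nth fls_zero_nth power_eq_0_iff)

lemma fls_subdegree_twist: "fls_subdegree (fls_twist Fq f) = fls_subdegree f"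
proof (cases "f = 0")
  case False
  then show ?thesis
    by (intro fls_subdegree_eqI) auto
qed simp

lemma frobenius_sum_int: "(sum f S :: 'a) ^ q = (\<Sum>s\<in>S. f s ^ q)"
  by (induction S rule: infinite_finite_induct) (auto simp: frobenius_add)

lemma fls_twist_mult: "fls_twist Fq (f * g) = fls_twist Fq f * fls_twist Fq g"
  by (intro fls_eqI)
    (simp add: fls_times_nth(2) fls_subdegree_twist frobenius_sum_int power_mult_distrib)

text \<open>
  The embedding of polynomials in \<open>t\<close> into Laurent series in \<open>1/t\<close>: the coefficient of \<open>t\<^sup>i\<close> has index
  \<open>-i\<close>.
\<close>

definition emb :: "'a poly \<Rightarrow> 'a fls"
  where "emb f = poly (map_poly fls_const f) fls_X_inv"

lemma emb_eq: "emb f = (\<Sum>i\<le>Polynomial.degree f. fls_const (poly.coeff f i) * fls_X_inv ^ i)"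
proof -
  have "Polynomial.degree (map_poly fls_const f) = Polynomial.degree f"
    by (rule degree_map_poly) (simp add: fls_const_nonzero)
  then show ?thesis
    by (simp add: emb_def poly_altdef coeff_map_poly)
qed

lemma emb_nth: "fls_nth (emb f) n = (if n \<le> 0 then poly.coeff f (nat (- n)) else 0)"
proof -
  have "fls_nth (emb f) n = (\<Sum>i\<le>Polynomial.degree f. poly.coeff f i * (if n = - int i then 1 else 0))"
    by (simp add: emb_eq fls_nth_sum fls_X_inv_power_nth)
  also have "\<dots> = (\<Sum>i\<le>Polynomial.degree f. if i = nat (- n) then (if n \<le> 0 then poly.coeff f i else 0) else 0)"
    by (intro sum.cong) auto
  also have "\<dots> = (if n \<le> 0 then poly.coeff f (nat (- n)) else 0)"
    by (auto simp: coeff_eq_0)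
  finally show ?thesis .
qed

lemma emb_add: "emb (f + g) = emb f + emb g"
  by (intro fls_eqI) (simp add: emb_nth)

lemma emb_0 [simp]: "emb 0 = 0"
  by (intro fls_eqI) (simp add: emb_nth)

lemma emb_1 [simp]: "emb 1 = 1"
  by (intro fls_eqI) (auto simp: emb_nth one_pCons coeff_pCons split: nat.splits)

lemma emb_monom: "emb (Polynomial.monom c n) = fls_const c * fls_X_inv ^ n"
  by (intro fls_eqI) (auto simp: emb_nth)

lemma emb_mult: "emb (f * g) = emb f * emb g"
proof (induction f rule: poly_induct_monom)
  case (monom c n)
  show ?case
  proof (induction g rule: poly_induct_monom)
    case (monom e m)
    have "fls_const (c * e) = fls_const c * fls_const e"
      by (rule fls_const_mult_const[symmetric])
    then show ?case
      by (simp only: mult_monom emb_monom power_add) (simp only: ac_simps)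
  qed (simp add: distrib_left emb_add)
qed (simp add: distrib_right emb_add)

lemma emb_sum: "emb (sum f S) = (\<Sum>s\<in>S. emb (f s))"
  by (induction S rule: infinite_finite_induct) (auto simp: emb_add)

lemma fls_twist_emb: "fls_twist Fq (emb f) = emb (frob_poly f)"
  by (intro fls_eqI) (simp add: emb_nth)

lemma emb_smult: "emb (Polynomial.smult c f) = fls_const c * emb f"
  by (intro fls_eqI) (simp add: emb_nth)

end

section \<open>The lattice in coordinates\<close>

definition row_matrix :: "nat \<Rightarrow> (nat \<Rightarrow> 'a poly) \<Rightarrow> 'a poly mat"
  where "row_matrix d x = mat 1 d (\<lambda>(i, j). x j)"

definition fls_rows :: "nat \<Rightarrow> (nat \<Rightarrow> 'a::zero fls) set"
  where "fls_rows r = {y. \<forall>k\<ge>r. y k = 0}"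

definition fls_mul :: "'a::comm_ring_1 fls \<Rightarrow> (nat \<Rightarrow> 'a fls) \<Rightarrow> nat \<Rightarrow> 'a fls"
  where "fls_mul f y = (\<lambda>k. f * y k)"

lemma mats_over_iff:
  "A \<in> mats_over S m n \<longleftrightarrow> A \<in> carrier_mat m n \<and> (\<forall>i<m. \<forall>j<n. A $$ (i, j) \<in> S)"
  by (auto simp: mats_over_def elements_mat_def UN_subset_iff image_subset_iff)

locale t_matrix_of = t_matrix Fq K d A for Fq :: "'a::alg_closed_field set" and K d A +
  fixes \<phi> :: "'a poly \<Rightarrow> 'a poly mat"
  assumes \<phi>: "\<phi> (Polynomial.monom 1 1) = A"
begin

abbreviation "R \<equiv> poly_ring_over K"
abbreviation "N \<equiv> laurent_module :: ('a poly, 'a fls) module"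
abbreviation "M \<equiv> assoc_module Fq K d \<phi>"

lemma M_carrier: "carrier M = mats_over (polys_over K) 1 d"
  and M_add [simp]: "x \<oplus>\<^bsub>M\<^esub> y = x + y"
  by (simp_all add: assoc_module_def)

lemma N_carrier [simp]: "carrier N = UNIV"
  and N_add [simp]: "x \<oplus>\<^bsub>N\<^esub> y = x + y"
  and N_smult [simp]: "a \<odot>\<^bsub>N\<^esub> x = emb a * x"
  by (simp_all add: laurent_module_def emb_def)

lemma R_carrier [simp]: "carrier R = polys_over K"
  by (simp add: poly_ring_over_def)

lemma mat_row_M: "m \<in> carrier M \<Longrightarrow> mat_row m 0 \<in> rows_over K d"
  using polys_over_closed(1)[OF K]
  by (auto simp: M_carrier mats_over_iff rows_over_def row_space_def mat_row_def)

lemma mat_row_in_row_space: "m \<in> carrier M \<Longrightarrow> mat_row m 0 \<in> row_space d"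
  using mat_row_M by (simp add: rows_over_def)

lemma mat_row_row_matrix: "x \<in> row_space d \<Longrightarrow> mat_row (row_matrix d x) 0 = x"
  by (auto simp: row_matrix_def mat_row_def row_space_def fun_eq_iff)

lemma row_matrix_in: "x \<in> rows_over K d \<Longrightarrow> row_matrix d x \<in> carrier M"
  by (auto simp: M_carrier mats_over_iff rows_over_def row_matrix_def)

lemma mat_row_inj: "m \<in> carrier_mat 1 d \<Longrightarrow> n \<in> carrier_mat 1 d \<Longrightarrow> mat_row m 0 = mat_row n 0 \<Longrightarrow> m = n"
proof (rule eq_matI)
  fix i j
  assume m: "m \<in> carrier_mat 1 d" and n: "n \<in> carrier_mat 1 d" and eq: "mat_row m 0 = mat_row n 0"
    and ij: "i < dim_row n" "j < dim_col n"
  have "m $$ (0, j) = mat_row m 0 j" "n $$ (0, j) = mat_row n 0 j"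
    using m n ij by (simp_all add: mat_row_def)
  then show "m $$ (i, j) = n $$ (i, j)"
    using eq ij(1) n by simp
qed auto

lemma M_carrier_mat: "m \<in> carrier M \<Longrightarrow> m \<in> carrier_mat 1 d"
  by (simp add: M_carrier mats_over_iff)

lemma mat_row_add: "m \<in> carrier M \<Longrightarrow> n \<in> carrier M \<Longrightarrow> mat_row (m + n) 0 = mat_row m 0 + mat_row n 0"
  by (auto simp: M_carrier mats_over_iff mat_row_def fun_eq_iff)

lemma M_add_closed: "m \<in> carrier M \<Longrightarrow> n \<in> carrier M \<Longrightarrow> m + n \<in> carrier M"
  using polys_over_closed(3)[OF K] by (auto simp: M_carrier mats_over_iff)

lemma mat_row_pow:
  assumes "m \<in> carrier_mat 1 d"
  shows "((\<lambda>y. skew_mat_mult Fq y A) ^^ i) m \<in> carrier_mat 1 d \<and>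
    mat_row (((\<lambda>y. skew_mat_mult Fq y A) ^^ i) m) 0 = ((\<lambda>y. row_mul y A) ^^ i) (mat_row m 0)"
proof (induction i)
  case 0
  show ?case
    using assms by simp
next
  case (Suc i)
  define n where "n = ((\<lambda>y. skew_mat_mult Fq y A) ^^ i) m"
  have n: "n \<in> carrier_mat 1 d" "mat_row n 0 = ((\<lambda>y. row_mul y A) ^^ i) (mat_row m 0)"
    using Suc.IH by (simp_all add: n_def)
  have "mat_row (skew_mat_mult Fq n A) 0 = row_mul (mat_row n 0) A"
    using n(1) A by (intro mat_row_mult) auto
  moreover have "skew_mat_mult Fq n A \<in> carrier_mat 1 d"
    using n(1) A by (rule skew_mat_mult_carrier)
  ultimately show ?case
    unfolding funpow.simps comp_apply n_def[symmetric] n(2) by simp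
qed

lemma mat_row_smult:
  assumes "m \<in> carrier M"
  shows "mat_row (f \<odot>\<^bsub>M\<^esub> m) 0 = t_act A f (mat_row m 0)"
proof
  fix l
  show "mat_row (f \<odot>\<^bsub>M\<^esub> m) 0 l = t_act A f (mat_row m 0) l"
  proof (cases "l < d")
    case True
    have "(((\<lambda>y. skew_mat_mult Fq y A) ^^ i) m) $$ (0, l) = ((\<lambda>y. row_mul y A) ^^ i) (mat_row m 0) l" for i
    proof -
      define n where "n = ((\<lambda>y. skew_mat_mult Fq y A) ^^ i) m"
      have n: "n \<in> carrier_mat 1 d" "mat_row n 0 = ((\<lambda>y. row_mul y A) ^^ i) (mat_row m 0)"
        using mat_row_pow[OF M_carrier_mat[OF assms], of i] by (simp_all only: n_def)
      have "n $$ (0, l) = mat_row n 0 l"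
        using n(1) True by (simp add: mat_row_def)
      then show ?thesis
        unfolding n(2) by (simp only: n_def)
    qed
    then show ?thesis
      using True
      by (simp add: assoc_module_def \<phi> mat_row_def t_act_def rows.lincomb_def sum_fun_apply del: One_nat_def)
  next
    case False
    have "t_act A f (mat_row m 0) \<in> row_space d"
      unfolding t_act_def
      by (intro rows.lincomb_in_subspace[OF subspace_row_space] row_mul_pow_in[OF carrier_matD(2)[OF A]]
          mat_row_in_row_space assms)
    then show ?thesis
      using False by (simp add: assoc_module_def mat_row_def row_space_def)
  qed
qed

lemma t_act_rows_over:
  assumes "f \<in> polys_over K" "x \<in> rows_over K d"
  shows "t_act A f x \<in> rows_over K d"
proof -
  have pow: "((\<lambda>y. row_mul y A) ^^ i) x \<in> rows_over K d" for i
  proof (induction i)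
    case (Suc i)
    then show ?case
      unfolding funpow.simps comp_apply by (rule rows_over_mul)
  qed (use assms in \<open>simp only: funpow.simps id_apply\<close>)
  show ?thesis
    unfolding t_act_def rows.lincomb_def
    by (intro sum_in_closed rows_over_0 rows_over_add rows_over_scale pow)
      (use assms(1) in \<open>auto simp: polys_over_iff\<close>)
qed

lemma M_smult_closed:
  assumes "f \<in> polys_over K" "m \<in> carrier M"
  shows "f \<odot>\<^bsub>M\<^esub> m \<in> carrier M"
proof -
  have "f \<odot>\<^bsub>M\<^esub> m \<in> carrier_mat 1 d"
    by (simp add: assoc_module_def)
  moreover have "row_matrix d (t_act A f (mat_row m 0)) \<in> carrier M"
    by (intro row_matrix_in t_act_rows_over assms mat_row_M)
  moreover have "t_act A f (mat_row m 0) \<in> row_space d"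
    using t_act_rows_over[OF assms(1) mat_row_M[OF assms(2)]] by (simp add: rows_over_def)
  ultimately have "f \<odot>\<^bsub>M\<^esub> m = row_matrix d (t_act A f (mat_row m 0))"
    using M_carrier_mat by (intro mat_row_inj) (simp_all add: mat_row_smult[OF assms(2)] mat_row_row_matrix)
  then show ?thesis
    using \<open>row_matrix d (t_act A f (mat_row m 0)) \<in> carrier M\<close> by simp
qed

lemma mat_row_tau: "m \<in> carrier M \<Longrightarrow> mat_row (tau_action Fq m) 0 = row_tau (mat_row m 0)"
  by (auto simp: M_carrier mats_over_iff tau_action_def mat_row_def fun_eq_iff poly_tau_def)

lemma M_tau_closed: "m \<in> carrier M \<Longrightarrow> tau_action Fq m \<in> carrier M"
proof -
  assume m: "m \<in> carrier M"
  have "tau_action Fq m = row_matrix d (row_tau (mat_row m 0))"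
    using M_carrier_mat[OF m]
    by (intro mat_row_inj)
      (simp_all add: mat_row_tau[OF m] mat_row_row_matrix row_tau_in mat_row_in_row_space[OF m],
        simp_all add: tau_action_def row_matrix_def)
  then show ?thesis
    using row_matrix_in[OF rows_over_tau[OF mat_row_M[OF m]]] by simp
qed

end

locale t_motive_of = t_motive Fq K d A r g p + t_matrix_of Fq K d A \<phi>
  for Fq :: "'a::alg_closed_field set" and K d A r g p \<phi>
begin

definition coord :: "nat \<Rightarrow> 'a fls \<Rightarrow> 'a poly mat \<Rightarrow> 'a fls"
  where "coord k x m = (if k < r then x * emb (t_coords (mat_row m 0) k) else 0)"

sublocale tensor: tensor_functional R N M "coord k" for k
  by unfold_locales
    (auto simp: coord_def M_add_closed M_smult_closed mat_row_add t_coords_add emb_add mat_row_smult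
      t_coords_t_act[OF mat_row_in_row_space] emb_mult algebra_simps)

text \<open>
  The coordinate map of the tensor product to Laurent series vectors of length \<open>r\<close>, which sends
  \<open>x \<otimes> m\<close> to \<open>x\<close> times the coordinates of \<open>m\<close>. It is onto, linear over the Laurent series and compatible
  with \<open>\<tau>\<close>, and these properties suffice to replace the lattice by its image.
\<close>

definition Psi :: "'a laurent_tensors \<Rightarrow> nat \<Rightarrow> 'a fls"
  where "Psi Z = (\<lambda>k. tensor.quotient_functional k Z)"

text \<open>
  The operator \<open>\<tau>\<close> in coordinates: the Frobenius twist followed by the matrix of \<open>\<tau>\<close> in the basis \<open>g\<close>.
\<close>

definition tau_fls :: "(nat \<Rightarrow> 'a fls) \<Rightarrow> nat \<Rightarrow> 'a fls"
  where "tau_fls y = (\<lambda>k. if k < r then \<Sum>l<r. fls_twist Fq (y l) * emb (t_coords (row_tau (g l)) k) else 0)"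

definition coordinates :: "(nat \<Rightarrow> 'a poly) \<Rightarrow> nat \<Rightarrow> 'a fls"
  where "coordinates x = (\<lambda>k. if k < r then emb (t_coords x k) else 0)"

abbreviation "V \<equiv> laurent_tensor Fq K d \<phi>"

lemma V_carrier: "carrier V = carrier (tensor_group R N M)"
  and V_zero: "ring.zero V = \<one>\<^bsub>tensor_group R N M\<^esub>"
  and V_add: "ring.add V = monoid.mult (tensor_group R N M)"
  and V_smult: "f \<odot>\<^bsub>V\<^esub> Z = tensor_map R N M (\<lambda>g. f * g) (\<lambda>m. m) Z"
  by (simp_all add: laurent_tensor_def Let_def)

lemma Psi_coset:
  "c \<in> carrier (tensor_free N M) \<Longrightarrow>
    Psi (tensor_null R N M #>\<^bsub>tensor_free N M\<^esub> c) = (\<lambda>k. tensor.functional k c)"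
  by (simp add: Psi_def tensor.quotient_functional_coset)

lemma functional_in: "(\<lambda>k. tensor.functional k c) \<in> fls_rows r"
  by (auto simp: fls_rows_def tensor.functional_def coord_def)

lemma Psi_in: "Z \<in> carrier V \<Longrightarrow> Psi Z \<in> fls_rows r"
  using functional_in by (auto simp: V_carrier tensor.tensor_carrier Psi_coset)

lemma Psi_smult:
  assumes Z: "Z \<in> carrier V"
  shows "f \<odot>\<^bsub>V\<^esub> Z \<in> carrier V" "Psi (f \<odot>\<^bsub>V\<^esub> Z) = fls_mul f (Psi Z)"
proof -
  obtain c where c: "c \<in> carrier (tensor_free N M)"
    "Z = tensor_null R N M #>\<^bsub>tensor_free N M\<^esub> c"
    using Z by (auto simp: V_carrier tensor.tensor_carrier)
  define c' where "c' = frag_extend (\<lambda>(x, m). frag_of (f * x, m)) c"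
  have map: "f \<odot>\<^bsub>V\<^esub> Z = tensor_null R N M #>\<^bsub>tensor_free N M\<^esub> c'" "c' \<in> carrier (tensor_free N M)"
    unfolding V_smult c(2) c'_def
    by (rule tensor.coset_map[where s = "\<lambda>a. a"]; use c in \<open>simp add: algebra_simps\<close>)+
  show "f \<odot>\<^bsub>V\<^esub> Z \<in> carrier V"
    using map by (auto simp: V_carrier tensor.tensor_carrier)
  have "tensor.functional k c' = f * tensor.functional k c" for k
    using c(1) unfolding c'_def tensor.free_carrier
  proof (induction rule: frag_induction)
    case (one z)
    then show ?case
      by (cases z) (simp, simp add: coord_def mult.assoc)
  qed (simp_all add: frag_extend_diff tensor.functional_diff right_diff_distrib)
  moreover have "Psi (f \<odot>\<^bsub>V\<^esub> Z) = (\<lambda>k. tensor.functional k c')"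
    unfolding map(1) by (rule Psi_coset[OF map(2)])
  moreover have "Psi Z = (\<lambda>k. tensor.functional k c)"
    unfolding c(2) by (rule Psi_coset[OF c(1)])
  ultimately show "Psi (f \<odot>\<^bsub>V\<^esub> Z) = fls_mul f (Psi Z)"
    by (simp add: fls_mul_def)
qed

lemma tau_fls_0: "tau_fls 0 = 0"
  by (simp add: tau_fls_def fun_eq_iff)

lemma tau_fls_add: "tau_fls (x + y) = tau_fls x + tau_fls y"
  by (auto simp: tau_fls_def fun_eq_iff fls_twist_add distrib_right sum.distrib)

lemma tau_fls_diff: "tau_fls (x - y) = tau_fls x - tau_fls y"
  using tau_fls_add[of "x - y" y] by simp

lemma tau_fls_in: "tau_fls y \<in> fls_rows r"
  by (simp add: tau_fls_def fls_rows_def)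

lemma tau_fls_mul: "tau_fls (fls_mul f y) = fls_mul (fls_twist Fq f) (tau_fls y)"
  by (auto simp: tau_fls_def fls_mul_def fun_eq_iff fls_twist_mult sum_distrib_left mult.assoc)

lemma emb_t_coords_tau:
  assumes "x \<in> row_space d" "k < r"
  shows "emb (t_coords (row_tau x) k) = (\<Sum>l<r. fls_twist Fq (emb (t_coords x l)) * emb (t_coords (row_tau (g l)) k))"
  using t_coords_tau[OF assms] by (simp add: emb_sum emb_mult fls_twist_emb)

lemma Psi_tau:
  assumes Z: "Z \<in> carrier V"
  shows "tensor_tau Fq K d \<phi> Z \<in> carrier V" "Psi (tensor_tau Fq K d \<phi> Z) = tau_fls (Psi Z)"
proof -
  obtain c where c: "c \<in> carrier (tensor_free N M)"
    "Z = tensor_null R N M #>\<^bsub>tensor_free N M\<^esub> c"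
    using Z by (auto simp: V_carrier tensor.tensor_carrier)
  define c' where "c' = frag_extend (\<lambda>(x, m). frag_of (fls_twist Fq x, tau_action Fq m)) c"
  have smult: "tau_action Fq (a \<odot>\<^bsub>M\<^esub> m) = frob_poly a \<odot>\<^bsub>M\<^esub> tau_action Fq m"
    if "a \<in> polys_over K" "m \<in> carrier M" for a m
  proof (rule mat_row_inj)
    have a: "frob_poly a \<in> polys_over K"
      using that(1) subfield_closed(6)[OF K] by (simp add: polys_over_iff)
    show "tau_action Fq (a \<odot>\<^bsub>M\<^esub> m) \<in> carrier_mat 1 d"
      by (intro M_carrier_mat M_tau_closed M_smult_closed that)
    show "frob_poly a \<odot>\<^bsub>M\<^esub> tau_action Fq m \<in> carrier_mat 1 d"
      by (intro M_carrier_mat M_tau_closed M_smult_closed that a)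
    show "mat_row (tau_action Fq (a \<odot>\<^bsub>M\<^esub> m)) 0 = mat_row (frob_poly a \<odot>\<^bsub>M\<^esub> tau_action Fq m) 0"
      by (simp only: mat_row_tau[OF M_smult_closed[OF that]] mat_row_smult[OF that(2)]
          mat_row_smult[OF M_tau_closed[OF that(2)]] mat_row_tau[OF that(2)] t_act_tau)
  qed
  have add: "tau_action Fq (m + n) = tau_action Fq m + tau_action Fq n"
    if "m \<in> carrier M" "n \<in> carrier M" for m n
  proof (rule mat_row_inj)
    show "tau_action Fq (m + n) \<in> carrier_mat 1 d" "tau_action Fq m + tau_action Fq n \<in> carrier_mat 1 d"
      by (intro M_carrier_mat M_tau_closed M_add_closed that)+
    show "mat_row (tau_action Fq (m + n)) 0 = mat_row (tau_action Fq m + tau_action Fq n) 0"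
      by (simp only: mat_row_tau[OF M_add_closed[OF that]] mat_row_add[OF that]
          mat_row_add[OF M_tau_closed[OF that(1)] M_tau_closed[OF that(2)]]
          mat_row_tau[OF that(1)] mat_row_tau[OF that(2)] rows.tau_add)
  qed
  have frob: "frob_poly a \<in> carrier R" if "a \<in> carrier R" for a
    using that subfield_closed(6)[OF K] by (simp add: polys_over_iff)
  have map: "tensor_tau Fq K d \<phi> Z = tensor_null R N M #>\<^bsub>tensor_free N M\<^esub> c'"
    "c' \<in> carrier (tensor_free N M)"
    unfolding tensor_tau_def c(2) c'_def
    by (rule tensor.coset_map[where s = frob_poly];
        use c M_tau_closed add smult frob in \<open>simp add: fls_twist_add fls_twist_mult fls_twist_emb\<close>)+
  show "tensor_tau Fq K d \<phi> Z \<in> carrier V"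
    using map by (auto simp: V_carrier tensor.tensor_carrier)
  have "(\<lambda>k. tensor.functional k c') = tau_fls (\<lambda>k. tensor.functional k c)"
    using c(1) unfolding c'_def tensor.free_carrier
  proof (induction rule: frag_induction)
    case zero
    show ?case
      using tau_fls_0 by (simp add: zero_fun_def)
  next
    case (one z)
    then obtain x m where z: "z = (x, m)" "m \<in> carrier M"
      by (cases z) auto
    show ?case
    proof
      fix k
      show "tensor.functional k (frag_extend (\<lambda>(x, m). frag_of (fls_twist Fq x, tau_action Fq m)) (frag_of z)) =
          tau_fls (\<lambda>k. tensor.functional k (frag_of z)) k"
        using z
        by (simp add: coord_def tau_fls_def fls_twist_mult mat_row_tau emb_t_coords_tau mat_row_in_row_space
            sum_distrib_left mult.assoc)
    qed
  next
    case (diff a b)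
    have "tau_fls (\<lambda>k. tensor.functional k (a - b)) =
        tau_fls ((\<lambda>k. tensor.functional k a) - (\<lambda>k. tensor.functional k b))"
      by (simp add: tensor.functional_diff fun_diff_def)
    then show ?case
      unfolding tau_fls_diff diff[symmetric]
      by (simp add: frag_extend_diff tensor.functional_diff fun_diff_def)
  qed
  moreover have "Psi (tensor_tau Fq K d \<phi> Z) = (\<lambda>k. tensor.functional k c')"
    unfolding map(1) by (rule Psi_coset[OF map(2)])
  moreover have "Psi Z = (\<lambda>k. tensor.functional k c)"
    unfolding c(2) by (rule Psi_coset[OF c(1)])
  ultimately show "Psi (tensor_tau Fq K d \<phi> Z) = tau_fls (Psi Z)"
    by simp
qed

lemma Psi_surj:
  assumes "y \<in> fls_rows r"
  shows "\<exists>Z\<in>carrier V. Psi Z = y"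
proof -
  define c where "c = (\<Sum>l<r. frag_of (y l, row_matrix d (g l)))"
  have c: "c \<in> carrier (tensor_free N M)"
  proof -
    have "c \<in> {c. Poly_Mapping.keys c \<subseteq> carrier N \<times> carrier M}"
      unfolding c_def
    proof (rule sum_in_closed)
      show "a + b \<in> {c. Poly_Mapping.keys c \<subseteq> carrier N \<times> carrier M}"
        if "a \<in> {c. Poly_Mapping.keys c \<subseteq> carrier N \<times> carrier M}"
          "b \<in> {c. Poly_Mapping.keys c \<subseteq> carrier N \<times> carrier M}" for a b
        using that Poly_Mapping.keys_add[of a b] by auto
    qed (use row_matrix_in g in auto)
    then show ?thesis
      by (simp add: tensor.free_carrier)
  qed
  have "tensor.functional k c = y k" for k
  proof (cases "k < r")
    case True
    have "tensor.functional k c = (\<Sum>l<r. if l = k then y l else 0)"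
      unfolding c_def tensor.functional_sum
    proof (rule sum.cong[OF refl])
      fix l assume "l \<in> {..<r}"
      then show "tensor.functional k (frag_of (y l, row_matrix d (g l))) = (if l = k then y l else 0)"
        using True g_in t_coords_eq_p[OF g True] p_g by (auto simp: coord_def mat_row_row_matrix)
    qed
    then show ?thesis
      using True by simp
  next
    case False
    then show ?thesis
      using functional_in[of c] assms by (simp add: fls_rows_def)
  qed
  then have "Psi (tensor_null R N M #>\<^bsub>tensor_free N M\<^esub> c) = y"
    using Psi_coset[OF c] by simp
  moreover have "tensor_null R N M #>\<^bsub>tensor_free N M\<^esub> c \<in> carrier V"
    using c by (auto simp: V_carrier tensor.tensor_carrier)
  ultimately show ?thesis
    by blast
qed

lemma Psi_finsum:
  assumes "finite B" "B \<subseteq> carrier V"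
  shows "Psi (finsum V (\<lambda>b. f b \<odot>\<^bsub>V\<^esub> b) B) = (\<lambda>k. \<Sum>b\<in>B. f b * Psi b k)"
proof
  fix k
  have "tensor.quotient_functional k (finsum V (\<lambda>b. f b \<odot>\<^bsub>V\<^esub> b) B) =
      (\<Sum>b\<in>B. tensor.quotient_functional k (f b \<odot>\<^bsub>V\<^esub> b))"
    using tensor.finsum_quotient_functional[OF V_carrier V_zero V_add assms(1), of "\<lambda>b. f b \<odot>\<^bsub>V\<^esub> b" k]
      Psi_smult(1) assms(2) V_carrier by blast
  also have "\<dots> = (\<Sum>b\<in>B. f b * Psi b k)"
  proof (rule sum.cong[OF refl])
    fix b assume "b \<in> B"
    then show "tensor.quotient_functional k (f b \<odot>\<^bsub>V\<^esub> b) = f b * Psi b k"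
      using fun_cong[OF Psi_smult(2)[of b "f b"], of k] assms(2) by (auto simp: Psi_def fls_mul_def)
  qed
  finally show "Psi (finsum V (\<lambda>b. f b \<odot>\<^bsub>V\<^esub> b) B) k = (\<Sum>b\<in>B. f b * Psi b k)"
    by (simp add: Psi_def)
qed

lemma Psi_finsum_closed:
  assumes "finite B" "B \<subseteq> carrier V"
  shows "finsum V (\<lambda>b. f b \<odot>\<^bsub>V\<^esub> b) B \<in> carrier V"
  using tensor.finsum_quotient_functional[OF V_carrier V_zero V_add assms(1), of "\<lambda>b. f b \<odot>\<^bsub>V\<^esub> b"]
    Psi_smult(1) assms(2) V_carrier by blast

end

section \<open>The filtration defined by a lattice\<close>

text \<open>
  The Laurent series in \<open>1/t\<close> of degree at most \<open>n\<close> in \<open>t\<close>, that is, \<open>t\<^sup>n\<close> times the power series.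
\<close>

definition pole_le :: "int \<Rightarrow> 'a::zero fls set"
  where "pole_le n = {f. \<forall>i < - n. fls_nth f i = 0}"

definition t_power :: "int \<Rightarrow> 'a::{zero,one} fls"
  where "t_power n = fls_shift n 1"

lemma t_power_mult: "t_power n * f = fls_shift n (f :: 'a::comm_ring_1 fls)"
  unfolding t_power_def using fls_shifted_times_simps(2)[of n 1 f] by simp

lemma t_power_add: "t_power m * (t_power n :: 'a::comm_ring_1 fls) = t_power (m + n)"
  unfolding t_power_mult by (simp add: t_power_def add.commute)

lemma t_power_0 [simp]: "t_power 0 = 1"
  by (simp add: t_power_def)

lemma t_power_of_nat: "t_power (int n) = fls_X_inv ^ n"
  by (simp add: t_power_def fls_X_inv_power_conv_shift_1)

lemma pole_le_t_power: "t_power m * f \<in> pole_le (n + m) \<longleftrightarrow> (f :: 'a::comm_ring_1 fls) \<in> pole_le n"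
proof -
  have "(\<forall>i < - (n + m). fls_nth f (i + m) = 0) \<longleftrightarrow> (\<forall>i < - n. fls_nth f i = 0)"
  proof (intro iffI allI impI)
    fix i assume "\<forall>i < - (n + m). fls_nth f (i + m) = 0" "i < - n"
    then have "fls_nth f ((i - m) + m) = 0"
      by (metis add_diff_cancel_right' diff_strict_right_mono minus_add_distrib uminus_add_conv_diff
          add.commute diff_conv_add_uminus)
    then show "fls_nth f i = 0"
      by simp
  qed auto
  then show ?thesis
    by (simp add: pole_le_def t_power_mult)
qed

lemma pole_le_0: "range fps_to_fls = (pole_le 0 :: 'a::zero fls set)"
proof (intro equalityI subsetI)
  fix f :: "'a fls" assume "f \<in> pole_le 0"
  then have "fps_to_fls (fls_regpart f) = f"
    by (intro fls_eqI) (auto simp: pole_le_def)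
  then show "f \<in> range fps_to_fls"
    by (metis rangeI)
qed (auto simp: pole_le_def)

lemma pole_le_mono: "m \<le> n \<Longrightarrow> pole_le m \<subseteq> pole_le n"
  by (auto simp: pole_le_def)

lemma pole_le_add: "f \<in> pole_le n \<Longrightarrow> g \<in> pole_le n \<Longrightarrow> f + g \<in> (pole_le n :: 'a::comm_ring_1 fls set)"
  by (auto simp: pole_le_def)

lemma pole_le_0_mem: "0 \<in> pole_le n"
  by (auto simp: pole_le_def)

lemma pole_le_const: "f \<in> pole_le n \<Longrightarrow> fls_const c * f \<in> (pole_le n :: 'a::comm_ring_1 fls set)"
  by (auto simp: pole_le_def)

lemma pole_le_mult:
  assumes "f \<in> pole_le m" "g \<in> pole_le n"
  shows "f * g \<in> (pole_le (m + n) :: 'a::field fls set)"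
proof (cases "f = 0 \<or> g = 0")
  case True
  then show ?thesis
    by (auto simp: pole_le_0_mem)
next
  case False
  then have "fls_subdegree f \<ge> - m" "fls_subdegree g \<ge> - n"
    using assms nth_fls_subdegree_nonzero[of f] nth_fls_subdegree_nonzero[of g]
    unfolding pole_le_def by (force simp: not_less[symmetric])+
  then show ?thesis
    using fls_times_nth_eq0[of _ f g] by (auto simp: pole_le_def)
qed

lemma pole_le_ex: "\<exists>n. f \<in> pole_le (int n)"
proof -
  have "f \<in> pole_le (int (nat (- fls_subdegree f)))"
    by (auto simp: pole_le_def)
  then show ?thesis ..
qed

lemma fls_mul_assoc: "fls_mul f (fls_mul g y) = fls_mul (f * g) y"
  by (simp add: fls_mul_def mult.assoc)

lemma fls_mul_1 [simp]: "fls_mul 1 y = y"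
  by (simp add: fls_mul_def)

lemma (in frobenius_field) fls_twist_t_power: "fls_twist Fq (t_power n) = t_power n"
  by (intro fls_eqI) (simp add: t_power_def)

context t_motive_of
begin

lemma tau_fls_pow_mul:
  "(tau_fls ^^ n) (fls_mul (t_power k) y) = fls_mul (t_power k) ((tau_fls ^^ n) y)"
proof (induction n)
  case (Suc n)
  show ?case
    unfolding funpow.simps comp_apply Suc.IH tau_fls_mul fls_twist_t_power ..
qed (simp only: funpow.simps id_apply)

lemma tau_fls_pow_in: "y \<in> fls_rows r \<Longrightarrow> (tau_fls ^^ n) y \<in> fls_rows r"
  by (cases n) (simp_all only: funpow.simps id_apply comp_apply tau_fls_in)

text \<open>
  Preimages of the unit vectors form a left inverse of the matrix of \<open>\<tau>\<close>. A left inverse of a square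
  matrix is a right inverse, and the Frobenius twist is injective.
\<close>

lemma tau_fls_inj:
  assumes surj: "\<And>y. y \<in> fls_rows r \<Longrightarrow> \<exists>z\<in>fls_rows r. tau_fls z = y"
    and y: "y \<in> fls_rows r" "tau_fls y = 0"
  shows "y = 0"
proof -
  define u :: "nat \<Rightarrow> nat \<Rightarrow> 'a fls" where "u k l = (if l = k \<and> k < r then 1 else 0)" for k l
  have "u k \<in> fls_rows r" for k
    by (auto simp: u_def fls_rows_def)
  then have "\<forall>k. \<exists>z. tau_fls z = u k"
    using surj by blast
  from choice[OF this] obtain z where z: "\<And>k. tau_fls (z k) = u k"
    by blast
  define A1 where "A1 = mat r r (\<lambda>(k, l). fls_twist Fq (z k l))"
  define A2 where "A2 = mat r r (\<lambda>(l, k). emb (t_coords (row_tau (g l)) k))"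
  have c: "A1 \<in> carrier_mat r r" "A2 \<in> carrier_mat r r"
    by (simp_all add: A1_def A2_def)
  have tau: "tau_fls y k = (\<Sum>l<r. fls_twist Fq (y l) * A2 $$ (l, k))" if "k < r" for y k
    using that by (simp add: tau_fls_def A2_def)
  have "A1 * A2 = 1\<^sub>m r"
  proof (rule eq_matI)
    fix k l assume "k < dim_row (1\<^sub>m r :: 'a fls mat)" "l < dim_col (1\<^sub>m r :: 'a fls mat)"
    then have kl: "k < r" "l < r"
      by simp_all
    have "(A1 * A2) $$ (k, l) = (\<Sum>j<r. A1 $$ (k, j) * A2 $$ (j, l))"
      using kl c by (simp add: scalar_prod_def atLeast0LessThan)
    also have "\<dots> = tau_fls (z k) l"
      using kl by (simp add: tau A1_def)
    finally show "(A1 * A2) $$ (k, l) = 1\<^sub>m r $$ (k, l)"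
      using kl by (auto simp: z u_def)
  qed (use c in auto)
  then have inv: "A2 * A1 = 1\<^sub>m r"
    by (rule mat_mult_left_right_inverse[OF c])
  have "y m = 0" if m: "m < r" for m
  proof -
    have "0 = (\<Sum>k<r. tau_fls y k * A1 $$ (k, m))"
      unfolding y(2) by simp
    also have "\<dots> = (\<Sum>k<r. \<Sum>l<r. fls_twist Fq (y l) * (A2 $$ (l, k) * A1 $$ (k, m)))"
      by (intro sum.cong) (simp_all add: tau sum_distrib_right mult.assoc)
    also have "\<dots> = (\<Sum>l<r. fls_twist Fq (y l) * (\<Sum>k<r. A2 $$ (l, k) * A1 $$ (k, m)))"
      by (subst sum.swap) (simp add: sum_distrib_left)
    also have "\<dots> = (\<Sum>l<r. fls_twist Fq (y l) * (A2 * A1) $$ (l, m))"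
      using c m by (intro sum.cong) (simp_all add: scalar_prod_def atLeast0LessThan)
    also have "\<dots> = (\<Sum>l<r. if l = m then fls_twist Fq (y l) else 0)"
      unfolding inv using m by (intro sum.cong) auto
    also have "\<dots> = fls_twist Fq (y m)"
      using m by simp
    finally show ?thesis
      using fls_twist_eq_0 by metis
  qed
  then show ?thesis
    using y(1) by (auto simp: fls_rows_def fun_eq_iff not_less[symmetric])
qed

lemma coordinates_in: "coordinates x \<in> fls_rows r"
  by (simp add: coordinates_def fls_rows_def)

lemma coordinates_tau: "x \<in> row_space d \<Longrightarrow> coordinates (row_tau x) = tau_fls (coordinates x)"
  by (auto simp: coordinates_def tau_fls_def fun_eq_iff emb_t_coords_tau intro!: sum.cong)

lemma coordinates_mul_pow:
  "x \<in> row_space d \<Longrightarrow>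
    coordinates (((\<lambda>y. row_mul y A) ^^ n) x) = fls_mul (t_power (int n)) (coordinates x)"
  by (auto simp: coordinates_def fls_mul_def fun_eq_iff t_coords_mul_pow emb_mult emb_monom t_power_of_nat)

lemma coordinates_tau_pow:
  assumes "x \<in> row_space d"
  shows "coordinates ((row_tau ^^ n) x) = (tau_fls ^^ n) (coordinates x) \<and> (row_tau ^^ n) x \<in> row_space d"
proof (induction n)
  case (Suc n)
  then show ?case
    unfolding funpow.simps comp_apply using coordinates_tau[of "(row_tau ^^ n) x"] row_tau_in[of "(row_tau ^^ n) x" d]
    by presburger
qed (use assms in \<open>simp only: funpow.simps id_apply simp_thms\<close>)

lemma coordinates_add: "coordinates (x + y) = coordinates x + coordinates y"
  by (auto simp: coordinates_def t_coords_add emb_add fun_eq_iff)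

lemma coordinates_scale: "coordinates (row_scale c x) = fls_mul (fls_const c) (coordinates x)"
  by (auto simp: coordinates_def t_coords_scale emb_smult fls_mul_def fun_eq_iff)

text \<open>
  Write \<open>Lat n\<close> for \<open>t\<^sup>n \<Lambda>\<close> in coordinates. From \<open>t\<^sup>u \<Lambda> = \<tau>\<^sup>v \<Lambda>\<close> it follows that \<open>\<tau>\<^sup>v\<close> is onto, hence \<open>\<tau>\<close> is
  bijective, and \<open>\<tau>\<^sup>v y \<in> Lat (n + u)\<close> is equivalent to \<open>y \<in> Lat n\<close>. The condition that defines \<open>F i\<close> is
  therefore periodic in \<open>j\<close> with period \<open>v\<close>, so that \<open>\<tau>\<close> shifts the filtration by exactly one. An element
  of \<open>F i\<close> has polynomial coordinates of bounded degree, so \<open>F i\<close> is finite-dimensional, and \<open>i0\<close> shifts the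
  index so that the bound is negative at \<open>F 0\<close>.
\<close>

theorem filtration_of_pure:
  assumes pure: "pure_t_module Fq K d \<phi>"
  obtains u v :: nat and F :: "nat \<Rightarrow> (nat \<Rightarrow> 'a poly) set" where "0 < u" "0 < v" "F 0 = {0}"
    "\<And>a b Aa. 0 < b \<Longrightarrow> a * v = b * u \<Longrightarrow>
      (\<And>x. x \<in> row_space d \<Longrightarrow> row_mul x Aa = ((\<lambda>y. row_mul y A) ^^ a) x) \<Longrightarrow>
      tau_filtration row_scale (card Fq) row_tau (\<lambda>x. row_mul x Aa) b (row_space d) F"
proof -
  obtain u v \<Lambda> where uv: "0 < u" "0 < v" and lat: "power_series_lattice V \<Lambda>"
    and eq: "(\<lambda>x. fls_X_inv ^ u \<odot>\<^bsub>V\<^esub> x) ` \<Lambda> = (tensor_tau Fq K d \<phi> ^^ v) ` \<Lambda>"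
    using conjunct2[OF pure[unfolded pure_t_module_def]] by (elim exE conjE) (rule that)
  obtain B where B: "module_basis ring_of_type_algebra V B"
    and \<Lambda>: "\<Lambda> = {finsum V (\<lambda>b. c b \<odot>\<^bsub>V\<^esub> b) B | c. c \<in> B \<rightarrow> range fps_to_fls}"
    using lat unfolding power_series_lattice_def by blast
  have fB: "finite B" and BV: "B \<subseteq> carrier V"
    and Bspan: "\<And>Z. Z \<in> carrier V \<Longrightarrow> \<exists>c. Z = finsum V (\<lambda>b. c b \<odot>\<^bsub>V\<^esub> b) B"
    using B unfolding module_basis_def by blast+
  define comb where "comb c = (\<lambda>k. \<Sum>b\<in>B. c b * Psi b k)" for c
  have comb: "Psi (finsum V (\<lambda>b. c b \<odot>\<^bsub>V\<^esub> b) B) = comb c" for c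
    unfolding comb_def by (rule Psi_finsum[OF fB BV])
  have \<Lambda>V: "Z \<in> carrier V" if "Z \<in> \<Lambda>" for Z
    using that Psi_finsum_closed[OF fB BV] unfolding \<Lambda> by blast
  have comb_in: "comb c \<in> fls_rows r" for c
    using Psi_in[OF Psi_finsum_closed[OF fB BV, of c]] unfolding comb .
  have comb_ex: "\<exists>c. y = comb c" if y: "y \<in> fls_rows r" for y
  proof -
    obtain Z where Z: "Z \<in> carrier V" "Psi Z = y"
      using Psi_surj[OF y] by blast
    obtain c where "Z = finsum V (\<lambda>b. c b \<odot>\<^bsub>V\<^esub> b) B"
      using Bspan[OF Z(1)] by blast
    then show ?thesis
      using comb[of c] Z(2) by (intro exI[of _ c]) simp
  qed
  have comb_mul: "comb (\<lambda>b. f * c b) = fls_mul f (comb c)" for f c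
    by (simp add: comb_def fls_mul_def sum_distrib_left mult.assoc)
  define Lat where "Lat n = {comb c | c. \<forall>b\<in>B. c b \<in> pole_le n}" for n :: int
  have Lat_in: "y \<in> fls_rows r" if "y \<in> Lat n" for y n
    using that comb_in by (auto simp: Lat_def)
  have Lat_mul: "fls_mul (t_power m) y \<in> Lat (n + m) \<longleftrightarrow> y \<in> Lat n" for m n y
  proof
    assume "y \<in> Lat n"
    then obtain c where c: "y = comb c" "\<forall>b\<in>B. c b \<in> pole_le n"
      by (auto simp: Lat_def)
    then show "fls_mul (t_power m) y \<in> Lat (n + m)"
      unfolding Lat_def c(1) comb_mul[symmetric] using pole_le_t_power by blast
  next
    assume "fls_mul (t_power m) y \<in> Lat (n + m)"
    then obtain c where c: "fls_mul (t_power m) y = comb c" "\<forall>b\<in>B. c b \<in> pole_le (n + m)"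
      by (auto simp: Lat_def)
    have "y = fls_mul (t_power (- m)) (fls_mul (t_power m) y)"
      by (simp add: fls_mul_assoc t_power_add)
    also have "\<dots> = comb (\<lambda>b. t_power (- m) * c b)"
      unfolding c(1) comb_mul ..
    finally show "y \<in> Lat n"
      unfolding Lat_def using c(2) pole_le_t_power[of "- m" _ "n + m"] by auto
  qed
  have Lat_mono: "Lat m \<subseteq> Lat n" if "m \<le> n" for m n
    using pole_le_mono[OF that] unfolding Lat_def by blast
  have Lat_0: "0 \<in> Lat n" for n
    unfolding Lat_def using pole_le_0_mem
    by (intro CollectI exI[of _ "\<lambda>_. 0"]) (auto simp: comb_def fun_eq_iff)
  have Lat_add: "x + y \<in> Lat n" if "x \<in> Lat n" "y \<in> Lat n" for x y n
  proof -
    from that(1) obtain c where c: "x = comb c" "\<forall>b\<in>B. c b \<in> pole_le n"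
      by (auto simp: Lat_def)
    from \<open>y \<in> Lat n\<close> obtain c' where c': "y = comb c'" "\<forall>b\<in>B. c' b \<in> pole_le n"
      by (auto simp: Lat_def)
    have "x + y = comb (\<lambda>b. c b + c' b)"
      unfolding c c' by (simp add: comb_def fun_eq_iff distrib_right sum.distrib)
    then show ?thesis
      unfolding Lat_def using c c' pole_le_add by blast
  qed
  have Lat_const: "fls_mul (fls_const e) x \<in> Lat n" if "x \<in> Lat n" for x n e
  proof -
    from that obtain c where c: "x = comb c" "\<forall>b\<in>B. c b \<in> pole_le n"
      by (auto simp: Lat_def)
    then show ?thesis
      unfolding Lat_def c(1) comb_mul[symmetric] using pole_le_const by blast
  qed
  have Lat_ex: "\<exists>n. y \<in> Lat (int n)" if y: "y \<in> fls_rows r" for y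
  proof -
    obtain c where c: "y = comb c"
      using comb_ex[OF y] by blast
    have "\<forall>b. \<exists>N. c b \<in> pole_le (int N)"
      using pole_le_ex by blast
    from choice[OF this] obtain N where N: "\<And>b. c b \<in> pole_le (int (N b))"
      by blast
    have "c b \<in> pole_le (int (\<Sum>b\<in>B. N b))" if "b \<in> B" for b
    proof -
      have "N b \<le> (\<Sum>b\<in>B. N b)"
        using that fB by (intro member_le_sum) auto
      then show ?thesis
        using subsetD[OF pole_le_mono N[of b]] by (simp only: of_nat_le_iff)
    qed
    then show ?thesis
      unfolding c Lat_def by blast
  qed
  have Psi_\<Lambda>: "Psi ` \<Lambda> = Lat 0"
  proof (intro equalityI subsetI)
    fix y assume "y \<in> Psi ` \<Lambda>"
    then obtain c where "y = comb c" "c \<in> B \<rightarrow> range fps_to_fls"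
      unfolding \<Lambda> by (auto simp: comb)
    then show "y \<in> Lat 0"
      unfolding Lat_def pole_le_0[symmetric] by blast
  next
    fix y assume "y \<in> Lat 0"
    then obtain c where c: "y = comb c" "\<forall>b\<in>B. c b \<in> range fps_to_fls"
      unfolding Lat_def pole_le_0 by blast
    then have "finsum V (\<lambda>b. c b \<odot>\<^bsub>V\<^esub> b) B \<in> \<Lambda>"
      unfolding \<Lambda> by blast
    then show "y \<in> Psi ` \<Lambda>"
      unfolding c(1) comb[symmetric] by blast
  qed
  have Psi_tau_pow: "(tensor_tau Fq K d \<phi> ^^ n) Z \<in> carrier V \<and>
      Psi ((tensor_tau Fq K d \<phi> ^^ n) Z) = (tau_fls ^^ n) (Psi Z)" if "Z \<in> carrier V" for n Z
    using that
  proof (induction n)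
    case (Suc n)
    define Z' where "Z' = (tensor_tau Fq K d \<phi> ^^ n) Z"
    have Z': "Z' \<in> carrier V" "Psi Z' = (tau_fls ^^ n) (Psi Z)"
      using Suc unfolding Z'_def by blast+
    show ?case
      unfolding funpow.simps comp_apply Z'_def[symmetric] Z'(2)[symmetric]
      using Psi_tau[OF Z'(1)] by (rule conjI)
  qed (simp only: funpow.simps id_apply simp_thms)
  have "fls_mul (t_power (int u)) ` Lat 0 = (tau_fls ^^ v) ` Lat 0"
  proof -
    have "Psi ` ((\<lambda>x. fls_X_inv ^ u \<odot>\<^bsub>V\<^esub> x) ` \<Lambda>) = fls_mul (t_power (int u)) ` (Psi ` \<Lambda>)"
      unfolding image_image t_power_of_nat by (rule image_cong[OF refl]) (rule Psi_smult(2)[OF \<Lambda>V])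
    moreover have "Psi ` ((tensor_tau Fq K d \<phi> ^^ v) ` \<Lambda>) = (tau_fls ^^ v) ` (Psi ` \<Lambda>)"
      unfolding image_image using Psi_tau_pow \<Lambda>V by (intro image_cong[OF refl]) blast
    ultimately show ?thesis
      using eq unfolding Psi_\<Lambda> by metis
  qed
  moreover have "fls_mul (t_power (int u)) ` Lat 0 = Lat (int u)"
  proof (intro equalityI subsetI)
    fix y assume "y \<in> Lat (int u)"
    moreover have "y = fls_mul (t_power (int u)) (fls_mul (t_power (- int u)) y)"
      by (simp add: fls_mul_assoc t_power_add)
    ultimately show "y \<in> fls_mul (t_power (int u)) ` Lat 0"
      using Lat_mul[of "- int u" y "int u"] by force
  qed (use Lat_mul[of "int u" _ 0] in auto)
  ultimately have tau_Lat0: "(tau_fls ^^ v) ` Lat 0 = Lat (int u)"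
    by simp
  have tau_Lat: "(tau_fls ^^ v) ` Lat n = Lat (n + int u)" for n
  proof (intro equalityI subsetI)
    fix y assume "y \<in> (tau_fls ^^ v) ` Lat n"
    then obtain x where x: "x \<in> Lat n" "y = (tau_fls ^^ v) x"
      by blast
    have "fls_mul (t_power (- n)) x \<in> Lat 0"
      using Lat_mul[of "- n" x n] x(1) by simp
    then have "(tau_fls ^^ v) (fls_mul (t_power (- n)) x) \<in> Lat (int u)"
      using tau_Lat0 by blast
    then have "fls_mul (t_power (- n)) y \<in> Lat (n + int u + - n)"
      unfolding tau_fls_pow_mul x(2) by simp
    then show "y \<in> Lat (n + int u)"
      unfolding Lat_mul .
  next
    fix y assume "y \<in> Lat (n + int u)"
    then have "fls_mul (t_power (- n)) y \<in> Lat (int u)"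
      using Lat_mul[of "- n" y "n + int u"] by simp
    then obtain x where x: "x \<in> Lat 0" "fls_mul (t_power (- n)) y = (tau_fls ^^ v) x"
      using tau_Lat0 by blast
    have "y = fls_mul (t_power n) (fls_mul (t_power (- n)) y)"
      by (simp add: fls_mul_assoc t_power_add)
    also have "\<dots> = (tau_fls ^^ v) (fls_mul (t_power n) x)"
      unfolding x(2) tau_fls_pow_mul ..
    finally show "y \<in> (tau_fls ^^ v) ` Lat n"
      using Lat_mul[of n x 0] x(1) by auto
  qed
  have tau_surj: "\<exists>z\<in>fls_rows r. tau_fls z = y" if y: "y \<in> fls_rows r" for y
  proof -
    obtain n where "y \<in> Lat (int n)"
      using Lat_ex[OF y] by blast
    then have "y \<in> (tau_fls ^^ v) ` Lat (int n - int u)"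
      unfolding tau_Lat by simp
    then obtain x where x: "x \<in> Lat (int n - int u)" "y = (tau_fls ^^ v) x"
      by blast
    obtain v' where v': "v = Suc v'"
      using uv(2) by (cases v) auto
    have "y = tau_fls ((tau_fls ^^ v') x)"
      unfolding x(2) v' funpow.simps comp_apply ..
    then show ?thesis
      using tau_fls_pow_in[OF Lat_in[OF x(1)]] by blast
  qed
  note tau_inj = tau_fls_inj[OF tau_surj]
  have tau_pow_inj: "y = 0" if "y \<in> fls_rows r" "(tau_fls ^^ n) y = 0" for n y
    using that
  proof (induction n)
    case (Suc n)
    have "tau_fls ((tau_fls ^^ n) y) = 0"
      using Suc.prems(2) unfolding funpow.simps comp_apply .
    then have "(tau_fls ^^ n) y = 0"
      using tau_inj tau_fls_pow_in[OF Suc.prems(1)] by blast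
    then show ?case
      using Suc.IH Suc.prems(1) by blast
  qed (simp only: funpow.simps id_apply)
  have tau_pow_diff: "(tau_fls ^^ n) (x - y) = (tau_fls ^^ n) x - (tau_fls ^^ n) y" for n x y
  proof (induction n)
    case (Suc n)
    show ?case
      unfolding funpow.simps comp_apply Suc.IH tau_fls_diff ..
  qed (simp only: funpow.simps id_apply)
  have fls_rows_diff: "x - y \<in> fls_rows r" if "x \<in> fls_rows r" "y \<in> fls_rows r" for x y :: "nat \<Rightarrow> 'a fls"
    using that by (simp add: fls_rows_def)
  have Lat_tau: "(tau_fls ^^ v) y \<in> Lat (n + int u) \<longleftrightarrow> y \<in> Lat n" if y: "y \<in> fls_rows r" for y n
  proof
    assume "(tau_fls ^^ v) y \<in> Lat (n + int u)"
    then obtain x where x: "x \<in> Lat n" "(tau_fls ^^ v) y = (tau_fls ^^ v) x"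
      unfolding tau_Lat[symmetric] by blast
    then have "(tau_fls ^^ v) (y - x) = 0"
      unfolding tau_pow_diff by simp
    then have "y - x = 0"
      using tau_pow_inj fls_rows_diff[OF y Lat_in[OF x(1)]] by blast
    then show "y \<in> Lat n"
      using x(1) by simp
  qed (use tau_Lat in blast)
  have Lat_tau_mult: "(tau_fls ^^ (v * j)) y \<in> Lat (n + int (u * j))" if "y \<in> Lat n" for y n j
  proof (induction j)
    case (Suc j)
    have "(tau_fls ^^ (v * Suc j)) y = (tau_fls ^^ v) ((tau_fls ^^ (v * j)) y)"
      by (simp only: mult_Suc_right funpow_add comp_apply)
    also have "\<dots> \<in> Lat (n + int (u * j) + int u)"
      using Suc.IH tau_Lat by blast
    finally show ?case
      by (simp add: algebra_simps)
  qed (use that in \<open>simp only: mult_0_right funpow.simps id_apply of_nat_0 add_0_right\<close>)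
  obtain N0 where N0: "\<And>y n k. y \<in> Lat n \<Longrightarrow> y k \<in> pole_le (n + int N0)"
  proof -
    have "\<forall>b k. \<exists>N. Psi b k \<in> pole_le (int N)"
      using pole_le_ex by blast
    then have "\<forall>z. \<exists>N. Psi (fst z) (snd z) \<in> pole_le (int N)"
      by blast
    from choice[OF this] obtain N' where N': "\<And>z. Psi (fst z) (snd z) \<in> pole_le (int (N' z))"
      by blast
    define N where "N b k = N' (b, k)" for b k
    have N: "Psi b k \<in> pole_le (int (N b k))" for b k
      using N'[of "(b, k)"] by (simp add: N_def)
    define N0 where "N0 = (\<Sum>b\<in>B. \<Sum>k<r. N b k)"
    have Psi_N0: "Psi b k \<in> pole_le (int N0)" if b: "b \<in> B" for b k
    proof (cases "k < r")
      case True
      have "N b k \<le> (\<Sum>k<r. N b k)"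
        using True by (intro member_le_sum) auto
      also have "\<dots> \<le> N0"
        unfolding N0_def using b fB by (intro member_le_sum) auto
      finally show ?thesis
        using subsetD[OF pole_le_mono N[of b k]] by (simp only: of_nat_le_iff)
    next
      case False
      then have "Psi b k = 0"
        using Psi_in[of b] b BV by (auto simp: fls_rows_def)
      then show ?thesis
        by (simp add: pole_le_0_mem)
    qed
    have "y k \<in> pole_le (n + int N0)" if y: "y \<in> Lat n" for y n k
    proof -
      obtain c where c: "y = comb c" "\<forall>b\<in>B. c b \<in> pole_le n"
        using y by (auto simp: Lat_def)
      show ?thesis
        unfolding c(1) comb_def
        by (intro sum_in_closed pole_le_0_mem pole_le_add pole_le_mult) (use c(2) Psi_N0 in auto)
    qed
    then show thesis
      by (rule that)
  qed
  define i0 where "i0 = int (v * Suc N0)"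
  define F where "F i = {x \<in> row_space d. \<forall>j. coordinates ((row_tau ^^ j) x) \<in>
      Lat ((int u * (int i - i0 + int j)) div int v)}" for i
  have F_bound: "Polynomial.degree (t_coords x k) \<le> n \<or> k \<ge> r"
    if x: "x \<in> F i" and n: "(int u * (int i - i0)) div int v + int N0 \<le> int n" for x i k n
  proof (cases "k < r")
    case True
    have "coordinates ((row_tau ^^ 0) x) \<in> Lat ((int u * (int i - i0 + int 0)) div int v)"
      using x unfolding F_def by blast
    then have "coordinates x \<in> Lat ((int u * (int i - i0)) div int v)"
      by (simp only: funpow.simps id_apply of_nat_0 add_0_right)
    then have "emb (t_coords x k) \<in> pole_le (int n)"
      using N0[of "coordinates x" _ k] True pole_le_mono[OF n] by (auto simp: coordinates_def)
    then have "poly.coeff (t_coords x k) j = 0" if "j > n" for j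
      using that spec[of "\<lambda>i. i < - int n \<longrightarrow> fls_nth (emb (t_coords x k)) i = 0" "- int j"]
      by (simp add: pole_le_def emb_nth)
    then show ?thesis
      by (metis degree_le not_le)
  qed simp
  have F_0: "F 0 = {0}"
  proof -
    have "x = 0" if x: "x \<in> F 0" for x
    proof -
      have "coordinates ((row_tau ^^ 0) x) \<in> Lat ((int u * (int 0 - i0 + int 0)) div int v)"
        using x unfolding F_def by blast
      then have "coordinates x \<in> Lat ((int u * (- i0)) div int v)"
        by (simp only: funpow.simps id_apply of_nat_0 add_0_right diff_0)
      also have "(int u * (- i0)) div int v = - (int u * int (Suc N0))"
      proof -
        have "int u * (- i0) = (- (int u * int (Suc N0))) * int v"
          by (simp add: i0_def algebra_simps)
        then show ?thesis
          using uv(2) by (metis nonzero_mult_div_cancel_right of_nat_0_eq_iff less_irrefl)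
      qed
      finally have *: "coordinates x k \<in> pole_le (- (int u * int (Suc N0)) + int N0)" for k
        using N0 by blast
      have "- t + int n \<le> - 1" if "int (Suc n) \<le> t" for t n
        using that by simp
      moreover have "int (Suc N0) \<le> int u * int (Suc N0)"
        using uv(1) by (simp add: mult_le_cancel_right1)
      ultimately have "- (int u * int (Suc N0)) + int N0 \<le> -1"
        by blast
      then have "coordinates x k \<in> pole_le (-1)" for k
        using * pole_le_mono by blast
      then have "emb (t_coords x k) \<in> pole_le (-1)" if "k < r" for k
        using that by (metis coordinates_def)
      then have "t_coords x k = 0" if "k < r" for k
      proof (intro poly_eqI)
        fix j
        show "poly.coeff (t_coords x k) j = poly.coeff 0 j"
          using \<open>\<And>k. k < r \<Longrightarrow> emb (t_coords x k) \<in> pole_le (-1)\<close>[OF that] emb_nth[of "t_coords x k" "- int j"]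
          by (simp add: pole_le_def)
      qed
      then have "(\<Sum>l<r. t_act A (t_coords x l) (g l)) = 0"
        by simp
      moreover have "x \<in> row_space d"
        using x by (simp add: F_def)
      ultimately show "x = 0"
        using sum_t_coords by metis
    qed
    moreover have "0 \<in> F 0"
    proof -
      have "coordinates 0 = 0"
        by (auto simp: coordinates_def fun_eq_iff)
      then show ?thesis
        unfolding F_def using rows.subspace_0[OF subspace_row_space] Lat_0 rows.tau_pow_0 by simp
    qed
    ultimately show ?thesis
      by blast
  qed
  have filt: "tau_filtration row_scale (card Fq) row_tau (\<lambda>x. row_mul x Aa) b (row_space d) F"
    if b: "0 < b" and abuv: "a * v = b * u"
      and Aa: "\<And>x. x \<in> row_space d \<Longrightarrow> row_mul x Aa = ((\<lambda>y. row_mul y A) ^^ a) x" for a b Aa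
  proof unfold_locales
    fix i
    show "rows.subspace (F i)"
    proof (rule rows.subspaceI)
      have "coordinates 0 = 0"
        by (auto simp: coordinates_def fun_eq_iff)
      then show "0 \<in> F i"
        unfolding F_def using rows.subspace_0[OF subspace_row_space] Lat_0 rows.tau_pow_0 by simp
      show "x + y \<in> F i" if "x \<in> F i" "y \<in> F i" for x y
        using that rows.subspace_add[OF subspace_row_space] Lat_add
        unfolding F_def by (simp only: rows.tau_pow_add coordinates_add mem_Collect_eq) blast
      show "row_scale c x \<in> F i" if "x \<in> F i" for c x
        using that rows.subspace_scale[OF subspace_row_space] Lat_const
        unfolding F_def by (simp only: rows.tau_pow_scale coordinates_scale mem_Collect_eq) blast
    qed
    show "F i \<subseteq> F (Suc i)"
    proof -
      have "(int u * (int i - i0 + int j)) div int v \<le> (int u * (int (Suc i) - i0 + int j)) div int v" for j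
        using uv by (intro zdiv_mono1 mult_left_mono) auto
      then show ?thesis
        unfolding F_def using Lat_mono by blast
    qed
    show "\<exists>S. finite S \<and> F i \<subseteq> rows.span S"
    proof -
      define n where "n = nat ((int u * (int i - i0)) div int v + int N0)"
      define S where "S = (\<lambda>(l, j). ((\<lambda>y. row_mul y A) ^^ j) (g l)) ` ({..<r} \<times> {..n})"
      have "x \<in> rows.span S" if x: "x \<in> F i" for x
      proof -
        have "x \<in> row_space d"
          using x by (simp add: F_def)
        then have "x = (\<Sum>l<r. t_act A (t_coords x l) (g l))"
          using sum_t_coords by simp
        also have "\<dots> = (\<Sum>l<r. \<Sum>j\<le>n. row_scale (poly.coeff (t_coords x l) j) (((\<lambda>y. row_mul y A) ^^ j) (g l)))"
        proof (rule sum.cong[OF refl])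
          fix l assume "l \<in> {..<r}"
          moreover have "(int u * (int i - i0)) div int v + int N0 \<le> int n"
            by (simp add: n_def)
          ultimately have "Polynomial.degree (t_coords x l) \<le> n"
            using F_bound[OF x] by force
          then show "t_act A (t_coords x l) (g l) =
              (\<Sum>j\<le>n. row_scale (poly.coeff (t_coords x l) j) (((\<lambda>y. row_mul y A) ^^ j) (g l)))"
            unfolding t_act_def by (rule rows.lincomb_eq)
        qed
        also have "\<dots> \<in> rows.span S"
          by (intro rows.span_sum rows.span_scale rows.span_base) (auto simp: S_def)
        finally show ?thesis .
      qed
      then show ?thesis
        by (intro exI[of _ S]) (auto simp: S_def)
    qed
    fix x :: "nat \<Rightarrow> 'a poly" assume x: "x \<in> row_space d"
    show "row_tau x \<in> F (Suc i) \<longleftrightarrow> x \<in> F i"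
    proof -
      define Q where "Q j \<longleftrightarrow> coordinates ((row_tau ^^ j) x) \<in> Lat ((int u * (int i - i0 + int j)) div int v)" for j
      have Q0: "Q 0" if "Q v"
      proof -
        have "(int u * (int i - i0 + int v)) div int v = (int u * (int i - i0)) div int v + int u"
          using uv(2) div_mult_self2[of "int v" "int u * (int i - i0)" "int u"]
          by (simp add: distrib_left mult.commute)
        then have "(tau_fls ^^ v) (coordinates x) \<in> Lat ((int u * (int i - i0)) div int v + int u)"
          using that coordinates_tau_pow[OF x, of v] unfolding Q_def by simp
        then show ?thesis
          unfolding Q_def Lat_tau[OF coordinates_in] by (simp only: funpow.simps id_apply of_nat_0 add_0_right)
      qed
      have "row_tau x \<in> F (Suc i) \<longleftrightarrow> (\<forall>j. Q (Suc j))"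
      proof -
        have 1: "(row_tau ^^ j) (row_tau x) = (row_tau ^^ Suc j) x" for j
          by (simp only: funpow_Suc_right comp_apply)
        have 2: "int (Suc i) - i0 + int j = int i - i0 + int (Suc j)" for j
          by simp
        have "coordinates ((row_tau ^^ j) (row_tau x)) \<in>
            Lat ((int u * (int (Suc i) - i0 + int j)) div int v) \<longleftrightarrow> Q (Suc j)" for j
          unfolding Q_def 1 2 ..
        then show ?thesis
          unfolding F_def using row_tau_in[OF x] by blast
      qed
      also have "\<dots> \<longleftrightarrow> (\<forall>j. Q j)"
        using Q0 uv(2) by (metis not0_implies_Suc less_irrefl)
      also have "\<dots> \<longleftrightarrow> x \<in> F i"
        using x by (simp add: F_def Q_def)
      finally show ?thesis .
    qed
    show "row_mul x Aa \<in> F (i + b) \<longleftrightarrow> x \<in> F i"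
    proof -
      have "coordinates ((row_tau ^^ j) (row_mul x Aa)) \<in> Lat ((int u * (int (i + b) - i0 + int j)) div int v) \<longleftrightarrow>
        coordinates ((row_tau ^^ j) x) \<in> Lat ((int u * (int i - i0 + int j)) div int v)" for j
      proof -
        have "coordinates ((row_tau ^^ j) (row_mul x Aa)) =
            (tau_fls ^^ j) (fls_mul (t_power (int a)) (coordinates x))"
          using coordinates_tau_pow[of "row_mul x Aa" j] row_mul_pow_in[OF carrier_matD(2)[OF A] x, of a]
          unfolding Aa[OF x] coordinates_mul_pow[OF x, symmetric] by blast
        also have "\<dots> = fls_mul (t_power (int a)) (coordinates ((row_tau ^^ j) x))"
          using coordinates_tau_pow[OF x, of j] by (simp add: tau_fls_pow_mul)
        finally have 1: "coordinates ((row_tau ^^ j) (row_mul x Aa)) =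
            fls_mul (t_power (int a)) (coordinates ((row_tau ^^ j) x))" .
        have "int u * (int (i + b) - i0 + int j) = int u * (int i - i0 + int j) + int (b * u)"
          by (simp add: algebra_simps)
        then have "int u * (int (i + b) - i0 + int j) = int u * (int i - i0 + int j) + int a * int v"
          unfolding abuv[symmetric] by simp
        then have "(int u * (int (i + b) - i0 + int j)) div int v =
            (int u * (int i - i0 + int j)) div int v + int a"
          using uv(2) by simp
        then show ?thesis
          unfolding 1 by (simp only: Lat_mul)
      qed
      moreover have "row_mul x Aa \<in> row_space d"
        unfolding Aa[OF x] by (rule row_mul_pow_in[OF carrier_matD(2)[OF A] x])
      ultimately show ?thesis
        unfolding F_def using x by simp
    qed
  next
    show "(\<Union>i. F i) = row_space d"
    proof (intro equalityI subsetI)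
      fix x :: "nat \<Rightarrow> 'a poly" assume x: "x \<in> row_space d"
      have "\<forall>j. \<exists>n. coordinates ((row_tau ^^ j) x) \<in> Lat (int n)"
        using Lat_ex coordinates_in by blast
      from choice[OF this] obtain N where N: "\<And>j. coordinates ((row_tau ^^ j) x) \<in> Lat (int (N j))"
        by blast
      define n where "n = (\<Sum>j<v. N j)"
      define i where "i = v * Suc N0 + v * n"
      have "coordinates ((row_tau ^^ j) x) \<in> Lat ((int u * (int i - i0 + int j)) div int v)" for j
      proof -
        define s where "s = j mod v"
        define k where "k = j div v"
        have j: "j = v * k + s"
          by (simp add: s_def k_def)
        have "s < v"
          using uv(2) by (simp add: s_def)
        then have "N s \<le> n"
          unfolding n_def by (intro member_le_sum) auto
        have "coordinates ((row_tau ^^ j) x) = (tau_fls ^^ (v * k)) (coordinates ((row_tau ^^ s) x))"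
          using coordinates_tau_pow[OF x, of j] coordinates_tau_pow[OF x, of s]
          unfolding j by (simp add: funpow_add)
        also have "\<dots> \<in> Lat (int (N s) + int (u * k))"
          by (rule Lat_tau_mult[OF N])
        also have "Lat (int (N s) + int (u * k)) \<subseteq> Lat ((int u * (int i - i0 + int j)) div int v)"
        proof (rule Lat_mono)
          have "int (N s) + int (u * k) \<le> int u * (int n + int k)"
          proof -
            have "int (N s) \<le> int u * int n"
              using \<open>N s \<le> n\<close> uv(1)
              by (metis (mono_tags, opaque_lifting) One_nat_def Suc_leI le_trans mult_le_mono1 nat_mult_1 of_nat_le_iff of_nat_mult)
            then show ?thesis
              by (simp add: distrib_left)
          qed
          also have "\<dots> = (int u * (int v * (int n + int k))) div int v"
            using uv(2) by simp
          also have "\<dots> \<le> (int u * (int i - i0 + int j)) div int v"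
            using uv by (intro zdiv_mono1 mult_left_mono) (auto simp: i_def i0_def j algebra_simps)
          finally show "int (N s) + int (u * k) \<le> (int u * (int i - i0 + int j)) div int v" .
        qed
        finally show ?thesis .
      qed
      then show "x \<in> (\<Union>i. F i)"
        using x unfolding F_def by blast
    qed (auto simp: F_def)
  qed (use b in \<open>auto simp: row_mul_add row_mul_scale row_mul_tau\<close>)
  show thesis
  proof (rule that[of u v F, OF uv F_0])
    fix a b :: nat and Aa
    assume "0 < b" "a * v = b * u" "\<And>x. x \<in> row_space d \<Longrightarrow> row_mul x Aa = ((\<lambda>y. row_mul y A) ^^ a) x"
    then show "tau_filtration row_scale (card Fq) row_tau (\<lambda>x. row_mul x Aa) b (row_space d) F"
      by (rule filt)
  qed
qed

end

section \<open>Bases of the associated module\<close>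

context t_matrix_of
begin

lemma M_abelian_monoid: "abelian_monoid M"
proof (rule abelian_monoidI)
  show "\<zero>\<^bsub>M\<^esub> \<in> carrier M"
    using polys_over_closed(1)[OF K] by (simp add: M_carrier mats_over_iff) (simp add: assoc_module_def)
  show "x \<oplus>\<^bsub>M\<^esub> y \<in> carrier M" if "x \<in> carrier M" "y \<in> carrier M" for x y
    using M_add_closed[OF that] by simp
  show "x \<oplus>\<^bsub>M\<^esub> y \<oplus>\<^bsub>M\<^esub> z = x \<oplus>\<^bsub>M\<^esub> (y \<oplus>\<^bsub>M\<^esub> z)"
    if "x \<in> carrier M" "y \<in> carrier M" "z \<in> carrier M" for x y z
    using that[THEN M_carrier_mat] by simp
  show "x \<oplus>\<^bsub>M\<^esub> y = y \<oplus>\<^bsub>M\<^esub> x" if "x \<in> carrier M" "y \<in> carrier M" for x y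
    using comm_add_mat[OF that[THEN M_carrier_mat]] by simp
  show "\<zero>\<^bsub>M\<^esub> \<oplus>\<^bsub>M\<^esub> x = x" if "x \<in> carrier M" for x
    using M_carrier_mat[OF that] by (simp add: assoc_module_def)
qed

lemma mat_row_finsum:
  assumes "finite B" "B \<subseteq> carrier M" "\<And>b. b \<in> B \<Longrightarrow> c b \<in> polys_over K"
  shows "finsum M (\<lambda>b. c b \<odot>\<^bsub>M\<^esub> b) B \<in> carrier M \<and>
    mat_row (finsum M (\<lambda>b. c b \<odot>\<^bsub>M\<^esub> b) B) 0 k = (\<Sum>b\<in>B. t_act A (c b) (mat_row b 0) k)"
proof -
  interpret M: abelian_monoid M
    by (rule M_abelian_monoid)
  show ?thesis
    using assms
  proof (induction B rule: finite_induct)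
    case empty
    show ?case
      by (simp add: M.zero_closed) (simp add: assoc_module_def mat_row_def)
  next
    case (insert b B)
    have b: "c b \<odot>\<^bsub>M\<^esub> b \<in> carrier M"
      using insert.prems by (intro M_smult_closed) auto
    have IH: "finsum M (\<lambda>b. c b \<odot>\<^bsub>M\<^esub> b) B \<in> carrier M"
      "mat_row (finsum M (\<lambda>b. c b \<odot>\<^bsub>M\<^esub> b) B) 0 k = (\<Sum>b\<in>B. t_act A (c b) (mat_row b 0) k)"
      using insert by blast+
    have "(\<lambda>b. c b \<odot>\<^bsub>M\<^esub> b) \<in> B \<rightarrow> carrier M"
      using insert.prems M_smult_closed by blast
    then have eq: "finsum M (\<lambda>b. c b \<odot>\<^bsub>M\<^esub> b) (insert b B) =
        c b \<odot>\<^bsub>M\<^esub> b + finsum M (\<lambda>b. c b \<odot>\<^bsub>M\<^esub> b) B"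
      using M.finsum_insert[of B b "\<lambda>b. c b \<odot>\<^bsub>M\<^esub> b"] insert.hyps b by simp
    have "b \<in> carrier M"
      using insert.prems by simp
    then show ?case
      unfolding eq using M_add_closed[OF b IH(1)] insert.hyps
      by (simp add: mat_row_add[OF b IH(1)] mat_row_smult IH(2))
  qed
qed

lemma motive_of_basis:
  assumes "module_basis R M B" and "card B = r"
  obtains g p where "t_motive_of Fq K d A r g p \<phi>"
proof -
  have fB: "finite B" and BM: "B \<subseteq> carrier M"
    and ex1: "\<And>m. m \<in> carrier M \<Longrightarrow> \<exists>!c. c \<in> B \<rightarrow>\<^sub>E carrier R \<and> m = finsum M (\<lambda>b. c b \<odot>\<^bsub>M\<^esub> b) B"
    using assms(1) unfolding module_basis_def by blast+
  obtain e where e: "bij_betw e {..<r} B"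
    using ex_bij_betw_nat_finite[OF fB] assms(2) by (auto simp: atLeast0LessThan)
  define g where "g l = mat_row (e l) 0" for l
  have sum_e: "mat_row (finsum M (\<lambda>b. c b \<odot>\<^bsub>M\<^esub> b) B) 0 = (\<Sum>l<r. t_act A (c (e l)) (g l))"
    if "\<And>b. b \<in> B \<Longrightarrow> c b \<in> polys_over K" for c
  proof
    fix k
    show "mat_row (finsum M (\<lambda>b. c b \<odot>\<^bsub>M\<^esub> b) B) 0 k = (\<Sum>l<r. t_act A (c (e l)) (g l)) k"
      using mat_row_finsum[of B c k, OF fB BM that]
        sum.reindex_bij_betw[OF e, of "\<lambda>b. t_act A (c b) (mat_row b 0) k"]
      by (simp add: sum_fun_apply g_def)
  qed
  have ex: "\<exists>c. (\<forall>b\<in>B. c b \<in> polys_over K) \<and> x = (\<Sum>l<r. t_act A (c (e l)) (g l))"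
    if x: "x \<in> rows_over K d" for x
  proof -
    obtain c where c: "c \<in> B \<rightarrow>\<^sub>E carrier R" "row_matrix d x = finsum M (\<lambda>b. c b \<odot>\<^bsub>M\<^esub> b) B"
      using ex1[OF row_matrix_in[OF x]] by blast
    have cK: "c b \<in> polys_over K" if "b \<in> B" for b
      using c(1) that by auto
    have "x = mat_row (row_matrix d x) 0"
      using x by (intro mat_row_row_matrix[symmetric]) (simp add: rows_over_def)
    also have "\<dots> = (\<Sum>l<r. t_act A (c (e l)) (g l))"
      unfolding c(2) by (rule sum_e) (rule cK)
    finally show ?thesis
      using cK by (intro exI[of _ c]) simp
  qed
  have "\<forall>x. \<exists>c. x \<in> rows_over K d \<longrightarrow> (\<forall>b\<in>B. c b \<in> polys_over K) \<and> x = (\<Sum>l<r. t_act A (c (e l)) (g l))"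
    using ex by blast
  from choice[OF this] obtain c where c: "\<And>x. x \<in> rows_over K d \<Longrightarrow> (\<forall>b\<in>B. c x b \<in> polys_over K)"
    "\<And>x. x \<in> rows_over K d \<Longrightarrow> x = (\<Sum>l<r. t_act A (c x (e l)) (g l))"
    by blast
  define p where "p x l = (if l < r then c x (e l) else 0)" for x l
  have eB: "e l \<in> B" if "l < r" for l
    using e that by (auto simp: bij_betw_def)
  have "t_motive_of Fq K d A r g p \<phi>"
  proof unfold_locales
    show "g l \<in> rows_over K d" if "l < r" for l
      unfolding g_def using mat_row_M eB[OF that] BM by blast
    show "p x l \<in> polys_over K" if "x \<in> rows_over K d" for x l
      using c(1)[OF that] eB polys_over_closed(1)[OF K] by (simp add: p_def)
    show "x = (\<Sum>l<r. t_act A (p x l) (g l))" if "x \<in> rows_over K d" for x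
      using c(2)[OF that] by (simp add: p_def)
    show "\<forall>l<r. f l = 0" if f: "\<And>l. f l \<in> polys_over K" "(\<Sum>l<r. t_act A (f l) (g l)) = 0" for f
    proof -
      define c1 where "c1 = (\<lambda>b\<in>B. f (inv_into {..<r} e b))"
      define c0 where "c0 = (\<lambda>b\<in>B. 0 :: 'a poly)"
      have c1e: "c1 (e l) = f l" if "l < r" for l
        using that e eB[OF that] by (simp add: c1_def bij_betw_def inv_into_f_f)
      have c1: "c1 \<in> B \<rightarrow>\<^sub>E carrier R" and c0: "c0 \<in> B \<rightarrow>\<^sub>E carrier R"
        using f(1) polys_over_closed(1)[OF K] by (auto simp: c1_def c0_def)
      have cK: "c1 b \<in> polys_over K" "c0 b \<in> polys_over K" if "b \<in> B" for b
        using c1 c0 that by auto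
      define m1 where "m1 = finsum M (\<lambda>b. c1 b \<odot>\<^bsub>M\<^esub> b) B"
      define m0 where "m0 = finsum M (\<lambda>b. c0 b \<odot>\<^bsub>M\<^esub> b) B"
      have m: "m1 \<in> carrier M" "m0 \<in> carrier M"
        unfolding m1_def m0_def using mat_row_finsum[of B c1, OF fB BM cK(1)] mat_row_finsum[of B c0, OF fB BM cK(2)] by blast+
      have s1: "mat_row m1 0 = (\<Sum>l<r. t_act A (c1 (e l)) (g l))"
        unfolding m1_def by (rule sum_e) (rule cK(1))
      have s0: "mat_row m0 0 = (\<Sum>l<r. t_act A (c0 (e l)) (g l))"
        unfolding m0_def by (rule sum_e) (rule cK(2))
      have "mat_row m1 0 = (\<Sum>l<r. t_act A (f l) (g l))"
        unfolding s1 by (intro sum.cong) (simp_all add: c1e)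
      moreover have "mat_row m0 0 = (\<Sum>l<r. t_act A 0 (g l))"
        unfolding s0 by (intro sum.cong) (simp_all add: c0_def eB)
      ultimately have "mat_row m1 0 = mat_row m0 0"
        unfolding f(2) by simp
      then have "m1 = m0"
        using m[THEN M_carrier_mat] by (intro mat_row_inj)
      then have "c1 = c0"
        using ex1[OF m(1)] c1 c0 unfolding m1_def m0_def by blast
      then show ?thesis
        using c1e eB by (metis c0_def restrict_apply')
    qed
  qed
  then show thesis
    by (rule that)
qed

end

section \<open>Conjugation of t-modules\<close>

lemma finite_extension_containing:
  fixes K :: "'a::field set"
  assumes "algebraic_closure \<AA> K" and "finite S"
  obtains L where "finite_extension_field K L" and "S \<subseteq> L"
proof -
  interpret algebraic_closure "\<AA> :: 'a ring" K
    by fact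
  have K: "subfield K \<AA>"
    by (rule subfield_axioms)
  obtain xs where xs: "set xs = S"
    using finite_list[OF assms(2)] by blast
  have car: "set xs \<subseteq> carrier \<AA>"
    by (simp add: ring_of_type_algebra_def)
  have alg: "(algebraic over K) x" if "x \<in> set xs" for x
    using algebraic_extension car that by blast
  have "subfield (finite_extension K xs) \<AA>" "finite_dimension K (finite_extension K xs)"
    using finite_extension_is_subfield[OF K car alg] finite_extension_finite_dimension(1)[OF K car alg] by blast+
  moreover have "K \<subseteq> finite_extension K xs"
    by (rule finite_extension_incl[OF subfieldE(3)[OF K] car])
  moreover have "S \<subseteq> finite_extension K xs"
    using finite_extension_mem[OF subfieldE(1)[OF K] car] xs by simp
  ultimately show thesis
    using that[of "finite_extension K xs"] by (simp add: finite_extension_field_def)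
qed

context frobenius_field
begin

lemma mats_over_mult:
  assumes "subfield L \<AA>" "A \<in> mats_over (polys_over L) d d" "B \<in> mats_over (polys_over L) d d"
  shows "skew_mat_mult Fq A B \<in> mats_over (polys_over L) d d"
  using assms(2,3)
  by (auto simp: mats_over_iff skew_mat_mult_def
      intro!: sum_in_closed polys_over_closed[OF assms(1)] skew_mult_closed[OF assms(1)])

lemma skew_mat_mult_add_left:
  "A \<in> carrier_mat d d \<Longrightarrow> B \<in> carrier_mat d d \<Longrightarrow> C \<in> carrier_mat d d \<Longrightarrow>
    skew_mat_mult Fq (A + B) C = skew_mat_mult Fq A C + skew_mat_mult Fq B C"
  by (rule eq_matI) (auto simp: skew_mat_mult_def skew_mult_add_left sum.distrib)

lemma skew_mat_mult_add_right:
  "A \<in> carrier_mat d d \<Longrightarrow> B \<in> carrier_mat d d \<Longrightarrow> C \<in> carrier_mat d d \<Longrightarrow>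
    skew_mat_mult Fq C (A + B) = skew_mat_mult Fq C A + skew_mat_mult Fq C B"
  by (rule eq_matI) (auto simp: skew_mat_mult_def skew_mult_add_right sum.distrib)

lemma Fq_pow_pow: "c \<in> Fq \<Longrightarrow> c ^ (q ^ n) = c"
  by (induction n) (simp_all add: power_mult Fq_pow mult.commute[of q])

lemma skew_mult_smult_right:
  assumes "c \<in> Fq"
  shows "skew_mult Fq f (Polynomial.smult c g) = Polynomial.smult c (skew_mult Fq f g)"
  by (rule poly_eqI)
    (simp add: coeff_skew_mult power_mult_distrib Fq_pow_pow[OF assms] sum_distrib_left algebra_simps)

lemma skew_mat_mult_smult:
  assumes "c \<in> Fq" "A \<in> carrier_mat d d" "B \<in> carrier_mat d d"
  shows "skew_mat_mult Fq A (map_mat (Polynomial.smult c) B) =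
      map_mat (Polynomial.smult c) (skew_mat_mult Fq A B)"
    "skew_mat_mult Fq (map_mat (Polynomial.smult c) A) B =
      map_mat (Polynomial.smult c) (skew_mat_mult Fq A B)"
  using assms
  by (auto intro!: eq_matI simp: skew_mat_mult_def skew_mult_smult_right skew_mult_smult_left
      poly.scale_sum_right)

lemma tau_coeff_0_mult:
  "A \<in> carrier_mat d d \<Longrightarrow> B \<in> carrier_mat d d \<Longrightarrow>
    tau_coeff 0 (skew_mat_mult Fq A B) = tau_coeff 0 A * tau_coeff 0 B"
  by (rule eq_matI)
    (auto simp: tau_coeff_def skew_mat_mult_def coeff_sum coeff_skew_mult scalar_prod_def atLeast0LessThan
      intro!: sum.cong)

lemma tau_coeff_0_one: "tau_coeff 0 (1\<^sub>m d :: 'a poly mat) = 1\<^sub>m d"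
  by (rule eq_matI) (auto simp: tau_coeff_def)

lemma t_module_hom:
  assumes "t_module Fq F \<theta> d \<phi>"
  shows "\<And>a. a \<in> polys_over Fq \<Longrightarrow> \<phi> a \<in> mats_over (polys_over F) d d"
    "\<And>a b. a \<in> polys_over Fq \<Longrightarrow> b \<in> polys_over Fq \<Longrightarrow> \<phi> (a * b) = skew_mat_mult Fq (\<phi> a) (\<phi> b)"
    "\<And>a b. a \<in> polys_over Fq \<Longrightarrow> b \<in> polys_over Fq \<Longrightarrow> \<phi> (a + b) = \<phi> a + \<phi> b"
    "\<phi> 1 = 1\<^sub>m d"
proof -
  have hom: "\<phi> \<in> Ring.ring_hom (poly_ring_over Fq) (skew_matrix_ring Fq F d)"
    using assms unfolding t_module_def by blast
  show "\<phi> a \<in> mats_over (polys_over F) d d" if "a \<in> polys_over Fq" for a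
    using ring_hom_closed[OF hom, of a] that by (simp add: poly_ring_over_def skew_matrix_ring_def)
  show "\<phi> (a * b) = skew_mat_mult Fq (\<phi> a) (\<phi> b)" if "a \<in> polys_over Fq" "b \<in> polys_over Fq" for a b
    using ring_hom_mult[OF hom, of a b] that
    by (simp add: poly_ring_over_def skew_matrix_ring_def ring_of_type_algebra_def)
  show "\<phi> (a + b) = \<phi> a + \<phi> b" if "a \<in> polys_over Fq" "b \<in> polys_over Fq" for a b
    using ring_hom_add[OF hom, of a b] that
    by (simp add: poly_ring_over_def skew_matrix_ring_def ring_of_type_algebra_def)
  show "\<phi> 1 = 1\<^sub>m d"
    using ring_hom_one[OF hom]
    by (simp add: poly_ring_over_def skew_matrix_ring_def ring_of_type_algebra_def)
qed

lemma t_in: "Polynomial.monom 1 n \<in> polys_over Fq"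
  using polys_over_closed(8)[OF subfield_Fq subfield_closed(2)[OF subfield_Fq]] .

lemma row_mul_t_power:
  assumes "t_module Fq F \<theta> d \<phi>" and "x \<in> row_space d"
  shows "row_mul x (\<phi> (Polynomial.monom 1 n)) = ((\<lambda>y. row_mul y (\<phi> (Polynomial.monom 1 1))) ^^ n) x"
proof (induction n)
  case 0
  have "\<phi> (Polynomial.monom 1 0) = 1\<^sub>m d"
    using t_module_hom(4)[OF assms(1)] by (simp add: monom_0 one_pCons)
  then show ?case
    using row_mul_one[OF assms(2)] by (simp only: funpow.simps id_apply)
next
  case (Suc n)
  have "Polynomial.monom 1 (Suc n) = Polynomial.monom 1 n * (Polynomial.monom 1 1 :: 'a poly)"
    by (simp add: mult_monom)
  then have "\<phi> (Polynomial.monom 1 (Suc n)) =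
      skew_mat_mult Fq (\<phi> (Polynomial.monom 1 n)) (\<phi> (Polynomial.monom 1 1))"
    using t_module_hom(2)[OF assms(1) t_in t_in] by metis
  moreover have "\<phi> (Polynomial.monom 1 n) \<in> carrier_mat d d" "\<phi> (Polynomial.monom 1 1) \<in> carrier_mat d d"
    using t_module_hom(1)[OF assms(1) t_in] by (simp_all add: mats_over_iff)
  ultimately show ?case
    unfolding funpow.simps comp_apply Suc.IH[symmetric] by (simp add: row_mul_mult)
qed

text \<open>
  Conjugation by an invertible matrix over \<open>L\<close> preserves all conditions on a t-module: scalars from
  the finite field are central in the skew polynomial ring, and the constant coefficients of
  \<open>\<phi>\<^sub>t - \<theta>\<close> are conjugated by the constant coefficients of \<open>U\<close>.
\<close>

lemma t_module_conjugate:
  assumes \<phi>: "t_module Fq K \<theta> d \<phi>" and L: "subfield L \<AA>" "K \<subseteq> L"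
    and U: "U \<in> mats_over (polys_over L) d d" "U' \<in> mats_over (polys_over L) d d"
      "skew_mat_mult Fq U U' = 1\<^sub>m d" "skew_mat_mult Fq U' U = 1\<^sub>m d"
  defines "\<psi> \<equiv> \<lambda>a. skew_mat_mult Fq (skew_mat_mult Fq U (\<phi> a)) U'"
  shows "t_module Fq L \<theta> d \<psi>" "t_module_isomorphic Fq L d \<phi> \<psi>"
proof -
  have Uc: "U \<in> carrier_mat d d" "U' \<in> carrier_mat d d"
    using U by (auto simp: mats_over_iff)
  have \<phi>L: "\<phi> a \<in> mats_over (polys_over L) d d" if "a \<in> polys_over Fq" for a
  proof -
    have "polys_over K \<subseteq> polys_over L"
      using L(2) by (auto simp: polys_over_def)
    then show ?thesis
      using t_module_hom(1)[OF \<phi> that] by (auto simp: mats_over_iff)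
  qed
  have \<phi>c: "\<phi> a \<in> carrier_mat d d" if "a \<in> polys_over Fq" for a
    using \<phi>L[OF that] by (simp add: mats_over_iff)
  have \<psi>L: "\<psi> a \<in> mats_over (polys_over L) d d" if "a \<in> polys_over Fq" for a
    unfolding \<psi>_def by (intro mats_over_mult[OF L(1)] U \<phi>L that)
  have \<psi>c: "\<psi> a \<in> carrier_mat d d" if "a \<in> polys_over Fq" for a
    using \<psi>L[OF that] by (simp add: mats_over_iff)
  have \<psi>U: "skew_mat_mult Fq (\<psi> a) U = skew_mat_mult Fq U (\<phi> a)" if "a \<in> polys_over Fq" for a
  proof -
    have "skew_mat_mult Fq U (\<phi> a) \<in> carrier_mat d d"
      using Uc \<phi>c[OF that] by (intro skew_mat_mult_carrier)
    then show ?thesis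
      unfolding \<psi>_def using Uc U(4) by (simp add: skew_mat_mult_assoc[of _ d])
  qed
  have \<psi>_mult: "\<psi> (a * b) = skew_mat_mult Fq (\<psi> a) (\<psi> b)" if ab: "a \<in> polys_over Fq" "b \<in> polys_over Fq" for a b
  proof -
    have c: "skew_mat_mult Fq U (\<phi> a) \<in> carrier_mat d d" "skew_mat_mult Fq U (\<phi> b) \<in> carrier_mat d d"
      using Uc \<phi>c ab by (intro skew_mat_mult_carrier; blast)+
    have "skew_mat_mult Fq (\<psi> a) (\<psi> b) = skew_mat_mult Fq (skew_mat_mult Fq (\<psi> a) (skew_mat_mult Fq U (\<phi> b))) U'"
      unfolding \<psi>_def[of] using skew_mat_mult_assoc[OF \<psi>c[OF ab(1)] c(2) Uc(2)] by (simp add: \<psi>_def)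
    also have "skew_mat_mult Fq (\<psi> a) (skew_mat_mult Fq U (\<phi> b)) =
        skew_mat_mult Fq (skew_mat_mult Fq (\<psi> a) U) (\<phi> b)"
      using skew_mat_mult_assoc[OF \<psi>c[OF ab(1)] Uc(1) \<phi>c[OF ab(2)]] by simp
    also have "\<dots> = skew_mat_mult Fq U (\<phi> (a * b))"
      unfolding \<psi>U[OF ab(1)] t_module_hom(2)[OF \<phi> ab]
      using skew_mat_mult_assoc[OF Uc(1) \<phi>c[OF ab(1)] \<phi>c[OF ab(2)]] by simp
    finally show ?thesis
      by (simp add: \<psi>_def)
  qed
  have \<psi>_add: "\<psi> (a + b) = \<psi> a + \<psi> b" if ab: "a \<in> polys_over Fq" "b \<in> polys_over Fq" for a b
    unfolding \<psi>_def t_module_hom(3)[OF \<phi> ab] skew_mat_mult_add_right[OF \<phi>c[OF ab(1)] \<phi>c[OF ab(2)] Uc(1)]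
    using Uc \<phi>c ab by (intro skew_mat_mult_add_left skew_mat_mult_carrier)
  have \<psi>_one: "\<psi> 1 = 1\<^sub>m d"
    unfolding \<psi>_def t_module_hom(4)[OF \<phi>] using Uc U(3) by simp
  have \<psi>_smult: "\<psi> (Polynomial.smult c a) = map_mat (Polynomial.smult c) (\<psi> a)"
    if c: "c \<in> Fq" and a: "a \<in> polys_over Fq" for c a
  proof -
    have "\<phi> (Polynomial.smult c a) = map_mat (Polynomial.smult c) (\<phi> a)"
      using \<phi> c a unfolding t_module_def by blast
    then show ?thesis
      unfolding \<psi>_def using Uc \<phi>c[OF a]
      by (simp add: skew_mat_mult_smult[OF c, of _ d])
  qed
  have nil: "\<exists>k. (tau_coeff 0 (\<psi> (Polynomial.monom 1 1)) - \<theta> \<cdot>\<^sub>m 1\<^sub>m d) ^\<^sub>m k = 0\<^sub>m d d"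
  proof -
    obtain k where k: "(tau_coeff 0 (\<phi> (Polynomial.monom 1 1)) - \<theta> \<cdot>\<^sub>m 1\<^sub>m d) ^\<^sub>m k = 0\<^sub>m d d"
      using \<phi> unfolding t_module_def by blast
    define N where "N = tau_coeff 0 (\<phi> (Polynomial.monom 1 1)) - \<theta> \<cdot>\<^sub>m 1\<^sub>m d"
    define N' where "N' = tau_coeff 0 (\<psi> (Polynomial.monom 1 1)) - \<theta> \<cdot>\<^sub>m 1\<^sub>m d"
    define V where "V = tau_coeff 0 U"
    define V' where "V' = tau_coeff 0 U'"
    have tc: "tau_coeff 0 A \<in> carrier_mat d d" if "A \<in> carrier_mat d d" for A :: "'a poly mat"
      using that by (simp add: tau_coeff_def)
    have c: "V \<in> carrier_mat d d" "V' \<in> carrier_mat d d" "N \<in> carrier_mat d d" "N' \<in> carrier_mat d d"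
      using tc Uc \<phi>c[OF t_in] \<psi>c[OF t_in] by (auto simp: V_def V'_def N_def N'_def intro!: minus_carrier_mat)
    have VV': "V * V' = 1\<^sub>m d" "V' * V = 1\<^sub>m d"
      using tau_coeff_0_mult[OF Uc(1,2)] tau_coeff_0_mult[OF Uc(2,1)] U(3,4) tau_coeff_0_one
      by (simp_all add: V_def V'_def)
    define T where "T = tau_coeff 0 (\<phi> (Polynomial.monom 1 1))"
    have T: "T \<in> carrier_mat d d"
      unfolding T_def by (rule tc[OF \<phi>c[OF t_in]])
    have "tau_coeff 0 (\<psi> (Polynomial.monom 1 1)) = V * T * V'"
      unfolding \<psi>_def V_def V'_def T_def
      using tau_coeff_0_mult[OF skew_mat_mult_carrier[OF Uc(1) \<phi>c[OF t_in]] Uc(2)]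
        tau_coeff_0_mult[OF Uc(1) \<phi>c[OF t_in]] by metis
    moreover have "V * (\<theta> \<cdot>\<^sub>m 1\<^sub>m d) * V' = \<theta> \<cdot>\<^sub>m 1\<^sub>m d"
    proof -
      have "V * (\<theta> \<cdot>\<^sub>m 1\<^sub>m d) = \<theta> \<cdot>\<^sub>m V"
        using mult_smult_distrib[OF c(1) one_carrier_mat, of \<theta>] right_mult_one_mat[OF c(1)] by simp
      then show ?thesis
        using mult_smult_assoc_mat[OF c(1,2), of \<theta>] VV'(1) by simp
    qed
    moreover have "V * (T - \<theta> \<cdot>\<^sub>m 1\<^sub>m d) * V' = V * T * V' - V * (\<theta> \<cdot>\<^sub>m 1\<^sub>m d) * V'"
    proof -
      have I: "\<theta> \<cdot>\<^sub>m 1\<^sub>m d \<in> carrier_mat d d"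
        by simp
      show ?thesis
        unfolding mult_minus_distrib_mat[OF c(1) T I]
        by (rule minus_mult_distrib_mat[OF mult_carrier_mat[OF c(1) T] mult_carrier_mat[OF c(1) I] c(2)])
    qed
    ultimately have N': "N' = V * N * V'"
      by (simp add: N'_def N_def T_def)
    have "similar_mat_wit N' N V V'"
      unfolding similar_mat_wit_def Let_def using c VV' N' by simp
    then have "N' ^\<^sub>m k = V * (N ^\<^sub>m k) * V'"
      using similar_mat_wit_pow[of N' N V V' k] c by (simp add: similar_mat_wit_def Let_def)
    also have "\<dots> = 0\<^sub>m d d"
      using k c unfolding N_def[symmetric] by simp
    finally show ?thesis
      unfolding N'_def by blast
  qed
  have hom: "\<psi> \<in> Ring.ring_hom (poly_ring_over Fq) (skew_matrix_ring Fq L d)"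
    using \<psi>L \<psi>_mult \<psi>_add \<psi>_one
    by (intro ring_hom_memI) (simp_all add: poly_ring_over_def skew_matrix_ring_def ring_of_type_algebra_def)
  have "\<theta> \<in> L" "d > 0"
    using \<phi> L(2) unfolding t_module_def by blast+
  then show "t_module Fq L \<theta> d \<psi>"
    unfolding t_module_def using hom \<psi>_smult nil by blast
  have "U \<in> Units (skew_matrix_ring Fq L d)"
    unfolding Units_def using U by (auto simp: skew_matrix_ring_def)
  then show "t_module_isomorphic Fq L d \<phi> \<psi>"
    unfolding t_module_isomorphic_def using \<psi>U by metis
qed

end

section \<open>Pure t-modules\<close>

context frobenius_field
begin

lemma invertible_leading_coeff_iff:
  "invertible_leading_coeff L d A \<longleftrightarrow>
    (\<exists>s C. tau_coeff s A \<noteq> 0\<^sub>m d d \<and> (\<forall>j>s. tau_coeff j A = 0\<^sub>m d d) \<and>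
      tau_coeff s A \<in> mats_over L d d \<and> C \<in> mats_over L d d \<and>
      tau_coeff s A * C = 1\<^sub>m d \<and> C * tau_coeff s A = 1\<^sub>m d)"
  unfolding invertible_leading_coeff_def Units_def matrix_ring_over_def by auto

end

locale pure_t_motive = t_motive_of Fq K d A r g p \<phi>
  for Fq :: "'a::alg_closed_field set" and K d A r g p \<phi> +
  fixes \<theta> :: 'a
  assumes t_module: "t_module Fq K \<theta> d \<phi>" and pure: "pure_t_module Fq K d \<phi>"
    and closure: "algebraic_closure \<AA> K"
begin

lemma row_mul_t: "x \<in> row_space d \<Longrightarrow>
    row_mul x (\<phi> (Polynomial.monom 1 n)) = ((\<lambda>y. row_mul y A) ^^ n) x"
  using row_mul_t_power[OF t_module, of x n] unfolding \<phi> .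

lemma d_pos: "0 < d"
  using t_module unfolding t_module_def by blast

lemma t_carrier: "\<phi> (Polynomial.monom 1 n) \<in> carrier_mat d d"
  using t_module_hom(1)[OF t_module t_in, of n] by (simp add: mats_over_iff)

text \<open>
  Counting the dimension of \<open>M / t M\<close>, where \<open>t\<close> acts on the side of \<open>\<psi>\<close> by a matrix of degree \<open>s\<close> with
  invertible leading coefficient.
\<close>

lemma strictly_pure_rank:
  assumes \<psi>: "t_module Fq L \<theta> d \<psi>" and L: "subfield L \<AA>"
    and iso: "t_module_isomorphic Fq L d \<phi> \<psi>" and "strictly_pure L d \<psi>"
  shows "\<exists>s. r = d * s"
proof -
  define P where "P = \<psi> (Polynomial.monom 1 1)"
  have P: "P \<in> carrier_mat d d"
    using t_module_hom(1)[OF \<psi> t_in, of 1] by (simp add: P_def mats_over_iff)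
  obtain s C where "\<forall>j>s. tau_coeff j P = 0\<^sub>m d d" "C \<in> mats_over L d d"
      "tau_coeff s P * C = 1\<^sub>m d" "C * tau_coeff s P = 1\<^sub>m d"
    using assms(4) unfolding strictly_pure_def invertible_leading_coeff_iff P_def by blast
  then have lead: "leading_invertible Fq d s P C"
    using P by unfold_locales (auto simp: mats_over_iff)
  obtain U where U: "U \<in> Units (skew_matrix_ring Fq L d)"
      "\<And>a. a \<in> polys_over Fq \<Longrightarrow> skew_mat_mult Fq U (\<phi> a) = skew_mat_mult Fq (\<psi> a) U"
    using iso unfolding t_module_isomorphic_def by blast
  then obtain U' where U': "U \<in> carrier_mat d d" "U' \<in> carrier_mat d d"
      "skew_mat_mult Fq U U' = 1\<^sub>m d" "skew_mat_mult Fq U' U = 1\<^sub>m d"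
    unfolding Units_def skew_matrix_ring_def by (auto simp: mats_over_iff)
  have "r * 1 = d * s"
  proof (rule rank_times_eq_dimension_times[OF t_basis_g A _ t_carrier lead U'])
    show "row_mul x (\<phi> (Polynomial.monom 1 1)) = ((\<lambda>y. row_mul y A) ^^ 1) x"
      if "x \<in> row_space d" for x
      by (rule row_mul_t[OF that])
    show "skew_mat_mult Fq P U = skew_mat_mult Fq U (\<phi> (Polynomial.monom 1 1))"
      unfolding P_def using U(2)[OF t_in] by simp
  qed
  then show ?thesis
    by auto
qed

text \<open>
  The two halves of the main theorem are the cases \<open>(a, b) = (u, v)\<close> and, if \<open>v = s u\<close>, \<open>(a, b) = (1, s)\<close>. The
  field \<open>L\<close> is generated by the entries of the base change matrices and of the inverse of the leading
  coefficient.
\<close>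

theorem invertible_leading_coeff_after_extension:
  obtains u v :: nat where "0 < u" "0 < v"
    "\<And>a b. 0 < b \<Longrightarrow> a * v = b * u \<Longrightarrow> r * a = d * b \<and>
      (\<exists>L \<psi>. finite_extension_field K L \<and> t_module Fq L \<theta> d \<psi> \<and>
        invertible_leading_coeff L d (\<psi> (Polynomial.monom 1 a)) \<and> t_module_isomorphic Fq L d \<phi> \<psi>)"
proof -
  obtain u v :: nat and F where uv: "0 < u" "0 < v" and F0: "F 0 = {0}"
    and filt: "\<And>a b Aa. 0 < b \<Longrightarrow> a * v = b * u \<Longrightarrow>
      (\<And>x. x \<in> row_space d \<Longrightarrow> row_mul x Aa = ((\<lambda>y. row_mul y A) ^^ a) x) \<Longrightarrow>
      tau_filtration row_scale (card Fq) row_tau (\<lambda>x. row_mul x Aa) b (row_space d) F"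
    using filtration_of_pure[OF pure] by metis
  have "r * a = d * b \<and>
      (\<exists>L \<psi>. finite_extension_field K L \<and> t_module Fq L \<theta> d \<psi> \<and>
        invertible_leading_coeff L d (\<psi> (Polynomial.monom 1 a)) \<and> t_module_isomorphic Fq L d \<phi> \<psi>)"
    if b: "0 < b" and ab: "a * v = b * u" for a b
  proof -
    define Aa where "Aa = \<phi> (Polynomial.monom 1 a)"
    have Aa: "Aa \<in> carrier_mat d d"
      unfolding Aa_def by (rule t_carrier)
    have filtr: "tau_filtration row_scale (card Fq) row_tau (\<lambda>x. row_mul x Aa) b (row_space d) F"
      by (rule filt[OF b ab]) (simp add: Aa_def row_mul_t)
    have division: "\<exists>y\<in>row_space d. x - row_tau y \<in> rows.span (unit_row ` {..<d})"
      if x: "x \<in> row_space d" for x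
    proof -
      obtain y where y: "y \<in> row_space d"
          "x = row_tau y + (\<Sum>i<d. row_scale (poly.coeff (x i) 0) (unit_row i))"
        using row_tau_division[OF x] by blast
      have "x - row_tau y = (\<Sum>i<d. row_scale (poly.coeff (x i) 0) (unit_row i))"
        using y(2) by (simp add: algebra_simps)
      also have "\<dots> \<in> rows.span (unit_row ` {..<d})"
        by (intro rows.span_sum rows.span_scale rows.span_base imageI)
      finally show ?thesis
        using y(1) by blast
    qed
    have units: "unit_row ` {..<d} \<subseteq> row_space d"
      using unit_row_in by blast
    have "\<exists>F' m. tau_filtration row_scale (card Fq) row_tau (\<lambda>x. row_mul x Aa) b (row_space d) F' \<and>
        F' m = {0} \<and> rows.stable_from F' (Suc m)"
    proof (rule rows.balanced_filtration_exists[OF filtr])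
      show "F 0 = {0}"
        by (rule F0)
      show "finite (unit_row ` {..<d} :: (nat \<Rightarrow> 'a poly) set)"
        by simp
    qed (use units division in blast)+
    then obtain F' m where F': "tau_filtration row_scale (card Fq) row_tau (\<lambda>x. row_mul x Aa) b (row_space d) F'"
        "F' m = {0}" "rows.stable_from F' (Suc m)"
      by blast
    interpret bal: balanced_filtration Fq Aa b d F' m
      by (intro balanced_filtration.intro balanced_filtration_axioms.intro frobenius_field_axioms F' Aa)
    obtain U U' C where U: "U \<in> carrier_mat d d" "U' \<in> carrier_mat d d" and C: "C \<in> carrier_mat d d"
      and UU': "skew_mat_mult Fq U U' = 1\<^sub>m d" "skew_mat_mult Fq U' U = 1\<^sub>m d"
      and lead: "\<And>j. j > b \<Longrightarrow> tau_coeff j (skew_mat_mult Fq (skew_mat_mult Fq U Aa) U') = 0\<^sub>m d d"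
      and inv: "tau_coeff b (skew_mat_mult Fq (skew_mat_mult Fq U Aa) U') * C = 1\<^sub>m d"
        "C * tau_coeff b (skew_mat_mult Fq (skew_mat_mult Fq U Aa) U') = 1\<^sub>m d"
      using bal.leading_coeff_invertible_after_base_change by blast
    define P where "P = skew_mat_mult Fq (skew_mat_mult Fq U Aa) U'"
    have UA: "skew_mat_mult Fq U Aa \<in> carrier_mat d d"
      by (rule skew_mat_mult_carrier[OF U(1) Aa])
    have P: "P \<in> carrier_mat d d"
      unfolding P_def by (rule skew_mat_mult_carrier[OF UA U(2)])
    have PU: "skew_mat_mult Fq P U = skew_mat_mult Fq U Aa"
      unfolding P_def skew_mat_mult_assoc[OF UA U(2,1)] UU'(2) using UA by simp
    have "leading_invertible Fq d b P C"
      using P C lead inv unfolding P_def[symmetric] by unfold_locales auto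
    then have rank: "r * a = d * b"
      by (intro rank_times_eq_dimension_times[OF t_basis_g A _ Aa _ U UU' PU]) (simp_all add: Aa_def row_mul_t)
    define S where "S = (\<Union>k<d. \<Union>l<d. range (poly.coeff (U $$ (k, l))) \<union> range (poly.coeff (U' $$ (k, l))) \<union> {C $$ (k, l)})"
    have fin_coeff: "finite (range (poly.coeff f))" for f :: "'a poly"
    proof -
      have "range (poly.coeff f) \<subseteq> insert 0 (poly.coeff f ` {..Polynomial.degree f})"
      proof
        fix c assume "c \<in> range (poly.coeff f)"
        then obtain j where "c = poly.coeff f j"
          by blast
        then show "c \<in> insert 0 (poly.coeff f ` {..Polynomial.degree f})"
          by (cases "j \<le> Polynomial.degree f") (auto simp: coeff_eq_0)
      qed
      then show ?thesis
        by (rule finite_subset) simp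
    qed
    have "finite S"
      unfolding S_def by (intro finite_UN_I finite_UnI fin_coeff) auto
    then obtain L where L: "finite_extension_field K L" "S \<subseteq> L"
      using finite_extension_containing[OF closure] by blast
    have Lf: "subfield L \<AA>" "K \<subseteq> L"
      using L(1) by (auto simp: finite_extension_field_def)
    have UL: "U \<in> mats_over (polys_over L) d d" "U' \<in> mats_over (polys_over L) d d" "C \<in> mats_over L d d"
      using U C L(2) by (fastforce simp: mats_over_iff polys_over_def S_def)+
    define \<psi> where "\<psi> = (\<lambda>a. skew_mat_mult Fq (skew_mat_mult Fq U (\<phi> a)) U')"
    have \<psi>: "t_module Fq L \<theta> d \<psi>" "t_module_isomorphic Fq L d \<phi> \<psi>"
      unfolding \<psi>_def by (rule t_module_conjugate[OF t_module Lf UL(1,2) UU'])+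
    have \<psi>P: "\<psi> (Polynomial.monom 1 a) = P"
      by (simp add: \<psi>_def P_def Aa_def)
    have "P \<in> mats_over (polys_over L) d d"
      using t_module_hom(1)[OF \<psi>(1) t_in, of a] unfolding \<psi>P .
    then have "tau_coeff b P \<in> mats_over L d d"
      by (auto simp: mats_over_iff tau_coeff_def polys_over_iff)
    moreover have "tau_coeff b P \<noteq> 0\<^sub>m d d"
    proof
      assume "tau_coeff b P = 0\<^sub>m d d"
      then have "(1\<^sub>m d :: 'a mat) = 0\<^sub>m d d"
        using inv(1) C unfolding P_def[symmetric] by simp
      then have "(1\<^sub>m d :: 'a mat) $$ (0, 0) = 0\<^sub>m d d $$ (0, 0)"
        by simp
      then show False
        using d_pos by simp
    qed
    ultimately have "invertible_leading_coeff L d (\<psi> (Polynomial.monom 1 a))"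
      unfolding \<psi>P invertible_leading_coeff_iff using UL(3) lead inv unfolding P_def[symmetric] by blast
    then show ?thesis
      using rank L(1) \<psi> by blast
  qed
  then show thesis
    using that[OF uv] by blast
qed

end

theorem theorem2:
  fixes Fq K :: "'a::alg_closed_field set"
    and \<theta> :: 'a
    and d :: nat
    and w :: rat
    and \<phi> :: "'a poly \<Rightarrow> 'a poly mat"
  assumes "algebraic_closure \<AA> K"
    and "subfield Fq \<AA>" and "finite Fq" and "Fq \<subseteq> K"
    and "t_module Fq K \<theta> d \<phi>"
    and "pure_t_module Fq K d \<phi>"
    and "has_weight Fq K d \<phi> w"
  shows "(\<exists>L \<psi>. finite_extension_field K L \<and> t_module Fq L \<theta> d \<psi> \<and>
           almost_strictly_pure L d \<psi> \<and> t_module_isomorphic Fq L d \<phi> \<psi>) \<and>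
         ((\<exists>L \<psi>. finite_extension_field K L \<and> t_module Fq L \<theta> d \<psi> \<and>
           strictly_pure L d \<psi> \<and> t_module_isomorphic Fq L d \<phi> \<psi>) \<longleftrightarrow> 1 / w \<in> \<int>)"
proof -
  interpret frobenius_field Fq
    using assms(2,3) by (rule frobenius_field.intro)
  have K: "subfield K \<AA>"
    using assms(1) unfolding algebraic_closure_def by blast
  define A where "A = \<phi> (Polynomial.monom 1 1)"
  have "A \<in> mats_over (polys_over K) d d"
    unfolding A_def by (rule t_module_hom(1)[OF assms(5) t_in])
  then interpret t_matrix_of Fq K d A \<phi>
    by (intro t_matrix_of.intro t_matrix.intro t_matrix_axioms.intro t_matrix_of_axioms.intro
        frobenius_field_axioms K) (auto simp: mats_over_iff A_def)
  obtain r where r: "has_rank Fq K d \<phi> r" "w = of_nat d / of_nat r"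
    using assms(7) unfolding has_weight_def by blast
  obtain g p where "t_motive_of Fq K d A r g p \<phi>"
    using r(1) motive_of_basis unfolding has_rank_def by blast
  then interpret t_motive_of Fq K d A r g p \<phi> .
  interpret pure_t_motive Fq K d A r g p \<phi> \<theta>
    by (intro pure_t_motive.intro pure_t_motive_axioms.intro t_motive_of_axioms assms)
  obtain u v :: nat where uv: "0 < u" "0 < v"
    and main: "\<And>a b. 0 < b \<Longrightarrow> a * v = b * u \<Longrightarrow> r * a = d * b \<and>
      (\<exists>L \<psi>. finite_extension_field K L \<and> t_module Fq L \<theta> d \<psi> \<and>
        invertible_leading_coeff L d (\<psi> (Polynomial.monom 1 a)) \<and> t_module_isomorphic Fq L d \<phi> \<psi>)"
    using invertible_leading_coeff_after_extension by metis
  have ru: "r * u = d * v"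
    using main[OF uv(2), of u] by (simp add: mult.commute)
  have "\<exists>L \<psi>. finite_extension_field K L \<and> t_module Fq L \<theta> d \<psi> \<and>
      almost_strictly_pure L d \<psi> \<and> t_module_isomorphic Fq L d \<phi> \<psi>"
  proof -
    obtain L \<psi> where "finite_extension_field K L" "t_module Fq L \<theta> d \<psi>"
        "invertible_leading_coeff L d (\<psi> (Polynomial.monom 1 u))" "t_module_isomorphic Fq L d \<phi> \<psi>"
      using main[OF uv(2), of u] by (auto simp: mult.commute)
    moreover have "1 \<le> u"
      using uv(1) by simp
    ultimately show ?thesis
      unfolding almost_strictly_pure_def by blast
  qed
  moreover have "(\<exists>L \<psi>. finite_extension_field K L \<and> t_module Fq L \<theta> d \<psi> \<and>
      strictly_pure L d \<psi> \<and> t_module_isomorphic Fq L d \<phi> \<psi>) \<longleftrightarrow> 1 / w \<in> \<int>"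
  proof
    assume "\<exists>L \<psi>. finite_extension_field K L \<and> t_module Fq L \<theta> d \<psi> \<and>
      strictly_pure L d \<psi> \<and> t_module_isomorphic Fq L d \<phi> \<psi>"
    then obtain s where "r = d * s"
      using strictly_pure_rank unfolding finite_extension_field_def by blast
    then have "1 / w = of_nat s"
      using r(2) d_pos by simp
    then show "1 / w \<in> \<int>"
      by simp
  next
    assume "1 / w \<in> \<int>"
    then obtain z :: int where z: "1 / w = of_int z"
      by (elim Ints_cases)
    then have "(of_nat r :: rat) = of_nat d * of_int z"
      using r(2) d_pos by (simp add: field_simps)
    then have "(of_int (int r) :: rat) = of_int (int d * z)"
      by simp
    then have rz: "int r = int d * z"
      by (simp only: of_int_eq_iff)
    have "0 < r"
      using ru d_pos uv by (metis mult_is_0 not_gr_zero)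
    then have "0 < z"
      using rz by (metis of_nat_0_le_iff of_nat_0_less_iff zero_less_mult_pos zero_less_mult_pos2 d_pos)
    then obtain s where s: "z = int s" "0 < s"
      by (metis zero_less_imp_eq_int)
    have "r = d * s"
      using rz s(1) by (metis of_nat_eq_iff of_nat_mult)
    then have "d * (s * u) = d * v"
      using ru by (simp add: mult.assoc)
    then have "1 * v = s * u"
      using d_pos by simp
    then show "\<exists>L \<psi>. finite_extension_field K L \<and> t_module Fq L \<theta> d \<psi> \<and>
      strictly_pure L d \<psi> \<and> t_module_isomorphic Fq L d \<phi> \<psi>"
      using main[OF s(2)] unfolding strictly_pure_def by blast
  qed
  ultimately show ?thesis
    by blast
qed

end
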